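(* There exist universal constants $C_8, C_9>0$ such that the following holds. Let $n,p$ be positive integers, let $m\ge n$ and $2\le s\le np$ be integers, and let $0<\delta_s\le 1$. Let $\Phi$ be the random $m\times np$ matrix defined in the context. If \[ m\ \ge\ C_9\,\delta_s^{-2}\, s\,\log^6(np), \] then \[ \mathbb{P}\big\{\|I-\Phi^*\Phi\|_s>\delta_s\big\}\ \le\ C_8\,(np)^{-1}. \]
   Context: Probe signals: for $i=1,\dots,p$ and $t=1,\dots,m$, the entries $\phi_i(t)$ are independent Gaussian random variables with mean $0$ and variance $1/m$. For each $i$, $\Phi_i$ is the $m\times n$ matrix with entries $\Phi_i(r,c)=\phi_i\big(((n+r-c-1)\bmod m)+1\big)$ for $1\le r\le m$, $1\le c\le n$; these are the first $n$ columns of an $m\times m$ circulant matrix. The matrix $\Phi=[\Phi_1\ \cdots\ \Phi_p]$ is their horizontal concatenation, of size $m\times np$. For an $N\times N$ matrix $A$, define \[ \|A\|_s=\sup\{|y^*Ax| : |\Gamma|\le s,\ x,y\text{ supported on }\Gamma\subset\{1,\dots,N\},\ \|x\|_2=\|y\|_2=1\}. \] $I$ is the $np\times np$ identity matrix. *)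

theory Defs
  imports "HOL-Probability.Probability"
begin

definition probe_space :: "nat \<Rightarrow> nat \<Rightarrow> (nat \<times> nat \<Rightarrow> real) measure" where
  "probe_space p m =
     PiM ({1..p} \<times> {1..m}) (\<lambda>_. density lborel (normal_density 0 (1 / sqrt (real m))))"

text \<open>The m x np matrix Phi = [Phi_1 ... Phi_p], indices 1-based:
  column c (1 <= c <= np) lies in block i = (c-1) div n + 1, local column
  c' = (c-1) mod n + 1, and Phi_i(r,c') = phi_i(((n + r - c' - 1) mod m) + 1).\<close>
definition Phi_mat :: "nat \<Rightarrow> nat \<Rightarrow> (nat \<times> nat \<Rightarrow> real) \<Rightarrow> nat \<Rightarrow> nat \<Rightarrow> real" where
  "Phi_mat n m \<phi> r c =
     (let i = (c - 1) div n + 1; c' = (c - 1) mod n + 1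
      in \<phi> (i, ((n + r - c' - 1) mod m) + 1))"

definition gram_defect :: "nat \<Rightarrow> nat \<Rightarrow> (nat \<times> nat \<Rightarrow> real) \<Rightarrow> nat \<Rightarrow> nat \<Rightarrow> real" where
  "gram_defect n m \<phi> a b =
     (if a = b then 1 else 0) - (\<Sum>r\<in>{1..m}. Phi_mat n m \<phi> r a * Phi_mat n m \<phi> r b)"

definition s_norm :: "nat \<Rightarrow> nat \<Rightarrow> (nat \<Rightarrow> nat \<Rightarrow> real) \<Rightarrow> real" where
  "s_norm N s A = Sup { \<bar>\<Sum>a\<in>{1..N}. \<Sum>b\<in>{1..N}. y a * A a b * x b\<bar> | x y \<Gamma>.
        \<Gamma> \<subseteq> {1..N} \<and> card \<Gamma> \<le> s \<and>
        (\<forall>a. a \<notin> \<Gamma> \<longrightarrow> x a = 0) \<and> (\<forall>a. a \<notin> \<Gamma> \<longrightarrow> y a = 0) \<and>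
        (\<Sum>a\<in>{1..N}. (x a)\<^sup>2) = 1 \<and> (\<Sum>a\<in>{1..N}. (y a)\<^sup>2) = 1 }"

end

theory Submission
  imports Defs
begin

text \<open>Since the random matrix enters quadratically, write \<open>Z x = \<parallel>\<Phi>x\<parallel>\<^sup>2\<close> and compare two
  independent copies \<open>\<phi>\<close>, \<open>\<phi>'\<close> of the probes. The rotated copies \<open>(\<phi> + \<phi>')/\<surd>2\<close> and \<open>(\<phi> - \<phi>')/\<surd>2\<close>
  are again independent with the same law, and \<open>Z x \<phi> - Z x \<phi>'\<close> is twice the inner product of the two
  images of \<open>x\<close>. Chain this decoupled form along successive approximations of the points of a finite
  net of sparse vectors: given one copy, each increment is a centred Gaussian in the other one, whose
  deviation is at most the operator norm of the increment times the norm of an image of a net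
  point, so that a union bound over all increments needs no conditioning. The operator norm is the
  maximum over frequencies of the Euclidean norm of the block Fourier transforms, and the covering numbers of sparse vectors for it
  come from Maurey's empirical method. Hence, outside a small event,
  \<open>\<bar>Z x \<phi> - Z x \<phi>'\<bar> \<le> R (W \<phi> + W \<phi>')\<close> on the net, where \<open>W\<^sup>2 = max Z\<close>. This inequality bounds itself,
  because for a point \<open>x\<close> chosen from \<open>\<phi>\<close> alone \<open>Z x \<phi>'\<close> is close to its mean with probability at
  least \<open>3/4\<close>.\<close>

section \<open>Maurey's empirical method\<close>

text \<open>The logarithms have three sources. Level \<open>j\<close> of the chain has entropy of
  order \<open>2 ^ j * ln N9\<close>, while Maurey's method with \<open>2 ^ j\<close> samples brings
  the squared size of its increments down to order \<open>q * s / 2 ^ j\<close>; here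
  \<open>q\<close>, of order \<open>log n\<close>, is the price of a maximum over polynomially many
  frequencies. The product is independent of the level, so each of the \<open>J\<close> levels, with
  \<open>J\<close> of order \<open>log s\<close>, costs the same multiple of
  \<open>sqrt (q * s * ln N9 / m)\<close>. The main obstacle is that the deviation of an increment
  is proportional to a random norm for which no bound is known beforehand. The exceptional events
  therefore keep this norm on their right-hand side. To make it a value covered by \<open>W\<close>,
  every point of the chain has to be a net point, and the bound is finally resolved pathwise, at one
  fixed pair of copies, without any estimate of an expected supremum.\<close>

lemma exp_le_quadratic:
  fixes y :: real
  assumes "y \<le> 1"
  shows "exp y \<le> 1 + y + y\<^sup>2"
proof (cases "0 \<le> y")
  case True
  then show ?thesis using exp_bound assms by blast
next
  case False
  \<comment> \<open>Negative \<open>y\<close> is not bounded below, so no Taylor remainder is used: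
    multiplication by \<open>1 - y > 0\<close> reduces the claim to
    \<open>1 \<le> 1 - y ^ 3\<close>.\<close>
  have "1 - y \<le> exp (- y)" using exp_ge_add_one_self[of "- y"] by simp
  then have "exp y * (1 - y) \<le> exp y * exp (- y)" by (intro mult_left_mono) auto
  also have "\<dots> \<le> 1 - y ^ 3" using False by (simp add: exp_minus_inverse power_less_zero_eq)
  also have "\<dots> = (1 + y + y\<^sup>2) * (1 - y)" by (simp add: algebra_simps power2_eq_square power3_eq_cube)
  finally show ?thesis using False by (simp add: mult_le_cancel_right)
qed

text \<open>Since \<open>\<eta>\<close> has mean zero, only its second-order effect survives in the
  \<open>q\<close>-th moment. In the application \<open>X\<close> dominates the squared norm of a
  partial sum and \<open>\<eta>\<close> is the cross term with a new vector of length at most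
  \<open>B\<close>, whence the bound \<open>2 * sqrt X * B\<close>.\<close>

lemma weighted_power_mean_le:
  fixes X B :: real and \<eta> c :: "'a \<Rightarrow> real" and q :: nat
  assumes A: "finite A" and c0: "\<And>a. a \<in> A \<Longrightarrow> 0 \<le> c a" and c1: "(\<Sum>a\<in>A. c a) = 1"
    and X: "0 < X" and B: "0 \<le> B" and q: "1 \<le> q"
    and nn: "\<And>a. a \<in> A \<Longrightarrow> 0 \<le> X + \<eta> a"
    and bd: "\<And>a. a \<in> A \<Longrightarrow> \<bar>\<eta> a\<bar> \<le> 2 * sqrt X * B"
    and mean: "(\<Sum>a\<in>A. c a * \<eta> a) = 0"
  shows "(\<Sum>a\<in>A. c a * (X + \<eta> a) ^ q) \<le> (X + 4 * q * B\<^sup>2) ^ q"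
\<comment> \<open>Below this threshold the fluctuation is pointwise at most
  \<open>4 * q * B\<^sup>2\<close>. Above it, \<open>q * \<eta> a / X\<close> is at most 1 in
  absolute value, as the quadratic bound on \<open>exp\<close> requires.\<close>
proof (cases "sqrt X \<le> 2 * q * B")
  case True
  have "(\<Sum>a\<in>A. c a * (X + \<eta> a) ^ q) \<le> (\<Sum>a\<in>A. c a * (X + 4 * q * B\<^sup>2) ^ q)"
  proof (intro sum_mono mult_left_mono power_mono c0 nn)
    fix a assume a: "a \<in> A"
    have "2 * sqrt X * B \<le> 2 * (2 * q * B) * B"
      using True B by (intro mult_right_mono[OF mult_left_mono]) auto
    then have "2 * sqrt X * B \<le> 4 * q * B\<^sup>2" by (simp add: power2_eq_square)
    then show "X + \<eta> a \<le> X + 4 * q * B\<^sup>2"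
      using bd[OF a] by linarith
  qed auto
  also have "\<dots> = (X + 4 * q * B\<^sup>2) ^ q"
    by (simp add: c1 flip: sum_distrib_right)
  finally show ?thesis .
next
  case False
  define y where "y a = q * \<eta> a / X" for a
  have sq: "sqrt X * sqrt X = X" and sp: "sqrt X > 0" using X by auto
  have y: "\<bar>y a\<bar> \<le> 2 * q * B / sqrt X" if "a \<in> A" for a
  proof -
    have "\<bar>y a\<bar> = q * \<bar>\<eta> a\<bar> / X" using X by (simp add: y_def abs_mult)
    also have "\<dots> \<le> q * (2 * sqrt X * B) / X"
      using bd[OF that] X by (intro divide_right_mono mult_left_mono) auto
    also have "\<dots> = 2 * q * B / sqrt X"
      using sp sq by (simp add: field_simps)
    finally show ?thesis .
  qed
  have y1: "\<bar>y a\<bar> \<le> 1" if "a \<in> A" for a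
    by (rule order_trans[OF y[OF that]]) (use False sp in \<open>simp add: divide_le_eq\<close>)
  have y2: "(y a)\<^sup>2 \<le> 4 * q\<^sup>2 * B\<^sup>2 / X" if "a \<in> A" for a
  proof -
    have "(y a)\<^sup>2 \<le> (2 * q * B / sqrt X)\<^sup>2" using y[OF that] by (metis power2_abs power_mono abs_ge_zero)
    also have "\<dots> = 4 * q\<^sup>2 * B\<^sup>2 / X" using X by (simp add: power_divide power_mult_distrib)
    finally show ?thesis .
  qed
  have step: "(X + \<eta> a) ^ q \<le> X ^ q * (1 + y a + 4 * q\<^sup>2 * B\<^sup>2 / X)" if a: "a \<in> A" for a
  proof -
    have "(X + \<eta> a) ^ q = X ^ q * (1 + \<eta> a / X) ^ q"
      using X by (simp add: field_simps flip: power_mult_distrib)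
    also have "(1 + \<eta> a / X) ^ q \<le> exp (\<eta> a / X) ^ q"
      using nn[OF a] X by (intro power_mono exp_ge_add_one_self) (simp add: field_simps)
    also have "exp (\<eta> a / X) ^ q = exp (y a)"
      by (simp add: y_def flip: exp_of_nat_mult)
    also have "exp (y a) \<le> 1 + y a + (y a)\<^sup>2"
      by (rule exp_le_quadratic) (use y1[OF a] in auto)
    also have "1 + y a + (y a)\<^sup>2 \<le> 1 + y a + 4 * q\<^sup>2 * B\<^sup>2 / X" using y2[OF a] by simp
    finally show ?thesis using X by simp
  qed
  have "(\<Sum>a\<in>A. c a * (X + \<eta> a) ^ q) \<le> (\<Sum>a\<in>A. c a * (X ^ q * (1 + y a + 4 * q\<^sup>2 * B\<^sup>2 / X)))"
    by (intro sum_mono mult_left_mono step c0)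
  also have "\<dots> = X ^ q * ((\<Sum>a\<in>A. c a) * (1 + 4 * q\<^sup>2 * B\<^sup>2 / X) + (\<Sum>a\<in>A. c a * \<eta> a) * q / X)"
    by (simp add: y_def sum_distrib_left sum_distrib_right sum.distrib algebra_simps sum_divide_distrib)
  also have "\<dots> = X ^ q * (1 + q * (4 * q * B\<^sup>2 / X))"
    by (simp add: c1 mean power2_eq_square)
  \<comment> \<open>Bernoulli turns the second-order term back into a \<open>q\<close>-th power, so
    that the estimate can be iterated.\<close>
  also have "\<dots> \<le> X ^ q * (1 + 4 * q * B\<^sup>2 / X) ^ q"
    using X by (intro mult_left_mono Bernoulli_inequality) (auto intro: order_trans[of _ 0])
  also have "\<dots> = (X + 4 * q * B\<^sup>2) ^ q"
    using X by (simp add: field_simps flip: power_mult_distrib)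
  finally show ?thesis .
qed

lemma sum_inner_Cauchy_Schwarz:
  fixes u v :: "'d \<Rightarrow> 'e::real_inner"
  shows "\<bar>\<Sum>d\<in>D. inner (u d) (v d)\<bar> \<le> sqrt (\<Sum>d\<in>D. (norm (u d))\<^sup>2) * sqrt (\<Sum>d\<in>D. (norm (v d))\<^sup>2)"
proof -
  have "\<bar>\<Sum>d\<in>D. inner (u d) (v d)\<bar> \<le> (\<Sum>d\<in>D. \<bar>norm (u d)\<bar> * \<bar>norm (v d)\<bar>)"
    by (rule order_trans[OF sum_abs]) (auto intro!: sum_mono simp: Cauchy_Schwarz_ineq2)
  also have "\<dots> \<le> L2_set (\<lambda>d. norm (u d)) D * L2_set (\<lambda>d. norm (v d)) D"
    by (rule L2_set_mult_ineq)
  finally show ?thesis by (simp add: L2_set_def)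
qed

text \<open>Maurey's empirical method without randomness: the samples are picked one at a time so that
  a sum of \<open>q\<close>-th powers of squared norms grows no faster than on average.\<close>

lemma maurey_power_sum:
  fixes v :: "'a \<Rightarrow> 'k \<Rightarrow> 'd \<Rightarrow> 'e::real_inner" and c :: "'a \<Rightarrow> real" and B S :: real and q L :: nat
  assumes A: "finite A" and K: "finite K" and D: "finite D"
    and c0: "\<And>a. a \<in> A \<Longrightarrow> 0 \<le> c a" and c1: "(\<Sum>a\<in>A. c a) = 1"
    and mean: "\<And>k d. k \<in> K \<Longrightarrow> d \<in> D \<Longrightarrow> (\<Sum>a\<in>A. c a *\<^sub>R v a k d) = 0"
    and bd: "\<And>a k. a \<in> A \<Longrightarrow> k \<in> K \<Longrightarrow> (\<Sum>d\<in>D. (norm (v a k d))\<^sup>2) \<le> B"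
    and B: "0 < B" and q: "1 \<le> q" and S: "0 \<le> S"
  shows "\<exists>g. (\<forall>l. g l \<in> A) \<and>
    (\<Sum>k\<in>K. (S + (\<Sum>d\<in>D. (norm (\<Sum>l<L. v (g l) k d))\<^sup>2)) ^ q) \<le> card K * (S + 5 * q * B * L) ^ q"
  using S
proof (induction L arbitrary: S)
  case 0
  obtain a where "a \<in> A" using c1 by (metis sum.empty zero_neq_one ex_in_conv)
  then show ?case by (intro exI[of _ "\<lambda>_. a"]) simp
next
  case (Suc L)
  \<comment> \<open>The first \<open>L\<close> samples are chosen for an offset enlarged by
    \<open>5 * q * B\<close>, which is what the last sample may add on average; hence
    \<open>S\<close> is generalized in the induction.\<close>
  have "0 \<le> S + 5 * q * B" using Suc.prems B by auto
  from Suc.IH[OF this] obtain g where gA: "\<forall>l. g l \<in> A"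
    and g: "(\<Sum>k\<in>K. (S + 5 * q * B + (\<Sum>d\<in>D. (norm (\<Sum>l<L. v (g l) k d))\<^sup>2)) ^ q)
      \<le> card K * (S + 5 * q * B + 5 * q * B * L) ^ q" by blast
  define w where "w k d = (\<Sum>l<L. v (g l) k d)" for k d
  define Q where "Q k = (\<Sum>d\<in>D. (norm (w k d))\<^sup>2)" for k
  define \<Psi> where "\<Psi> a = (\<Sum>k\<in>K. (S + (\<Sum>d\<in>D. (norm (w k d + v a k d))\<^sup>2)) ^ q)" for a
  have Q0: "0 \<le> Q k" for k unfolding Q_def by (intro sum_nonneg) auto
  have key: "(\<Sum>a\<in>A. c a * (S + (\<Sum>d\<in>D. (norm (w k d + v a k d))\<^sup>2)) ^ q) \<le> (S + 5 * q * B + Q k) ^ q"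
    if k: "k \<in> K" for k
  proof -
    define X where "X = S + Q k + B"
    define \<eta> where "\<eta> a = 2 * (\<Sum>d\<in>D. inner (w k d) (v a k d))" for a
    have X0: "X > 0" unfolding X_def using Suc.prems Q0[of k] B by linarith
    have le: "S + (\<Sum>d\<in>D. (norm (w k d + v a k d))\<^sup>2) \<le> X + \<eta> a" if a: "a \<in> A" for a
    proof -
      have "(\<Sum>d\<in>D. (norm (w k d + v a k d))\<^sup>2)
          = Q k + \<eta> a + (\<Sum>d\<in>D. (norm (v a k d))\<^sup>2)"
      proof -
        have "(norm (w k d + v a k d))\<^sup>2 = (norm (w k d))\<^sup>2 + 2 * inner (w k d) (v a k d) + (norm (v a k d))\<^sup>2" for d
          by (simp add: power2_norm_eq_inner inner_add_left inner_add_right inner_commute[of "v a k d" "w k d"])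
        then show ?thesis by (simp add: Q_def \<eta>_def sum_distrib_left sum.distrib)
      qed
      then show ?thesis using bd[OF a k] by (simp add: X_def)
    qed
    have nn: "0 \<le> S + (\<Sum>d\<in>D. (norm (w k d + v a k d))\<^sup>2)" for a
      using Suc.prems by (auto intro!: add_nonneg_nonneg sum_nonneg)
    have "(\<Sum>a\<in>A. c a * (S + (\<Sum>d\<in>D. (norm (w k d + v a k d))\<^sup>2)) ^ q) \<le> (\<Sum>a\<in>A. c a * (X + \<eta> a) ^ q)"
      by (intro sum_mono mult_left_mono power_mono le nn c0)
    \<comment> \<open>\<open>X\<close> already contains one \<open>B\<close> for the square of the
      new vector, and the cross term adds \<open>4 * q * B\<close>; together this is at most
      \<open>5 * q * B\<close>.\<close>
    also have "\<dots> \<le> (X + 4 * q * (sqrt B)\<^sup>2) ^ q"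
    proof (rule weighted_power_mean_le[OF A c0 c1 X0 _ q])
      show "0 \<le> sqrt B" using B by simp
      show "0 \<le> X + \<eta> a" if "a \<in> A" for a using le[OF that] nn[of a] by linarith
      show "\<bar>\<eta> a\<bar> \<le> 2 * sqrt X * sqrt B" if a: "a \<in> A" for a
      proof -
        have "\<bar>\<eta> a\<bar> \<le> 2 * (sqrt (Q k) * sqrt (\<Sum>d\<in>D. (norm (v a k d))\<^sup>2))"
          using sum_inner_Cauchy_Schwarz[of "w k" "v a k" D] by (simp add: \<eta>_def abs_mult Q_def)
        also have "\<dots> \<le> 2 * (sqrt X * sqrt B)"
          using bd[OF a k] Suc.prems B Q0[of k]
          by (intro mult_left_mono mult_mono real_sqrt_le_mono) (auto simp: X_def sum_nonneg)
        finally show ?thesis by simp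
      qed
      have "(\<Sum>a\<in>A. c a * \<eta> a) = 2 * (\<Sum>d\<in>D. inner (w k d) (\<Sum>a\<in>A. c a *\<^sub>R v a k d))"
        by (simp add: \<eta>_def sum_distrib_left inner_sum_right sum.swap[of _ A] mult_ac)
      then show "(\<Sum>a\<in>A. c a * \<eta> a) = 0" using mean[OF k] by simp
    qed
    also have "\<dots> \<le> (S + 5 * q * B + Q k) ^ q"
    proof (rule power_mono)
      have "B \<le> q * B" using q B by simp
      then show "X + 4 * q * (sqrt B)\<^sup>2 \<le> S + 5 * q * B + Q k" using B by (simp add: X_def)
      show "0 \<le> X + 4 * q * (sqrt B)\<^sup>2" using X0 B by simp
    qed
    finally show ?thesis .
  qed
  have "(\<Sum>a\<in>A. c a * \<Psi> a) = (\<Sum>k\<in>K. \<Sum>a\<in>A. c a * (S + (\<Sum>d\<in>D. (norm (w k d + v a k d))\<^sup>2)) ^ q)"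
    by (simp add: \<Psi>_def sum_distrib_left sum.swap[of _ A])
  also have "\<dots> \<le> (\<Sum>k\<in>K. (S + 5 * q * B + Q k) ^ q)" by (intro sum_mono key)
  also have "\<dots> \<le> card K * (S + 5 * q * B * Suc L) ^ q"
    using g by (simp add: w_def Q_def algebra_simps)
  finally have avg: "(\<Sum>a\<in>A. c a * \<Psi> a) \<le> card K * (S + 5 * q * B * Suc L) ^ q" .
  \<comment> \<open>What is averaged is the sum over all \<open>k\<close>, so a single choice of
    sample serves every \<open>k\<close> at once.\<close>
  have "\<exists>a\<in>A. \<Psi> a \<le> card K * (S + 5 * q * B * Suc L) ^ q"
  proof (rule ccontr)
    let ?C = "card K * (S + 5 * q * B * Suc L) ^ q"
    assume "\<not> ?thesis"
    then have gt: "\<And>a. a \<in> A \<Longrightarrow> ?C < \<Psi> a" by force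
    obtain a where a: "a \<in> A" "c a \<noteq> 0" using c1 by (metis sum.neutral zero_neq_one)
    then have ca: "0 < c a" using c0 by force
    have "(\<Sum>a\<in>A. c a * ?C) < (\<Sum>a\<in>A. c a * \<Psi> a)"
    proof (rule sum_strict_mono_ex1[OF A])
      show "\<forall>x\<in>A. c x * ?C \<le> c x * \<Psi> x"
        by (intro ballI mult_left_mono c0) (blast intro: less_imp_le[OF gt])+
      show "\<exists>x\<in>A. c x * ?C < c x * \<Psi> x"
        using gt a ca by (intro bexI[of _ a] mult_strict_left_mono)
    qed
    moreover have "(\<Sum>a\<in>A. c a * ?C) = ?C" by (simp add: c1 flip: sum_distrib_right)
    ultimately show False using avg by linarith
  qed
  then obtain a where a: "a \<in> A" "\<Psi> a \<le> card K * (S + 5 * q * B * Suc L) ^ q" by blast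
  have "(\<Sum>l<Suc L. v ((g(L := a)) l) k d) = w k d + v a k d" for k d
    by (simp add: w_def)
  then have "(\<Sum>k\<in>K. (S + (\<Sum>d\<in>D. (norm (\<Sum>l<Suc L. v ((g(L := a)) l) k d))\<^sup>2)) ^ q) = \<Psi> a"
    unfolding \<Psi>_def by presburger
  with a gA show ?case by (intro exI[of _ "g(L := a)"]) auto
qed

lemma norm_square_convex_sum:
  fixes v :: "'a \<Rightarrow> 'e::real_normed_vector" and c :: "'a \<Rightarrow> real"
  assumes "finite A" "\<And>a. a \<in> A \<Longrightarrow> 0 \<le> c a" "(\<Sum>a\<in>A. c a) = 1"
  shows "(norm (\<Sum>a\<in>A. c a *\<^sub>R v a))\<^sup>2 \<le> (\<Sum>a\<in>A. c a * (norm (v a))\<^sup>2)"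
proof -
  have "norm (\<Sum>a\<in>A. c a *\<^sub>R v a) \<le> (\<Sum>a\<in>A. c a * norm (v a))"
    using assms(2) by (intro order_trans[OF norm_sum]) (auto intro!: sum_mono)
  then have "(norm (\<Sum>a\<in>A. c a *\<^sub>R v a))\<^sup>2 \<le> (\<Sum>a\<in>A. c a * norm (v a))\<^sup>2"
    by (intro power_mono) auto
  also have "\<dots> \<le> (\<Sum>a\<in>A. c a * (norm (v a))\<^sup>2)"
  proof -
    define \<mu> where "\<mu> = (\<Sum>a\<in>A. c a * norm (v a))"
    have "0 \<le> (\<Sum>a\<in>A. c a * (norm (v a) - \<mu>)\<^sup>2)" using assms(2) by (intro sum_nonneg) auto
    also have "\<dots> = (\<Sum>a\<in>A. c a * (norm (v a))\<^sup>2) - 2 * \<mu> * (\<Sum>a\<in>A. c a * norm (v a)) + \<mu>\<^sup>2 * (\<Sum>a\<in>A. c a)"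
      by (simp add: power2_diff sum_distrib_left sum_distrib_right sum.distrib sum_subtractf algebra_simps)
    finally show ?thesis by (simp add: assms(3) \<mu>_def[symmetric] power2_eq_square)
  qed
  finally show ?thesis .
qed

text \<open>A maximum over \<open>K\<close> is at most the \<open>q\<close>-th root of a sum of
  \<open>q\<close>-th powers, and \<open>card K \<le> 2 ^ q\<close> makes this cost a factor 2. The
  constant is \<open>40 = 2 * 5 * 4\<close>: this 2, the 5 of \<open>maurey_power_sum\<close>, and 4
  for centring the vectors at their mean.\<close>

lemma maurey_empirical:
  fixes v :: "'a \<Rightarrow> 'k \<Rightarrow> 'd \<Rightarrow> 'e::real_inner" and c :: "'a \<Rightarrow> real" and B S :: real and q L :: nat
  assumes A: "finite A" and K: "finite K" and D: "finite D"
    and c0: "\<And>a. a \<in> A \<Longrightarrow> 0 \<le> c a" and c1: "(\<Sum>a\<in>A. c a) = 1"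
    and bd: "\<And>a k. a \<in> A \<Longrightarrow> k \<in> K \<Longrightarrow> (\<Sum>d\<in>D. (norm (v a k d))\<^sup>2) \<le> B"
    and B: "0 < B" and q: "1 \<le> q" "card K \<le> 2 ^ q" and L: "0 < L"
  shows "\<exists>g. (\<forall>l. g l \<in> A) \<and> (\<forall>k\<in>K.
    (\<Sum>d\<in>D. (norm ((\<Sum>a\<in>A. c a *\<^sub>R v a k d) - (1 / L) *\<^sub>R (\<Sum>l<L. v (g l) k d)))\<^sup>2) \<le> 40 * q * B / L)"
proof -
  define \<mu> where "\<mu> k d = (\<Sum>a\<in>A. c a *\<^sub>R v a k d)" for k d
  define v' where "v' a k d = v a k d - \<mu> k d" for a k d
  have \<mu>B: "(\<Sum>d\<in>D. (norm (\<mu> k d))\<^sup>2) \<le> B" if k: "k \<in> K" for k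
  proof -
    have "(\<Sum>d\<in>D. (norm (\<mu> k d))\<^sup>2) \<le> (\<Sum>d\<in>D. \<Sum>a\<in>A. c a * (norm (v a k d))\<^sup>2)"
      unfolding \<mu>_def by (intro sum_mono norm_square_convex_sum A c0 c1)
    also have "\<dots> = (\<Sum>a\<in>A. c a * (\<Sum>d\<in>D. (norm (v a k d))\<^sup>2))"
      by (simp add: sum_distrib_left sum.swap[of _ D])
    also have "\<dots> \<le> (\<Sum>a\<in>A. c a * B)"
      by (intro sum_mono mult_left_mono bd c0 k)
    finally show ?thesis by (simp add: c1 flip: sum_distrib_right)
  qed
  have v'B: "(\<Sum>d\<in>D. (norm (v' a k d))\<^sup>2) \<le> 4 * B" if a: "a \<in> A" and k: "k \<in> K" for a k
  proof -
    have "(norm (v' a k d))\<^sup>2 \<le> 2 * (norm (v a k d))\<^sup>2 + 2 * (norm (\<mu> k d))\<^sup>2" for d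
    proof -
      have "(norm (v' a k d))\<^sup>2 \<le> (norm (v a k d) + norm (\<mu> k d))\<^sup>2"
        unfolding v'_def by (intro power_mono norm_triangle_ineq4) auto
      also have "\<dots> \<le> 2 * (norm (v a k d))\<^sup>2 + 2 * (norm (\<mu> k d))\<^sup>2"
        using sum_squares_bound[of "norm (v a k d)" "norm (\<mu> k d)"] by (simp add: power2_sum)
      finally show ?thesis .
    qed
    then have "(\<Sum>d\<in>D. (norm (v' a k d))\<^sup>2) \<le> (\<Sum>d\<in>D. 2 * (norm (v a k d))\<^sup>2 + 2 * (norm (\<mu> k d))\<^sup>2)"
      by (intro sum_mono)
    also have "\<dots> = 2 * (\<Sum>d\<in>D. (norm (v a k d))\<^sup>2) + 2 * (\<Sum>d\<in>D. (norm (\<mu> k d))\<^sup>2)"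
      by (simp add: sum.distrib sum_distrib_left)
    finally show ?thesis using bd[OF a k] \<mu>B[OF k] by simp
  qed
  have mean: "(\<Sum>a\<in>A. c a *\<^sub>R v' a k d) = 0" for k d
    by (simp add: v'_def \<mu>_def scaleR_diff_right sum_subtractf c1 flip: scaleR_sum_left)
  have "0 < 4 * B" using B by simp
  from maurey_power_sum[where v=v' and c=c and L=L and S=0, OF A K D c0 c1 mean v'B this q(1)]
  obtain g where gA: "\<forall>l. g l \<in> A"
    and g: "(\<Sum>k\<in>K. (\<Sum>d\<in>D. (norm (\<Sum>l<L. v' (g l) k d))\<^sup>2) ^ q) \<le> card K * (5 * q * (4 * B) * L) ^ q"
    by auto
  have "(\<Sum>d\<in>D. (norm (\<mu> k d - (1 / L) *\<^sub>R (\<Sum>l<L. v (g l) k d)))\<^sup>2) \<le> 40 * q * B / L" if k: "k \<in> K" for k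
  proof -
    let ?Y = "\<Sum>d\<in>D. (norm (\<Sum>l<L. v' (g l) k d))\<^sup>2"
    have Y0: "?Y \<ge> 0" by (intro sum_nonneg) auto
    have "?Y ^ q \<le> (\<Sum>k\<in>K. (\<Sum>d\<in>D. (norm (\<Sum>l<L. v' (g l) k d))\<^sup>2) ^ q)"
      using k K by (intro member_le_sum[where f="\<lambda>k. (\<Sum>d\<in>D. (norm (\<Sum>l<L. v' (g l) k d))\<^sup>2) ^ q"]) (auto intro!: sum_nonneg zero_le_power)
    also have "\<dots> \<le> 2 ^ q * (5 * q * (4 * B) * L) ^ q"
    proof -
      have "real (card K) \<le> 2 ^ q" using q(2) by (metis of_nat_le_iff of_nat_numeral of_nat_power)
      then show ?thesis using g B by (elim order_trans) (intro mult_right_mono, auto)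
    qed
    also have "\<dots> = (40 * q * B * L) ^ q"
      unfolding power_mult_distrib[symmetric] by (rule arg_cong[of _ _ "\<lambda>x. x ^ q"]) simp
    finally have "?Y \<le> 40 * q * B * L"
      using q(1) B power_mono_iff[of ?Y "40 * q * B * L" q] Y0 by auto
    moreover have "(\<Sum>d\<in>D. (norm (\<mu> k d - (1 / L) *\<^sub>R (\<Sum>l<L. v (g l) k d)))\<^sup>2) = ?Y / L\<^sup>2"
    proof -
      have "\<mu> k d - (1 / L) *\<^sub>R (\<Sum>l<L. v (g l) k d) = - (1 / L) *\<^sub>R (\<Sum>l<L. v' (g l) k d)" for d
        using L by (simp add: v'_def sum_subtractf scaleR_diff_right sum_constant_scaleR)
      then show ?thesis by (simp add: power_divide sum_divide_distrib norm_divide)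
    qed
    moreover have "40 * q * B * L / L\<^sup>2 = 40 * q * B / L" using L by (simp add: power2_eq_square)
    ultimately show ?thesis using divide_right_mono[of ?Y "40 * q * B * L" "L\<^sup>2"] by simp
  qed
  with gA show ?thesis unfolding \<mu>_def by blast
qed

section \<open>Channel matrices in the Fourier domain\<close>

lemma sum_cis_mult_cnj:
  fixes M u v :: nat
  assumes "u \<in> {1..M}" "v \<in> {1..M}"
  shows "(\<Sum>\<omega><M. cis (2 * pi * \<omega> / M * u) * cnj (cis (2 * pi * \<omega> / M * v))) = (if u = v then of_nat M else 0)"
proof -
  define z where "z = cis (2 * pi * (real u - real v) / M)"
  have M: "M > 0" using assms by auto
  have "cis (2 * pi * \<omega> / M * u) * cnj (cis (2 * pi * \<omega> / M * v)) = z ^ \<omega>" for \<omega> :: nat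
    unfolding z_def Complex.DeMoivre cis_cnj cis_mult by (rule arg_cong[of _ _ cis]) (use M in \<open>simp add: field_simps\<close>)
  then have sum: "(\<Sum>\<omega><M. cis (2 * pi * \<omega> / M * u) * cnj (cis (2 * pi * \<omega> / M * v))) = (\<Sum>\<omega><M. z ^ \<omega>)"
    by simp
  show ?thesis
  proof (cases "u = v")
    case True
    then show ?thesis using sum by (simp add: z_def)
  next
    case False
    have "z \<noteq> 1"
    proof
      assume "z = 1"
      then have "cos (2 * pi * (real u - real v) / M) = 1" by (metis z_def Re_complex_of_real cis.sel(1) of_real_1)
      then obtain k :: int where "2 * pi * (real u - real v) / M = of_int k * 2 * pi"
        using cos_one_2pi_int by blast
      then have "pi * (2 * (real u - real v)) = pi * (2 * (k * M))" using M by (simp add: field_simps)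
      then have "real u - real v = k * M" by (simp only: mult_cancel_left) simp
      then have eq: "int u - int v = k * int M" by (metis of_int_diff of_int_eq_iff of_int_mult of_int_of_nat_eq)
      moreover have "\<bar>int u - int v\<bar> < int M" using assms by auto
      ultimately have "\<bar>k\<bar> * int M < int M" by (simp add: abs_mult)
      then have "k = 0" using M by auto
      then show False using eq False by simp
    qed
    moreover have "z ^ M = 1"
    proof -
      have "z ^ M = cis (2 * pi * real u) * cis (- (2 * pi * real v))"
        unfolding z_def Complex.DeMoivre cis_mult by (rule arg_cong[of _ _ cis]) (use M in \<open>simp add: field_simps\<close>)
      moreover have "cis (2 * pi * real k) = 1" for k :: nat by simp
      moreover have "cis (- (2 * pi * real v)) = 1"
        using \<open>cis (2 * pi * real v) = 1\<close> by (metis cis_cnj complex_cnj_one)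
      ultimately show ?thesis by simp
    qed
    ultimately show ?thesis using sum False by (simp add: geometric_sum)
  qed
qed

text \<open>Distinct positions inside \<open>{1..M}\<close> stay distinct modulo \<open>M\<close>,
  so there is no aliasing. It serves both the \<open>m\<close> channel frequencies and the
  oversampled grid of \<open>8 * n\<^sup>2\<close> points.\<close>

lemma parseval_cis:
  fixes a :: "'c \<Rightarrow> complex" and pos :: "'c \<Rightarrow> nat" and M :: nat
  assumes S: "finite S" and inj: "inj_on pos S" and pos: "pos ` S \<subseteq> {1..M}"
  shows "(\<Sum>\<omega><M. (cmod (\<Sum>c\<in>S. a c * cis (2 * pi * \<omega> / M * pos c)))\<^sup>2) = M * (\<Sum>c\<in>S. (cmod (a c))\<^sup>2)"
proof -
  define e where "e \<omega> c = cis (2 * pi * real \<omega> / real M * real (pos c))" for \<omega> c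
  have "complex_of_real (\<Sum>\<omega><M. (cmod (\<Sum>c\<in>S. a c * e \<omega> c))\<^sup>2)
     = (\<Sum>\<omega><M. \<Sum>c\<in>S. \<Sum>d\<in>S. (a c * cnj (a d)) * (e \<omega> c * cnj (e \<omega> d)))"
    by (simp only: of_real_sum complex_norm_square cnj_sum complex_cnj_mult sum_product mult_ac)
  also have "\<dots> = (\<Sum>c\<in>S. \<Sum>\<omega><M. \<Sum>d\<in>S. (a c * cnj (a d)) * (e \<omega> c * cnj (e \<omega> d)))"
    by (rule sum.swap)
  also have "\<dots> = (\<Sum>c\<in>S. \<Sum>d\<in>S. \<Sum>\<omega><M. (a c * cnj (a d)) * (e \<omega> c * cnj (e \<omega> d)))"
    by (intro sum.cong refl sum.swap)
  also have "\<dots> = (\<Sum>c\<in>S. \<Sum>d\<in>S. (a c * cnj (a d)) * (if c = d then of_nat M else 0))"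
  proof (intro sum.cong refl)
    fix c d assume "c \<in> S" "d \<in> S"
    then have "(\<Sum>\<omega><M. e \<omega> c * cnj (e \<omega> d)) = (if c = d then of_nat M else 0)"
      unfolding e_def using pos inj by (subst sum_cis_mult_cnj) (auto simp: inj_on_eq_iff)
    then show "(\<Sum>\<omega><M. (a c * cnj (a d)) * (e \<omega> c * cnj (e \<omega> d))) = (a c * cnj (a d)) * (if c = d then of_nat M else 0)"
      by (simp only: flip: sum_distrib_left)
  qed
  also have "\<dots> = (\<Sum>c\<in>S. of_nat M * (a c * cnj (a c)))"
    using S by (simp add: if_distrib[of "\<lambda>x. _ * x"] sum.delta' mult_ac cong: if_cong)
  also have "\<dots> = complex_of_real (M * (\<Sum>c\<in>S. (cmod (a c))\<^sup>2))"
    by (simp only: of_real_sum of_real_mult complex_norm_square sum_distrib_left of_real_of_nat_eq)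
  finally show ?thesis unfolding e_def of_real_eq_iff .
qed

lemma cmod_cis_diff_le: "cmod (cis a - cis b) \<le> \<bar>a - b\<bar>"
proof -
  have "(cmod (cis a - cis b))\<^sup>2 = (cos a - cos b)\<^sup>2 + (sin a - sin b)\<^sup>2"
    by (simp add: cmod_power2)
  also have "\<dots> = 2 - 2 * cos (a - b)"
    by (simp add: power2_diff cos_diff cos_squared_eq)
  also have "\<dots> = (2 * sin ((a - b) / 2))\<^sup>2"
  proof -
    have "2 * ((a - b) / 2) = a - b" by simp
    then have "cos (a - b) = 1 - 2 * (sin ((a - b) / 2))\<^sup>2" by (metis cos_double_sin)
    then show ?thesis by (simp add: power_mult_distrib)
  qed
  finally have "cmod (cis a - cis b) = \<bar>2 * sin ((a - b) / 2)\<bar>"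
    by (metis abs_norm_cancel power2_eq_iff_nonneg abs_ge_zero power2_abs)
  also have "\<dots> \<le> \<bar>a - b\<bar>" using abs_sin_x_le_abs_x[of "(a - b) / 2"] by simp
  finally show ?thesis .
qed

lemma cmod_square_sum_le:
  fixes a b :: "'c \<Rightarrow> complex"
  shows "(cmod (\<Sum>c\<in>S. a c * b c))\<^sup>2 \<le> (\<Sum>c\<in>S. (cmod (a c))\<^sup>2) * (\<Sum>c\<in>S. (cmod (b c))\<^sup>2)"
proof -
  have "cmod (\<Sum>c\<in>S. a c * b c) \<le> (\<Sum>c\<in>S. cmod (a c) * cmod (b c))"
    by (rule order_trans[OF norm_sum]) (simp add: norm_mult)
  then have "(cmod (\<Sum>c\<in>S. a c * b c))\<^sup>2 \<le> (\<Sum>c\<in>S. cmod (a c) * cmod (b c))\<^sup>2"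
    by (intro power_mono) auto
  also have "\<dots> \<le> (\<Sum>c\<in>S. (cmod (a c))\<^sup>2) * (\<Sum>c\<in>S. (cmod (b c))\<^sup>2)"
    by (rule Cauchy_Schwarz_ineq_sum)
  finally show ?thesis .
qed

text \<open>A trigonometric polynomial of degree at most \<open>n\<close> is controlled by its values on a grid whose
  size depends on \<open>n\<close> only, so that the number \<open>m\<close> of channel frequencies never enters an entropy bound.\<close>

lemma trig_grid_bound:
  fixes a :: "'c \<Rightarrow> complex" and pos :: "'c \<Rightarrow> nat" and S :: "'d \<Rightarrow> 'c set" and n :: nat
  defines "f \<equiv> \<lambda>i (\<theta>::real). \<Sum>c\<in>S i. a c * cis (\<theta> * pos c)"
  assumes n: "0 < n" and D: "finite D"
    and S: "\<And>i. i \<in> D \<Longrightarrow> finite (S i)" "\<And>i. i \<in> D \<Longrightarrow> inj_on pos (S i)" "\<And>i. i \<in> D \<Longrightarrow> pos ` S i \<subseteq> {1..n}"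
    and G: "\<And>k. k < 8 * n\<^sup>2 \<Longrightarrow> (\<Sum>i\<in>D. (cmod (f i (2 * pi * k / real (8 * n\<^sup>2))))\<^sup>2) \<le> G"
    and \<theta>: "0 \<le> \<theta>" "\<theta> < 2 * pi"
  shows "(\<Sum>i\<in>D. (cmod (f i \<theta>))\<^sup>2) \<le> 4 * G"
proof -
  \<comment> \<open>With this spacing a phase at a position at most \<open>n\<close> changes by at
    most \<open>pi / (4 * n)\<close> on the way to the next grid point below. At most
    \<open>n\<close> such squares add up to \<open>pi\<^sup>2 / (16 * n) \<le> 1\<close>, so by
    Cauchy-Schwarz the value changes by at most the coefficient energy.\<close>
  define M where "M = 8 * n\<^sup>2"
  have M: "M > 0" using n by (simp add: M_def)
  have nM: "n \<le> M" using n by (simp add: M_def power2_eq_square)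
  define E where "E i = (\<Sum>c\<in>S i. (cmod (a c))\<^sup>2)" for i
  \<comment> \<open>By Parseval the energy is the average of the grid values, so \<open>G\<close>
    bounds the variation between grid points as well.\<close>
  have "M * (\<Sum>i\<in>D. E i) = (\<Sum>i\<in>D. \<Sum>k<M. (cmod (f i (2 * pi * k / M)))\<^sup>2)"
    unfolding sum_distrib_left[of _ _ D]
  proof (intro sum.cong[OF refl])
    fix i assume i: "i \<in> D"
    have "pos ` S i \<subseteq> {1..M}" using S(3)[OF i] nM by auto
    then show "M * E i = (\<Sum>k<M. (cmod (f i (2 * pi * k / M)))\<^sup>2)"
      unfolding E_def f_def by (rule parseval_cis[OF S(1)[OF i] S(2)[OF i], symmetric])
  qed
  also have "\<dots> = (\<Sum>k<M. \<Sum>i\<in>D. (cmod (f i (2 * pi * k / M)))\<^sup>2)" by (rule sum.swap)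
  also have "\<dots> \<le> (\<Sum>k<M. G)" using G by (intro sum_mono) (auto simp: M_def)
  finally have E: "(\<Sum>i\<in>D. E i) \<le> G" using M by simp
  define k where "k = nat \<lfloor>\<theta> * M / (2 * pi)\<rfloor>"
  have fl: "\<theta> * M / (2 * pi) \<ge> 0" using \<theta> by simp
  have "real k \<le> \<theta> * M / (2 * pi)" unfolding k_def using fl by simp
  moreover have "\<theta> * M / (2 * pi) < real k + 1" unfolding k_def using fl by linarith
  ultimately have k: "2 * pi * k / M \<le> \<theta>" "\<theta> < 2 * pi * k / M + 2 * pi / M"
    using M by (auto simp: field_simps)
  have "\<theta> * M / (2 * pi) < M" using \<theta> M by (simp add: field_simps)
  then have kM: "k < M" using \<open>real k \<le> _\<close> by linarith
  let ?t = "2 * pi * k / M"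
  have diff: "(cmod (f i \<theta> - f i ?t))\<^sup>2 \<le> E i" if i: "i \<in> D" for i
  proof -
    have "f i \<theta> - f i ?t = (\<Sum>c\<in>S i. a c * (cis (\<theta> * pos c) - cis (?t * pos c)))"
      by (simp add: f_def sum_subtractf right_diff_distrib)
    then have "(cmod (f i \<theta> - f i ?t))\<^sup>2 \<le> E i * (\<Sum>c\<in>S i. (cmod (cis (\<theta> * pos c) - cis (?t * pos c)))\<^sup>2)"
      unfolding E_def by (simp only: cmod_square_sum_le)
    also have "\<dots> \<le> E i * 1"
    proof (intro mult_left_mono)
      have "(\<Sum>c\<in>S i. (cmod (cis (\<theta> * pos c) - cis (?t * pos c)))\<^sup>2) \<le> (\<Sum>c\<in>S i. (2 * pi / M * n)\<^sup>2)"
      proof (intro sum_mono power_mono)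
        fix c assume c: "c \<in> S i"
        have "cmod (cis (\<theta> * pos c) - cis (?t * pos c)) \<le> \<bar>\<theta> * pos c - ?t * pos c\<bar>" by (rule cmod_cis_diff_le)
        also have "\<dots> = \<bar>\<theta> - ?t\<bar> * pos c" unfolding left_diff_distrib[symmetric] abs_mult by simp
        also have "\<dots> \<le> 2 * pi / M * n"
          using k S(3)[OF i] c by (intro mult_mono) auto
        finally show "cmod (cis (\<theta> * pos c) - cis (?t * pos c)) \<le> 2 * pi / M * n" .
      qed auto
      also have "\<dots> = card (S i) * (2 * pi / M * n)\<^sup>2" by simp
      also have "\<dots> \<le> n * (2 * pi / M * n)\<^sup>2"
        using card_inj_on_le[OF S(2,3)] i by (intro mult_right_mono) auto
      also have "\<dots> = pi\<^sup>2 / 16 / n" using n by (simp add: M_def power2_eq_square divide_simps)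
      also have "\<dots> \<le> 1"
      proof -
        have "pi\<^sup>2 \<le> 4\<^sup>2" using pi_less_4 by (intro power_mono) auto
        then show ?thesis using n by (simp add: field_simps)
      qed
      finally show "(\<Sum>c\<in>S i. (cmod (cis (\<theta> * pos c) - cis (?t * pos c)))\<^sup>2) \<le> 1" .
    qed (auto simp: E_def sum_nonneg)
    finally show ?thesis by simp
  qed
  have "(cmod (f i \<theta>))\<^sup>2 \<le> 2 * (cmod (f i ?t))\<^sup>2 + 2 * E i" if i: "i \<in> D" for i
  proof -
    have "(cmod (f i \<theta>))\<^sup>2 \<le> (cmod (f i ?t) + cmod (f i \<theta> - f i ?t))\<^sup>2"
      by (intro power_mono norm_triangle_sub) auto
    also have "\<dots> \<le> 2 * (cmod (f i ?t))\<^sup>2 + 2 * (cmod (f i \<theta> - f i ?t))\<^sup>2"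
      using sum_squares_bound[of "cmod (f i ?t)" "cmod (f i \<theta> - f i ?t)"] by (simp add: power2_sum)
    finally show ?thesis using diff[OF i] by simp
  qed
  then have "(\<Sum>i\<in>D. (cmod (f i \<theta>))\<^sup>2) \<le> (\<Sum>i\<in>D. 2 * (cmod (f i ?t))\<^sup>2 + 2 * E i)" by (intro sum_mono)
  also have "\<dots> = 2 * (\<Sum>i\<in>D. (cmod (f i ?t))\<^sup>2) + 2 * (\<Sum>i\<in>D. E i)"
    by (simp add: sum.distrib sum_distrib_left)
  also have "\<dots> \<le> 4 * G" using G[of k] kM E by (simp add: M_def)
  finally show ?thesis .
qed

section \<open>Cyclic convolution structure of the probe matrix\<close>

locale probe_channel =
  fixes n p m :: nat
  assumes n0: "0 < n" and p0: "0 < p" and nm: "n \<le> m"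
begin

definition "blk c = (c - 1) div n + 1" for c :: nat
definition "pos c = (c - 1) mod n + 1" for c :: nat
text \<open>The index of the probe entry standing in row \<open>r\<close> and column
  \<open>c\<close>. For rows in \<open>outs\<close> the natural subtraction does not truncate,
  because \<open>pos c \<le> n\<close> and \<open>1 \<le> r\<close>.\<close>

definition "slot r c = (blk c, (n + r - pos c - 1) mod m + 1)" for r c :: nat
abbreviation "cols \<equiv> {1..n * p}"
abbreviation "outs \<equiv> {1..m}"
abbreviation "taps \<equiv> {1..p} \<times> {1..m}"
definition "Y x \<phi> r = (\<Sum>c\<in>cols. \<phi> (slot r c) * x c)" for x :: "nat \<Rightarrow> real" and \<phi> :: "nat \<times> nat \<Rightarrow> real"
text \<open>The adjoint of the linear map \<open>\<phi> \<mapsto> Y z \<phi>\<close>, applied to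
  \<open>w\<close>: for a fixed \<open>w\<close> it exhibits the inner product of
  \<open>Y z \<phi>\<close> with \<open>w\<close> as a linear form in the probes.\<close>

definition "coef z w t = (\<Sum>r\<in>outs. \<Sum>c\<in>cols. if slot r c = t then w r * z c else 0)"
  for z w :: "nat \<Rightarrow> real" and t :: "nat \<times> nat"
definition "fhat z \<theta> i = (\<Sum>c\<in>{c\<in>cols. blk c = i}. complex_of_real (z c) * cis (\<theta> * pos c))"
  for z :: "nat \<Rightarrow> real" and \<theta> :: real
text \<open>Its maximum over the frequencies \<open>2 * pi * \<omega> / m\<close> bounds the squared
  operator norm of \<open>\<phi> \<mapsto> Y z \<phi>\<close>, so it measures distances in the
  chaining.\<close>

definition "spec z \<theta> = (\<Sum>i\<in>{1..p}. (cmod (fhat z \<theta> i))\<^sup>2)"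
  for z :: "nat \<Rightarrow> real" and \<theta> :: real

lemma m0: "0 < m" using n0 nm by simp

lemma Phi_mat_slot: "Phi_mat n m \<phi> r c = \<phi> (slot r c)"
  by (simp add: Phi_mat_def slot_def blk_def pos_def Let_def)

lemma pos_range: "pos c \<in> {1..n}"
  using n0 by (simp add: pos_def Suc_le_eq)

lemma blk_range: "c \<in> cols \<Longrightarrow> blk c \<in> {1..p}"
  using n0 by (auto simp: blk_def Suc_le_eq less_mult_imp_div_less mult.commute)

lemma inj_on_pos: "inj_on pos {c\<in>cols. blk c = i}"
proof (rule inj_onI)
  fix c d assume "c \<in> {c\<in>cols. blk c = i}" "d \<in> {c\<in>cols. blk c = i}" "pos c = pos d"
  then have "(c - 1) div n = (d - 1) div n" "(c - 1) mod n = (d - 1) mod n" "c \<ge> 1" "d \<ge> 1"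
    by (auto simp: blk_def pos_def)
  then have "c - 1 = d - 1" by (metis div_mult_mod_eq)
  then show "c = d" using \<open>c \<ge> 1\<close> \<open>d \<ge> 1\<close> by linarith
qed

lemma slot_range: "c \<in> cols \<Longrightarrow> slot r c \<in> taps"
  using blk_range m0 by (auto simp: slot_def Suc_le_eq)

lemma sum_Y_mult: "(\<Sum>r\<in>outs. Y z \<phi> r * w r) = (\<Sum>t\<in>taps. coef z w t * \<phi> t)"
proof -
  have "(\<Sum>t\<in>taps. coef z w t * \<phi> t)
    = (\<Sum>t\<in>taps. \<Sum>r\<in>outs. \<Sum>c\<in>cols. if slot r c = t then w r * z c * \<phi> t else 0)"
    unfolding coef_def sum_distrib_right by (intro sum.cong refl) auto
  also have "\<dots> = (\<Sum>r\<in>outs. \<Sum>t\<in>taps. \<Sum>c\<in>cols. if slot r c = t then w r * z c * \<phi> t else 0)"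
    by (rule sum.swap)
  also have "\<dots> = (\<Sum>r\<in>outs. \<Sum>c\<in>cols. \<Sum>t\<in>taps. if slot r c = t then w r * z c * \<phi> t else 0)"
    by (intro sum.cong refl sum.swap)
  also have "\<dots> = (\<Sum>r\<in>outs. \<Sum>c\<in>cols. w r * z c * \<phi> (slot r c))"
    by (intro sum.cong refl, subst sum.delta') (use slot_range in auto)
  also have "\<dots> = (\<Sum>r\<in>outs. Y z \<phi> r * w r)"
    unfolding Y_def sum_distrib_right by (intro sum.cong refl) simp
  finally show ?thesis ..
qed

text \<open>The character has period \<open>m\<close>, hence ignores the reduction modulo
  \<open>m\<close>. The 1 added after the reduction makes the index congruent to exactly
  \<open>n + r - pos c\<close>, which splits into three phases.\<close>

lemma cis_slot:
  fixes \<omega> :: nat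
  assumes "r \<in> outs"
  shows "cis (2 * pi * \<omega> / m * real ((n + r - pos c - 1) mod m + 1))
    = cis (2 * pi * \<omega> / m * n) * cis (2 * pi * \<omega> / m * r) * cnj (cis (2 * pi * \<omega> / m * pos c))"
proof -
  define k where "k = n + r - pos c - 1"
  have k: "real k + 1 = real n + real r - real (pos c)"
    using pos_range[of c] assms by (auto simp: k_def)
  have "real (k mod m) = real k - real m * real (k div m)"
    by (metis add_diff_cancel_left' div_mult_mod_eq mult.commute of_nat_add of_nat_mult)
  then have "real (k mod m + 1) = real n + real r - real (pos c) - real m * real (k div m)" using k by simp
  then have "2 * pi * \<omega> / m * real (k mod m + 1)
     = 2 * pi * \<omega> / m * n + 2 * pi * \<omega> / m * r + - (2 * pi * \<omega> / m * pos c) + - (2 * pi * real (\<omega> * (k div m)))"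
    using m0 by (simp only: of_nat_mult) (simp add: field_simps)
  moreover have "cis (- (2 * pi * real (\<omega> * (k div m)))) = 1"
  proof -
    have "cis (2 * pi * real (\<omega> * (k div m))) = 1" by (rule cis_multiple_2pi) auto
    then show ?thesis by (metis cis_cnj complex_cnj_one)
  qed
  ultimately show ?thesis unfolding k_def[symmetric] by (simp only: cis_cnj flip: cis_mult) simp
qed

text \<open>Within block \<open>i\<close> the coefficients are a cyclic correlation of
  \<open>w\<close> with the block of \<open>z\<close>; up to a phase its discrete Fourier transform
  is a product.\<close>

lemma coef_transform:
  fixes \<omega> :: nat
  assumes "i \<in> {1..p}"
  shows "(\<Sum>t\<in>outs. complex_of_real (coef z w (i, t)) * cis (2 * pi * \<omega> / m * t))
    = cis (2 * pi * \<omega> / m * n) * (\<Sum>r\<in>outs. complex_of_real (w r) * cis (2 * pi * \<omega> / m * r)) * cnj (fhat z (2 * pi * \<omega> / m) i)"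
proof -
  let ?e = "\<lambda>x::real. cis (2 * pi * \<omega> / m * x)"
  have "(\<Sum>t\<in>outs. complex_of_real (coef z w (i, t)) * ?e t)
    = (\<Sum>t\<in>outs. \<Sum>r\<in>outs. \<Sum>c\<in>cols. if slot r c = (i, t) then of_real (w r * z c) * ?e t else 0)"
    unfolding coef_def of_real_sum sum_distrib_right by (intro sum.cong refl) auto
  also have "\<dots> = (\<Sum>r\<in>outs. \<Sum>t\<in>outs. \<Sum>c\<in>cols. if slot r c = (i, t) then of_real (w r * z c) * ?e t else 0)"
    by (rule sum.swap)
  also have "\<dots> = (\<Sum>r\<in>outs. \<Sum>c\<in>cols. \<Sum>t\<in>outs. if slot r c = (i, t) then of_real (w r * z c) * ?e t else 0)"
    by (intro sum.cong refl sum.swap)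
  also have "\<dots> = (\<Sum>r\<in>outs. \<Sum>c\<in>cols. if blk c = i then of_real (w r * z c) * ?e ((n + r - pos c - 1) mod m + 1) else 0)"
  proof (intro sum.cong refl)
    fix r c assume c: "c \<in> cols"
    let ?t = "(n + r - pos c - 1) mod m + 1"
    have "(\<Sum>t\<in>outs. if slot r c = (i, t) then of_real (w r * z c) * ?e t else 0)
      = (\<Sum>t\<in>outs. if ?t = t then (if blk c = i then of_real (w r * z c) * ?e t else 0) else 0)"
      by (intro sum.cong refl) (auto simp: slot_def)
    also have "\<dots> = (if blk c = i then of_real (w r * z c) * ?e ?t else 0)"
      using slot_range[OF c, of r] by (subst sum.delta') (auto simp: slot_def)
    finally show "(\<Sum>t\<in>outs. if slot r c = (i, t) then of_real (w r * z c) * ?e t else 0) = \<dots>" .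
  qed
  also have "\<dots> = (\<Sum>r\<in>outs. \<Sum>c\<in>{c\<in>cols. blk c = i}. of_real (w r * z c) * (?e n * ?e r * cnj (?e (pos c))))"
  proof (intro sum.cong[OF refl])
    fix r assume r: "r \<in> outs"
    show "(\<Sum>c\<in>cols. if blk c = i then of_real (w r * z c) * ?e ((n + r - pos c - 1) mod m + 1) else 0)
      = (\<Sum>c\<in>{c\<in>cols. blk c = i}. of_real (w r * z c) * (?e n * ?e r * cnj (?e (pos c))))"
      unfolding cis_slot[OF r] by (rule sum.inter_filter[symmetric]) simp
  qed
  also have "\<dots> = ?e n * (\<Sum>r\<in>outs. of_real (w r) * ?e r) * cnj (fhat z (2 * pi * \<omega> / m) i)"
    unfolding fhat_def cnj_sum mult.assoc sum_product unfolding sum_distrib_left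
    by (intro sum.cong refl) simp
  finally show ?thesis .
qed

text \<open>All blocks share the transform of \<open>w\<close>. Parseval in each block therefore
  leaves, at every frequency, the factor \<open>W \<omega>\<close> times the sum over blocks, which
  is \<open>spec\<close>; a second use of Parseval removes \<open>W\<close>.\<close>

lemma coef_energy:
  assumes G: "\<And>\<omega>. \<omega> < m \<Longrightarrow> spec z (2 * pi * \<omega> / m) \<le> G"
  shows "(\<Sum>t\<in>taps. (coef z w t)\<^sup>2) \<le> G * (\<Sum>r\<in>outs. (w r)\<^sup>2)"
proof -
  define W where "W \<omega> = (cmod (\<Sum>r\<in>outs. complex_of_real (w r) * cis (2 * pi * \<omega> / m * r)))\<^sup>2" for \<omega> :: nat
  have W: "(\<Sum>\<omega><m. W \<omega>) = m * (\<Sum>r\<in>outs. (w r)\<^sup>2)"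
    using parseval_cis[of outs "\<lambda>r. r" m "\<lambda>r. complex_of_real (w r)"] by (simp add: W_def)
  have row: "m * (\<Sum>t\<in>outs. (coef z w (i, t))\<^sup>2) = (\<Sum>\<omega><m. W \<omega> * (cmod (fhat z (2 * pi * \<omega> / m) i))\<^sup>2)"
    if i: "i \<in> {1..p}" for i
    using parseval_cis[of outs "\<lambda>r. r" m "\<lambda>t. complex_of_real (coef z w (i, t))"]
    unfolding coef_transform[OF i] by (simp add: W_def norm_mult power_mult_distrib)
  have "m * (\<Sum>t\<in>taps. (coef z w t)\<^sup>2) = (\<Sum>i\<in>{1..p}. m * (\<Sum>t\<in>outs. (coef z w (i, t))\<^sup>2))"
    by (simp add: sum.cartesian_product' sum_distrib_left)
  also have "\<dots> = (\<Sum>i\<in>{1..p}. \<Sum>\<omega><m. W \<omega> * (cmod (fhat z (2 * pi * \<omega> / m) i))\<^sup>2)"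
    by (intro sum.cong refl row)
  also have "\<dots> = (\<Sum>\<omega><m. W \<omega> * spec z (2 * pi * \<omega> / m))"
    unfolding spec_def sum_distrib_left by (rule sum.swap)
  also have "\<dots> \<le> (\<Sum>\<omega><m. W \<omega> * G)" using G by (intro sum_mono mult_left_mono) (auto simp: W_def)
  also have "\<dots> = m * (G * (\<Sum>r\<in>outs. (w r)\<^sup>2))" by (simp add: W flip: sum_distrib_right)
  finally show ?thesis using m0 by simp
qed

lemma coef_energy_grid:
  assumes G: "\<And>k. k < 8 * n\<^sup>2 \<Longrightarrow> spec z (2 * pi * k / real (8 * n\<^sup>2)) \<le> G"
  shows "(\<Sum>t\<in>taps. (coef z w t)\<^sup>2) \<le> 4 * G * (\<Sum>r\<in>outs. (w r)\<^sup>2)"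
proof (rule coef_energy)
  fix \<omega> assume "\<omega> < m"
  then have "2 * pi * \<omega> / m < 2 * pi" by (simp add: field_simps)
  then show "spec z (2 * pi * \<omega> / m) \<le> 4 * G"
    unfolding spec_def fhat_def
    by (intro trig_grid_bound[OF n0] G[unfolded spec_def fhat_def] inj_on_pos)
      (use pos_range in \<open>auto simp del: One_nat_def\<close>)
qed

end

section \<open>Gaussian linear forms and rotation invariance\<close>

text \<open>Exponential tilting: the factor \<open>exp (t / s\<^sup>2 * (x - t))\<close> is at least
  1 beyond \<open>t\<close>, and it turns the density into a constant multiple of the normal density
  centred at \<open>t\<close>, whose total mass is 1.\<close>

lemma normal_upper_tail:
  assumes s: "0 < s" and t: "0 \<le> t"
  shows "(\<integral>\<^sup>+x. ennreal (normal_density 0 s x) * indicator {t<..} x \<partial>lborel) \<le> ennreal (exp (- t\<^sup>2 / (2 * s\<^sup>2)))"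
proof -
  let ?C = "exp (- t\<^sup>2 / (2 * s\<^sup>2))"
  have shift: "normal_density 0 s x * exp (t / s\<^sup>2 * (x - t)) = ?C * normal_density t s x" for x
  proof -
    have "- x\<^sup>2 / (2 * s\<^sup>2) + t / s\<^sup>2 * (x - t) = - t\<^sup>2 / (2 * s\<^sup>2) + - (x - t)\<^sup>2 / (2 * s\<^sup>2)"
      using s by (simp add: field_simps power2_eq_square)
    then have "exp (- x\<^sup>2 / (2 * s\<^sup>2)) * exp (t / s\<^sup>2 * (x - t)) = ?C * exp (- (x - t)\<^sup>2 / (2 * s\<^sup>2))"
      by (simp only: flip: exp_add)
    then show ?thesis by (simp add: normal_density_def)
  qed
  have "(\<integral>\<^sup>+x. ennreal (normal_density 0 s x) * indicator {t<..} x \<partial>lborel)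
     \<le> (\<integral>\<^sup>+x. ennreal (normal_density 0 s x * exp (t / s\<^sup>2 * (x - t))) \<partial>lborel)"
  proof (rule nn_integral_mono)
    fix x :: real
    have "normal_density 0 s x \<le> normal_density 0 s x * exp (t / s\<^sup>2 * (x - t))" if "t < x"
    proof -
      have "1 \<le> exp (t / s\<^sup>2 * (x - t))" using that t by simp
      then show ?thesis using mult_left_mono[of 1 _ "normal_density 0 s x"] by simp
    qed
    then show "ennreal (normal_density 0 s x) * indicator {t<..} x \<le> ennreal (normal_density 0 s x * exp (t / s\<^sup>2 * (x - t)))"
      by (auto simp: indicator_def intro!: ennreal_leI)
  qed
  also have "\<dots> = ennreal ?C * (\<integral>\<^sup>+x. ennreal (normal_density t s x) \<partial>lborel)"
    by (simp only: shift ennreal_mult'[OF exp_ge_zero]) (simp add: nn_integral_cmult)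
  also have "(\<integral>\<^sup>+x. ennreal (normal_density t s x) \<partial>lborel) = 1"
    using prob_space.emeasure_space_1[OF prob_space_normal_density[OF s, of t]] by (simp add: emeasure_density)
  finally show ?thesis by simp
qed

locale gauss_product =
  fixes I :: "'i set" and \<sigma> :: real
  assumes I: "finite I" and \<sigma>: "0 < \<sigma>"
begin

abbreviation "N1 \<equiv> density lborel (normal_density 0 \<sigma>)"
abbreviation "P \<equiv> PiM I (\<lambda>_. N1)"

sublocale N1: prob_space N1 by (rule prob_space_normal_density[OF \<sigma>])
sublocale PS: product_prob_space "\<lambda>_. N1" I ..
sublocale PP: pair_prob_space P P ..

definition lin where "lin b \<phi> = (\<Sum>i\<in>I. b i * \<phi> i)" for b \<phi> :: "'i \<Rightarrow> real"

lemma component_measurable [measurable]: "i \<in> I \<Longrightarrow> (\<lambda>\<phi>. \<phi> i) \<in> borel_measurable P"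
  by (rule measurable_compose[OF measurable_component_singleton]) auto

lemma lin_measurable [measurable]: "lin b \<in> borel_measurable P"
  unfolding lin_def[abs_def] by measurable

lemma lin_distributed:
  assumes b: "0 < (\<Sum>i\<in>I. (b i)\<^sup>2)"
  shows "distributed P lborel (lin b) (normal_density 0 (\<sigma> * sqrt (\<Sum>i\<in>I. (b i)\<^sup>2)))"
proof -
  \<comment> \<open>Zero coefficients give degenerate summands without a density, so the independent
    normal variables are added over the nonzero ones only.\<close>
  define J where "J = {i\<in>I. b i \<noteq> 0}"
  have J: "finite J" "J \<subseteq> I" using I by (auto simp: J_def)
  have sJ: "(\<Sum>i\<in>J. (b i)\<^sup>2) = (\<Sum>i\<in>I. (b i)\<^sup>2)"
    using I by (intro sum.mono_neutral_left) (auto simp: J_def)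
  have lJ: "lin b \<phi> = (\<Sum>i\<in>J. b i * \<phi> i)" for \<phi>
    unfolding lin_def using I by (intro sum.mono_neutral_right) (auto simp: J_def)
  have "J \<noteq> {}" using b sJ by (metis sum.empty less_irrefl)
  have ind: "PS.P.indep_vars (\<lambda>_. N1) (\<lambda>i \<phi>. \<phi> i) J"
  proof (rule PS.P.indep_vars_subset[OF _ J(2)])
    show "PS.P.indep_vars (\<lambda>_. N1) (\<lambda>i \<phi>. \<phi> i) I"
    proof (cases "I = {}")
      case True then show ?thesis using \<open>J \<noteq> {}\<close> J by auto
    next
      case False
      have "distr P P (\<lambda>\<phi>. \<lambda>i\<in>I. \<phi> i) = distr P P (\<lambda>\<phi>. \<phi>)"
        by (intro distr_cong) (auto simp: space_PiM)
      also have "\<dots> = P" by (rule distr_id2) simp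
      also have "\<dots> = PiM I (\<lambda>i. distr P N1 (\<lambda>\<phi>. \<phi> i))"
        by (intro PiM_cong refl distr_PiM_component[symmetric] N1.prob_space_axioms)
      finally show ?thesis by (subst PS.P.indep_vars_iff_distr_eq_PiM'[OF False]) auto
    qed
  qed
  have ind': "PS.P.indep_vars (\<lambda>_. borel) (\<lambda>i \<phi>. b i * \<phi> i) J"
    using PS.P.indep_vars_compose2[OF ind, of "\<lambda>i x. b i * x" "\<lambda>_. borel"] by simp
  have "distributed P lborel (\<lambda>\<phi>. \<Sum>i\<in>J. b i * \<phi> i) (normal_density (\<Sum>i\<in>J. 0) (sqrt (\<Sum>i\<in>J. (\<bar>b i\<bar> * \<sigma>)\<^sup>2)))"
  proof (rule PS.P.sum_indep_normal[OF J(1) \<open>J \<noteq> {}\<close> ind'])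
    fix i assume i: "i \<in> J"
    then show "0 < \<bar>b i\<bar> * \<sigma>" using \<sigma> by (simp add: J_def)
    have "distr P N1 (\<lambda>\<phi>. \<phi> i) = N1"
      using i J by (intro distr_PiM_component N1.prob_space_axioms) auto
    moreover have "distr P lborel (\<lambda>\<phi>. \<phi> i) = distr P N1 (\<lambda>\<phi>. \<phi> i)"
      by (intro distr_cong) auto
    ultimately have "distributed P lborel (\<lambda>\<phi>. \<phi> i) (normal_density 0 \<sigma>)"
      using i J by (auto simp: distributed_def)
    from PS.P.normal_density_affine[OF this \<sigma>, of "b i" 0] i
    show "distributed P lborel (\<lambda>\<phi>. b i * \<phi> i) (normal_density 0 (\<bar>b i\<bar> * \<sigma>))"
      by (simp add: J_def)
  qed
  moreover have "sqrt (\<Sum>i\<in>J. (\<bar>b i\<bar> * \<sigma>)\<^sup>2) = \<sigma> * sqrt (\<Sum>i\<in>I. (b i)\<^sup>2)"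
    using \<sigma> by (simp add: power_mult_distrib sJ real_sqrt_mult flip: sum_distrib_right)
  ultimately show ?thesis by (simp add: lJ[abs_def])
qed

lemma lin_zero: "(\<Sum>i\<in>I. (b i)\<^sup>2) \<le> 0 \<Longrightarrow> lin b \<phi> = 0"
  using I sum_nonneg_eq_0_iff[OF I, of "\<lambda>i. (b i)\<^sup>2"] sum_nonneg[of I "\<lambda>i. (b i)\<^sup>2"]
  by (simp add: lin_def)

text \<open>The variance enters through an upper bound \<open>c\<^sup>2\<close>, since later it is
  estimated and not computed. A vanishing form has no density and is treated apart.\<close>

lemma lin_upper_tail:
  assumes v: "\<sigma>\<^sup>2 * (\<Sum>i\<in>I. (b i)\<^sup>2) \<le> c\<^sup>2" and c: "0 \<le> c" and \<tau>: "0 \<le> \<tau>"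
  shows "emeasure P {\<phi>\<in>space P. lin b \<phi> > \<tau> * c} \<le> ennreal (exp (- \<tau>\<^sup>2 / 2))"
proof (cases "0 < (\<Sum>i\<in>I. (b i)\<^sup>2)")
  case False
  then have "{\<phi>\<in>space P. lin b \<phi> > \<tau> * c} = {}" using lin_zero[of b] c \<tau> by (simp add: not_less)
  then show ?thesis by (simp only: emeasure_empty) simp
next
  case True
  let ?s = "\<sigma> * sqrt (\<Sum>i\<in>I. (b i)\<^sup>2)"
  have s: "0 < ?s" using True \<sigma> by simp
  have "?s\<^sup>2 \<le> c\<^sup>2" using v True by (simp add: power_mult_distrib)
  then have sc: "?s \<le> c" using c by (rule power2_le_imp_le)
  have "emeasure P {\<phi>\<in>space P. lin b \<phi> > \<tau> * c} \<le> emeasure P (lin b -` {\<tau> * ?s<..} \<inter> space P)"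
  proof (rule emeasure_mono)
    show "{\<phi>\<in>space P. lin b \<phi> > \<tau> * c} \<subseteq> lin b -` {\<tau> * ?s<..} \<inter> space P"
      using mult_left_mono[OF sc \<tau>] by auto
  qed measurable
  also have "\<dots> = (\<integral>\<^sup>+x. ennreal (normal_density 0 ?s x) * indicator {\<tau> * ?s<..} x \<partial>lborel)"
    by (rule distributed_emeasure[OF lin_distributed[OF True]]) simp
  also have "\<dots> \<le> ennreal (exp (- (\<tau> * ?s)\<^sup>2 / (2 * ?s\<^sup>2)))"
    by (rule normal_upper_tail[OF s]) (use s \<tau> in auto)
  also have "- (\<tau> * ?s)\<^sup>2 / (2 * ?s\<^sup>2) = - \<tau>\<^sup>2 / 2"
  proof -
    have "- (\<tau> * r)\<^sup>2 / (2 * r\<^sup>2) = - \<tau>\<^sup>2 / 2" if "0 < r" for r :: real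
      using that by (simp add: power_mult_distrib)
    then show ?thesis using s by blast
  qed
  finally show ?thesis .
qed

lemma lin_tail:
  assumes v: "\<sigma>\<^sup>2 * (\<Sum>i\<in>I. (b i)\<^sup>2) \<le> c\<^sup>2" and c: "0 \<le> c" and \<tau>: "0 \<le> \<tau>"
  shows "emeasure P {\<phi>\<in>space P. \<bar>lin b \<phi>\<bar> > \<tau> * c} \<le> ennreal (2 * exp (- \<tau>\<^sup>2 / 2))"
proof -
  have neg: "lin (\<lambda>i. - b i) \<phi> = - lin b \<phi>" for \<phi> by (simp add: lin_def sum_negf)
  have "emeasure P {\<phi>\<in>space P. \<bar>lin b \<phi>\<bar> > \<tau> * c}
    \<le> emeasure P ({\<phi>\<in>space P. lin b \<phi> > \<tau> * c} \<union> {\<phi>\<in>space P. lin (\<lambda>i. - b i) \<phi> > \<tau> * c})"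
    by (rule emeasure_mono) (auto simp: neg abs_if split: if_splits)
  also have "\<dots> \<le> emeasure P {\<phi>\<in>space P. lin b \<phi> > \<tau> * c} + emeasure P {\<phi>\<in>space P. lin (\<lambda>i. - b i) \<phi> > \<tau> * c}"
    by (rule emeasure_subadditive) measurable
  also have "\<dots> \<le> ennreal (exp (- \<tau>\<^sup>2 / 2)) + ennreal (exp (- \<tau>\<^sup>2 / 2))"
    using v c \<tau> by (intro add_mono lin_upper_tail) auto
  finally show ?thesis by (simp flip: ennreal_plus)
qed

lemma lin_second_moment:
  "(\<integral>\<^sup>+\<phi>. ennreal ((lin b \<phi>)\<^sup>2) \<partial>P) = ennreal (\<sigma>\<^sup>2 * (\<Sum>i\<in>I. (b i)\<^sup>2))"
proof (cases "0 < (\<Sum>i\<in>I. (b i)\<^sup>2)")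
  case False
  then have "(\<Sum>i\<in>I. (b i)\<^sup>2) = 0" by (simp add: antisym sum_nonneg)
  then show ?thesis using lin_zero[of b] by simp
next
  case True
  let ?s = "\<sigma> * sqrt (\<Sum>i\<in>I. (b i)\<^sup>2)"
  have s: "0 < ?s" using True \<sigma> by simp
  have "(\<integral>\<^sup>+\<phi>. ennreal ((lin b \<phi>)\<^sup>2) \<partial>P) = (\<integral>\<^sup>+x. ennreal (normal_density 0 ?s x) * ennreal (x\<^sup>2) \<partial>lborel)"
    by (rule distributed_nn_integral[OF lin_distributed[OF True], symmetric]) simp
  also have "\<dots> = (\<integral>\<^sup>+x. ennreal (normal_density 0 ?s x * x\<^sup>2) \<partial>lborel)"
    by (simp add: ennreal_mult')
  also have "\<dots> = ennreal (fact 2 / ((2 / ?s\<^sup>2) * fact 1))"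
  proof -
    have "has_bochner_integral lborel (\<lambda>x. normal_density 0 ?s x * x\<^sup>2) (fact 2 / ((2 / ?s\<^sup>2) * fact 1))"
      using normal_moment_even[OF s, of 0 1] by simp
    then show ?thesis
      by (subst nn_integral_eq_integral) (auto simp: has_bochner_integral_iff)
  qed
  also have "fact 2 / ((2 / ?s\<^sup>2) * fact 1) = ?s\<^sup>2" by simp
  also have "?s\<^sup>2 = \<sigma>\<^sup>2 * (\<Sum>i\<in>I. (b i)\<^sup>2)" using True by (simp add: power_mult_distrib)
  finally show ?thesis .
qed

end

text \<open>The rotation is carried out as two one-dimensional affine substitutions with Fubini in
  between: \<open>u = (a + b) / sqrt 2\<close> at fixed \<open>b\<close>, then
  \<open>v = u - sqrt 2 * b\<close> at fixed \<open>u\<close>. The Jacobians \<open>sqrt 2\<close>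
  and \<open>1 / sqrt 2\<close> cancel, and the product density is invariant by the parallelogram
  identity.\<close>

lemma normal_rotation_2:
  fixes f :: "real \<Rightarrow> real \<Rightarrow> ennreal"
  assumes \<sigma>: "0 < \<sigma>" and f[measurable]: "case_prod f \<in> borel_measurable (borel \<Otimes>\<^sub>M borel)"
  defines "N \<equiv> density lborel (normal_density 0 \<sigma>)"
  shows "(\<integral>\<^sup>+a. \<integral>\<^sup>+b. f ((a + b) / sqrt 2) ((a - b) / sqrt 2) \<partial>N \<partial>N) = (\<integral>\<^sup>+a. \<integral>\<^sup>+b. f a b \<partial>N \<partial>N)"
proof -
  define g where "g x = ennreal (normal_density 0 \<sigma> x)" for x
  have [measurable]: "g \<in> borel_measurable borel" unfolding g_def by measurable
  have sq: "sqrt 2 * sqrt 2 = (2::real)" by simp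
  have gg: "g ((u + v) / sqrt 2) * g ((u - v) / sqrt 2) = g u * g v" for u v
  proof -
    have "- ((u + v) / sqrt 2)\<^sup>2 / (2 * \<sigma>\<^sup>2) + - ((u - v) / sqrt 2)\<^sup>2 / (2 * \<sigma>\<^sup>2) = - u\<^sup>2 / (2 * \<sigma>\<^sup>2) + - v\<^sup>2 / (2 * \<sigma>\<^sup>2)"
      using \<sigma> by (simp add: field_simps power2_eq_square)
    then have "exp (- ((u + v) / sqrt 2)\<^sup>2 / (2 * \<sigma>\<^sup>2)) * exp (- ((u - v) / sqrt 2)\<^sup>2 / (2 * \<sigma>\<^sup>2))
      = exp (- u\<^sup>2 / (2 * \<sigma>\<^sup>2)) * exp (- v\<^sup>2 / (2 * \<sigma>\<^sup>2))" by (simp only: flip: exp_add)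
    then show ?thesis unfolding g_def by (simp add: normal_density_def flip: ennreal_mult')
  qed
  have N: "(\<integral>\<^sup>+a. \<integral>\<^sup>+b. h a b \<partial>N \<partial>N) = (\<integral>\<^sup>+b. \<integral>\<^sup>+a. g a * g b * h a b \<partial>lborel \<partial>lborel)"
    if [measurable]: "case_prod h \<in> borel_measurable (borel \<Otimes>\<^sub>M borel)" for h :: "real \<Rightarrow> real \<Rightarrow> ennreal"
  proof -
    have "(\<integral>\<^sup>+a. \<integral>\<^sup>+b. h a b \<partial>N \<partial>N) = (\<integral>\<^sup>+a. \<integral>\<^sup>+b. g a * g b * h a b \<partial>lborel \<partial>lborel)"
      unfolding N_def by (simp add: nn_integral_density g_def[symmetric] mult.assoc flip: nn_integral_cmult)
    also have "\<dots> = (\<integral>\<^sup>+b. \<integral>\<^sup>+a. g a * g b * h a b \<partial>lborel \<partial>lborel)"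
      by (rule lborel_pair.Fubini') measurable
    finally show ?thesis .
  qed
  have "(\<integral>\<^sup>+a. \<integral>\<^sup>+b. f ((a + b) / sqrt 2) ((a - b) / sqrt 2) \<partial>N \<partial>N)
    = (\<integral>\<^sup>+b. \<integral>\<^sup>+a. g a * g b * f ((a + b) / sqrt 2) ((a - b) / sqrt 2) \<partial>lborel \<partial>lborel)"
    by (rule N) measurable
  also have "\<dots> = (\<integral>\<^sup>+b. sqrt 2 * (\<integral>\<^sup>+u. g (sqrt 2 * u - b) * g b * f u (u - sqrt 2 * b) \<partial>lborel) \<partial>lborel)"
  proof (intro nn_integral_cong)
    fix b :: real
    have e: "(- b + sqrt 2 * u + b) / sqrt 2 = u" "(- b + sqrt 2 * u - b) / sqrt 2 = u - sqrt 2 * b"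
      "(sqrt 2 * u - 2 * b) / sqrt 2 = u - sqrt 2 * b" "- b + sqrt 2 * u = sqrt 2 * u - b" for u
      using sq by (auto simp: field_simps)
    show "(\<integral>\<^sup>+a. g a * g b * f ((a + b) / sqrt 2) ((a - b) / sqrt 2) \<partial>lborel)
      = sqrt 2 * (\<integral>\<^sup>+u. g (sqrt 2 * u - b) * g b * f u (u - sqrt 2 * b) \<partial>lborel)"
      by (subst nn_integral_real_affine[where c="sqrt 2" and t="- b"]) (measurable, simp only: e, simp add: e)
  qed
  also have "\<dots> = (\<integral>\<^sup>+b. \<integral>\<^sup>+u. sqrt 2 * (g (sqrt 2 * u - b) * g b * f u (u - sqrt 2 * b)) \<partial>lborel \<partial>lborel)"
    by (simp add: nn_integral_cmult)
  also have "\<dots> = (\<integral>\<^sup>+u. \<integral>\<^sup>+b. sqrt 2 * (g (sqrt 2 * u - b) * g b * f u (u - sqrt 2 * b)) \<partial>lborel \<partial>lborel)"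
    by (rule lborel_pair.Fubini'[symmetric]) measurable
  also have "\<dots> = (\<integral>\<^sup>+u. \<integral>\<^sup>+v. g u * g v * f u v \<partial>lborel \<partial>lborel)"
  proof (rule nn_integral_cong)
    fix u :: real
    have e: "u / sqrt 2 + (- 1 / sqrt 2) * v = (u - v) / sqrt 2"
      "sqrt 2 * u - (u - v) / sqrt 2 = (u + v) / sqrt 2"
      "u - sqrt 2 * ((u - v) / sqrt 2) = v" for v
      using sq by (auto simp: field_simps)
    define h where "h b = ennreal (sqrt 2) * (g (sqrt 2 * u - b) * g b * f u (u - sqrt 2 * b))" for b
    have [measurable]: "h \<in> borel_measurable borel" unfolding h_def by measurable
    have h: "h (u / sqrt 2 + (- 1 / sqrt 2) * v) = ennreal (sqrt 2) * (g ((u + v) / sqrt 2) * g ((u - v) / sqrt 2) * f u v)" for v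
      unfolding h_def e ..
    have "(\<integral>\<^sup>+b. h b \<partial>lborel) = ennreal \<bar>- 1 / sqrt 2\<bar> * (\<integral>\<^sup>+v. h (u / sqrt 2 + (- 1 / sqrt 2) * v) \<partial>lborel)"
      by (rule nn_integral_real_affine) auto
    also have "\<dots> = ennreal \<bar>- 1 / sqrt 2\<bar> * (\<integral>\<^sup>+v. ennreal (sqrt 2) * (g ((u + v) / sqrt 2) * g ((u - v) / sqrt 2) * f u v) \<partial>lborel)"
      unfolding h ..
    also have "\<dots> = (\<integral>\<^sup>+v. (ennreal \<bar>- 1 / sqrt 2\<bar> * ennreal (sqrt 2)) * (g u * g v * f u v) \<partial>lborel)"
      by (simp add: gg mult.assoc flip: nn_integral_cmult)
    also have "ennreal \<bar>- 1 / sqrt 2\<bar> * ennreal (sqrt 2) = 1"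
      by (simp flip: ennreal_mult')
    finally show "(\<integral>\<^sup>+b. sqrt 2 * (g (sqrt 2 * u - b) * g b * f u (u - sqrt 2 * b)) \<partial>lborel) = (\<integral>\<^sup>+v. g u * g v * f u v \<partial>lborel)"
      unfolding h_def by simp
  qed
  also have "\<dots> = (\<integral>\<^sup>+v. \<integral>\<^sup>+u. g u * g v * f u v \<partial>lborel \<partial>lborel)"
    by (rule lborel_pair.Fubini'[symmetric]) measurable
  also have "\<dots> = (\<integral>\<^sup>+a. \<integral>\<^sup>+b. f a b \<partial>N \<partial>N)"
    by (rule N[symmetric]) measurable
  finally show ?thesis .
qed

text \<open>The rotation mixes only equal coordinates of the two copies, so they can be treated one
  at a time. Integrating out the two copies of the new coordinate \<open>i\<close> leaves a function
  \<open>K\<close> of the rotated remaining coordinates, to which the induction hypothesis applies;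
  hence the induction is over arbitrary \<open>f\<close>.\<close>

lemma PiM_normal_rotation:
  fixes f :: "('i \<Rightarrow> real) \<Rightarrow> ('i \<Rightarrow> real) \<Rightarrow> ennreal"
  assumes \<sigma>: "0 < \<sigma>" and I: "finite I"
    and f: "case_prod f \<in> borel_measurable (PiM I (\<lambda>_. density lborel (normal_density 0 \<sigma>)) \<Otimes>\<^sub>M PiM I (\<lambda>_. density lborel (normal_density 0 \<sigma>)))"
  defines "Q \<equiv> \<lambda>I. PiM I (\<lambda>_::'i. density lborel (normal_density 0 \<sigma>))"
  shows "(\<integral>\<^sup>+h. \<integral>\<^sup>+h'. f (\<lambda>i\<in>I. (h i + h' i) / sqrt 2) (\<lambda>i\<in>I. (h i - h' i) / sqrt 2) \<partial>Q I \<partial>Q I)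
    = (\<integral>\<^sup>+h. \<integral>\<^sup>+h'. f h h' \<partial>Q I \<partial>Q I)"
proof -
  define N where "N = density lborel (\<lambda>x. ennreal (normal_density 0 \<sigma> x))"
  interpret N: prob_space N unfolding N_def by (rule prob_space_normal_density[OF \<sigma>])
  interpret product_prob_space "\<lambda>_::'i. N" ..
  have Q: "Q I = PiM I (\<lambda>_. N)" for I by (simp add: Q_def N_def)
  have setsN [measurable_cong]: "sets N = sets borel" by (simp add: N_def)
  have rot2: "(\<integral>\<^sup>+a. \<integral>\<^sup>+b. g ((a + b) / sqrt 2) ((a - b) / sqrt 2) \<partial>N \<partial>N) = (\<integral>\<^sup>+a. \<integral>\<^sup>+b. g a b \<partial>N \<partial>N)"
    if "case_prod g \<in> borel_measurable (borel \<Otimes>\<^sub>M borel)" for g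
    using normal_rotation_2[OF \<sigma> that] by (simp add: N_def)
  have "case_prod f \<in> borel_measurable (Q I \<Otimes>\<^sub>M Q I)" using f by (simp add: Q_def)
  with I show ?thesis
  proof (induction I arbitrary: f rule: finite_induct)
    case empty
    have "(\<lambda>i\<in>{}. g i) = (\<lambda>_. undefined)" for g :: "'i \<Rightarrow> real" by (simp add: restrict_def)
    moreover have "prob_space (PiM {} (\<lambda>_::'i. N))" by (rule prob_space_PiM) (rule N.prob_space_axioms)
    ultimately show ?case by (simp add: Q nn_integral_empty prob_space.emeasure_space_1)
  next
    case (insert i I)
    interpret QI: prob_space "Q I" unfolding Q by (rule prob_space_PiM) (rule N.prob_space_axioms)
    interpret QJ: prob_space "Q (insert i I)" unfolding Q by (rule prob_space_PiM) (rule N.prob_space_axioms)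
    interpret NQ: pair_sigma_finite N "Q I" ..
    have comp: "(\<lambda>x. x j) \<in> borel_measurable (Q J)" if "j \<in> J" for j J
      using measurable_component_singleton[OF that, of "\<lambda>_. N"] by (simp add: Q setsN cong: measurable_cong_sets)
    have upd [measurable]: "(\<lambda>z. (u z)(i := v z)) \<in> M \<rightarrow>\<^sub>M Q (insert i I)"
      if "u \<in> M \<rightarrow>\<^sub>M Q I" "v \<in> borel_measurable M" for u v and M :: "'z measure"
      using that unfolding Q by (intro measurable_fun_upd[where J=I]) (auto simp: setsN cong: measurable_cong_sets)
    have res: "(\<lambda>z. \<lambda>j\<in>J. u z j) \<in> M \<rightarrow>\<^sub>M Q J"
      if "\<And>j. j \<in> J \<Longrightarrow> (\<lambda>z. u z j) \<in> borel_measurable M" for u J and M :: "'z measure"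
      using that unfolding Q by (intro measurable_restrict) (auto simp: setsN cong: measurable_cong_sets)
    have [measurable]: "(\<lambda>z. \<lambda>j\<in>J. (fst z j + snd z j) / sqrt 2) \<in> Q J \<Otimes>\<^sub>M Q J \<rightarrow>\<^sub>M Q J"
      "(\<lambda>z. \<lambda>j\<in>J. (fst z j - snd z j) / sqrt 2) \<in> Q J \<Otimes>\<^sub>M Q J \<rightarrow>\<^sub>M Q J" for J
      by (intro res borel_measurable_divide borel_measurable_add borel_measurable_diff borel_measurable_const
          measurable_compose[OF measurable_fst comp] measurable_compose[OF measurable_snd comp]; assumption)+
    have ins: "(\<integral>\<^sup>+h. G h \<partial>Q (insert i I)) = (\<integral>\<^sup>+x. \<integral>\<^sup>+y. G (x(i := y)) \<partial>N \<partial>Q I)"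
      if "G \<in> borel_measurable (Q (insert i I))" for G
      using product_nn_integral_insert[OF insert.hyps, of G] that by (simp add: Q)
    have split: "(\<integral>\<^sup>+h. \<integral>\<^sup>+h'. g h h' \<partial>Q (insert i I) \<partial>Q (insert i I))
      = (\<integral>\<^sup>+x. \<integral>\<^sup>+x'. \<integral>\<^sup>+y. \<integral>\<^sup>+y'. g (x(i := y)) (x'(i := y')) \<partial>N \<partial>N \<partial>Q I \<partial>Q I)"
      if [measurable]: "case_prod g \<in> borel_measurable (Q (insert i I) \<Otimes>\<^sub>M Q (insert i I))" for g
    proof -
      have "(\<integral>\<^sup>+h. \<integral>\<^sup>+h'. g h h' \<partial>Q (insert i I) \<partial>Q (insert i I))
        = (\<integral>\<^sup>+x. \<integral>\<^sup>+y. \<integral>\<^sup>+h'. g (x(i := y)) h' \<partial>Q (insert i I) \<partial>N \<partial>Q I)"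
        by (rule ins) measurable
      also have "\<dots> = (\<integral>\<^sup>+x. \<integral>\<^sup>+y. \<integral>\<^sup>+x'. \<integral>\<^sup>+y'. g (x(i := y)) (x'(i := y')) \<partial>N \<partial>Q I \<partial>N \<partial>Q I)"
      proof (intro nn_integral_cong)
        fix x y assume [measurable]: "x \<in> space (Q I)" "y \<in> space N"
        then have [measurable]: "x(i := y) \<in> space (Q (insert i I))"
          unfolding Q by (auto simp: space_PiM PiE_def extensional_def)
        show "(\<integral>\<^sup>+h'. g (x(i := y)) h' \<partial>Q (insert i I)) = (\<integral>\<^sup>+x'. \<integral>\<^sup>+y'. g (x(i := y)) (x'(i := y')) \<partial>N \<partial>Q I)"
          by (rule ins) measurable
      qed
      also have "\<dots> = (\<integral>\<^sup>+x. \<integral>\<^sup>+x'. \<integral>\<^sup>+y. \<integral>\<^sup>+y'. g (x(i := y)) (x'(i := y')) \<partial>N \<partial>N \<partial>Q I \<partial>Q I)"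
      proof (rule nn_integral_cong)
        fix x assume [measurable]: "x \<in> space (Q I)"
        show "(\<integral>\<^sup>+y. \<integral>\<^sup>+x'. \<integral>\<^sup>+y'. g (x(i := y)) (x'(i := y')) \<partial>N \<partial>Q I \<partial>N)
          = (\<integral>\<^sup>+x'. \<integral>\<^sup>+y. \<integral>\<^sup>+y'. g (x(i := y)) (x'(i := y')) \<partial>N \<partial>N \<partial>Q I)"
          by (rule NQ.Fubini'[symmetric]) measurable
      qed
      finally show ?thesis .
    qed
    note [measurable] = insert.prems
    define K where "K x x' = (\<integral>\<^sup>+y. \<integral>\<^sup>+y'. f (x(i := y)) (x'(i := y')) \<partial>N \<partial>N)" for x x'
    have [measurable]: "case_prod K \<in> borel_measurable (Q I \<Otimes>\<^sub>M Q I)"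
      unfolding K_def by measurable
    let ?rp = "\<lambda>J x x'. \<lambda>j\<in>J. (x j + x' j) / sqrt 2" and ?rm = "\<lambda>J x x'. \<lambda>j\<in>J. (x j - x' j) / sqrt 2"
    have upd_rot: "?rp (insert i I) (x(i := y)) (x'(i := y')) = (?rp I x x')(i := (y + y') / sqrt 2)"
      "?rm (insert i I) (x(i := y)) (x'(i := y')) = (?rm I x x')(i := (y - y') / sqrt 2)" for x x' :: "'i \<Rightarrow> real" and y y' :: real
      using insert.hyps(2) by (auto simp: fun_eq_iff)
    have m: "(\<lambda>(h, h'). f (?rp (insert i I) h h') (?rm (insert i I) h h')) \<in> borel_measurable (Q (insert i I) \<Otimes>\<^sub>M Q (insert i I))"
      by measurable
    have "(\<integral>\<^sup>+h. \<integral>\<^sup>+h'. f (?rp (insert i I) h h') (?rm (insert i I) h h') \<partial>Q (insert i I) \<partial>Q (insert i I))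
      = (\<integral>\<^sup>+x. \<integral>\<^sup>+x'. \<integral>\<^sup>+y. \<integral>\<^sup>+y'. f ((?rp I x x')(i := (y + y') / sqrt 2)) ((?rm I x x')(i := (y - y') / sqrt 2)) \<partial>N \<partial>N \<partial>Q I \<partial>Q I)"
      using split[OF m] by (simp only: upd_rot)
    also have "\<dots> = (\<integral>\<^sup>+x. \<integral>\<^sup>+x'. K (?rp I x x') (?rm I x x') \<partial>Q I \<partial>Q I)"
    proof (intro nn_integral_cong)
      fix x x' assume [measurable]: "x \<in> space (Q I)" "x' \<in> space (Q I)"
      have [measurable]: "?rp I x x' \<in> space (Q I)" "?rm I x x' \<in> space (Q I)" by (auto simp: Q space_PiM N_def)
      show "(\<integral>\<^sup>+y. \<integral>\<^sup>+y'. f ((?rp I x x')(i := (y + y') / sqrt 2)) ((?rm I x x')(i := (y - y') / sqrt 2)) \<partial>N \<partial>N) = K (?rp I x x') (?rm I x x')"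
        unfolding K_def by (rule rot2) measurable
    qed
    also have "\<dots> = (\<integral>\<^sup>+x. \<integral>\<^sup>+x'. K x x' \<partial>Q I \<partial>Q I)"
      by (rule insert.IH) measurable
    also have "\<dots> = (\<integral>\<^sup>+h. \<integral>\<^sup>+h'. f h h' \<partial>Q (insert i I) \<partial>Q (insert i I))"
      unfolding K_def by (rule split[symmetric]) measurable
    finally show ?case .
  qed
qed

context gauss_product
begin

definition plus where "plus h h' = (\<lambda>i\<in>I. (h i + h' i) / sqrt 2)" for h h' :: "'i \<Rightarrow> real"
definition minus where "minus h h' = (\<lambda>i\<in>I. (h i - h' i) / sqrt 2)" for h h' :: "'i \<Rightarrow> real"

lemma restrict_measurable:
  "(\<And>i. i \<in> I \<Longrightarrow> (\<lambda>z. u z i) \<in> borel_measurable M) \<Longrightarrow> (\<lambda>z. \<lambda>i\<in>I. u z i) \<in> M \<rightarrow>\<^sub>M P"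
  by (intro measurable_restrict) (simp cong: measurable_cong_sets)

lemma plus_measurable [measurable]: "(\<lambda>z. plus (fst z) (snd z)) \<in> P \<Otimes>\<^sub>M P \<rightarrow>\<^sub>M P"
  unfolding plus_def by (rule restrict_measurable) measurable

lemma minus_measurable [measurable]: "(\<lambda>z. minus (fst z) (snd z)) \<in> P \<Otimes>\<^sub>M P \<rightarrow>\<^sub>M P"
  unfolding minus_def by (rule restrict_measurable) measurable

lemma nn_integral_rotation:
  assumes f [measurable]: "f \<in> borel_measurable (P \<Otimes>\<^sub>M P)"
  shows "(\<integral>\<^sup>+z. f (plus (fst z) (snd z), minus (fst z) (snd z)) \<partial>(P \<Otimes>\<^sub>M P)) = (\<integral>\<^sup>+z. f z \<partial>(P \<Otimes>\<^sub>M P))"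
proof -
  have "(\<integral>\<^sup>+h. \<integral>\<^sup>+h'. f (plus h h', minus h h') \<partial>P \<partial>P) = (\<integral>\<^sup>+h. \<integral>\<^sup>+h'. f (h, h') \<partial>P \<partial>P)"
    using PiM_normal_rotation[OF \<sigma> I, of "\<lambda>h h'. f (h, h')"] f by (simp add: plus_def minus_def)
  then show ?thesis
    by (simp add: PS.P.nn_integral_fst[symmetric])
qed

end

section \<open>Nets of sparse vectors and chaining\<close>

definition supported_on :: "'a set \<Rightarrow> ('a \<Rightarrow> real) \<Rightarrow> bool" where
  "supported_on \<Gamma> x \<longleftrightarrow> (\<forall>a. a \<notin> \<Gamma> \<longrightarrow> x a = 0)"

text \<open>The mesh \<open>1 / (4 * s)\<close> makes the squared rounding error of an
  \<open>s\<close>-sparse vector at most \<open>1 / (16 * s)\<close>, while each entry has at most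
  \<open>8 * s + 1\<close> possible values.\<close>

definition sparse_net :: "nat \<Rightarrow> nat \<Rightarrow> (nat \<Rightarrow> real) set" where
  "sparse_net N s = {x. (\<exists>\<Gamma>\<subseteq>{1..N}. card \<Gamma> \<le> s \<and> supported_on \<Gamma> x) \<and>
     (\<Sum>a\<in>{1..N}. (x a)\<^sup>2) \<le> 1 \<and> (\<forall>a. \<exists>k::int. x a = k / (4 * s))}"

lemma zero_in_sparse_net: "(\<lambda>_. 0) \<in> sparse_net N s"
proof -
  have "\<exists>\<Gamma>\<subseteq>{1..N}. card \<Gamma> \<le> s \<and> supported_on \<Gamma> (\<lambda>_. 0)"
    by (rule exI[of _ "{}"]) (simp add: supported_on_def)
  then show ?thesis unfolding sparse_net_def by (auto intro: exI[of _ 0])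
qed

text \<open>Each of \<open>s\<close> coordinates contributes a factor \<open>N\<close> for its place
  and \<open>8 * s + 1 \<le> 9 * N\<close> for its value, after the support has been enlarged to
  exactly \<open>s\<close> elements.\<close>

lemma sparse_net_card:
  assumes s: "0 < s" "s \<le> N"
  shows "finite (sparse_net N s)" "card (sparse_net N s) \<le> (9 * N\<^sup>2) ^ s"
proof -
  define E where "E \<Gamma> = (\<lambda>f a. if a \<in> \<Gamma> then real_of_int (f a) / (4 * s) else 0) ` (\<Gamma> \<rightarrow>\<^sub>E {- 4 * int s..4 * int s})" for \<Gamma> :: "nat set"
  define S where "S = {\<Gamma>. \<Gamma> \<subseteq> {1..N} \<and> card \<Gamma> = s}"
  have finS: "finite S" unfolding S_def by simp
  have cS: "card S \<le> N ^ s" unfolding S_def using n_subsets[of "{1..N}" s] binomial_le_pow[OF s(2)] by simp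
  have fE: "finite (E \<Gamma>)" "card (E \<Gamma>) \<le> (9 * N) ^ s" if "\<Gamma> \<in> S" for \<Gamma>
  proof -
    have \<Gamma>: "finite \<Gamma>" "card \<Gamma> = s" using that finite_subset by (auto simp: S_def)
    then show "finite (E \<Gamma>)" unfolding E_def by (intro finite_imageI finite_PiE) auto
    have "card (E \<Gamma>) \<le> card (\<Gamma> \<rightarrow>\<^sub>E {- 4 * int s..4 * int s})"
      unfolding E_def using \<Gamma> by (intro card_image_le finite_PiE) auto
    also have "\<dots> = (8 * s + 1) ^ s"
    proof -
      have "card {- 4 * int s..4 * int s} = 8 * s + 1" by simp
      then show ?thesis using \<Gamma> by (simp add: card_PiE)
    qed
    also have "\<dots> \<le> (9 * N) ^ s" using s by (intro power_mono) auto
    finally show "card (E \<Gamma>) \<le> (9 * N) ^ s" .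
  qed
  have sub: "sparse_net N s \<subseteq> (\<Union>\<Gamma>\<in>S. E \<Gamma>)"
  proof
    fix x assume x: "x \<in> sparse_net N s"
    then obtain \<Gamma> where \<Gamma>: "\<Gamma> \<subseteq> {1..N}" "card \<Gamma> \<le> s" "supported_on \<Gamma> x" by (auto simp: sparse_net_def)
    obtain \<Gamma>' where \<Gamma>': "\<Gamma> \<subseteq> \<Gamma>'" "\<Gamma>' \<subseteq> {1..N}" "card \<Gamma>' = s"
      using exists_subset_between[of \<Gamma> s "{1..N}"] \<Gamma> s by auto
    obtain f where f: "\<And>a. x a = real_of_int (f a) / (4 * s)"
      using x unfolding sparse_net_def by (auto simp: choice_iff)
    have bd: "f a \<in> {- 4 * int s..4 * int s}" if a: "a \<in> \<Gamma>'" for a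
    proof -
      have "(x a)\<^sup>2 \<le> (\<Sum>a\<in>{1..N}. (x a)\<^sup>2)" using a \<Gamma>' by (intro member_le_sum) auto
      also have "\<dots> \<le> 1" using x by (simp add: sparse_net_def)
      finally have "\<bar>x a\<bar> \<le> 1" by (simp add: abs_square_le_1)
      then have "\<bar>real_of_int (f a)\<bar> \<le> 4 * s" using s by (simp add: f divide_simps)
      then show ?thesis by auto
    qed
    have "x = (\<lambda>a. if a \<in> \<Gamma>' then real_of_int (restrict f \<Gamma>' a) / (4 * s) else 0)"
      using f \<Gamma>(3) \<Gamma>'(1) by (auto simp: fun_eq_iff supported_on_def)
    moreover have "restrict f \<Gamma>' \<in> \<Gamma>' \<rightarrow>\<^sub>E {- 4 * int s..4 * int s}" using bd by auto
    ultimately have "x \<in> E \<Gamma>'" unfolding E_def by blast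
    then show "x \<in> (\<Union>\<Gamma>\<in>S. E \<Gamma>)" using \<Gamma>' by (auto simp: S_def)
  qed
  have fin: "finite (\<Union>\<Gamma>\<in>S. E \<Gamma>)" using finS fE by auto
  then show "finite (sparse_net N s)" using sub finite_subset by blast
  have "card (sparse_net N s) \<le> card (\<Union>\<Gamma>\<in>S. E \<Gamma>)" by (rule card_mono[OF fin sub])
  also have "\<dots> \<le> (\<Sum>\<Gamma>\<in>S. card (E \<Gamma>))" by (rule card_UN_le[OF finS])
  also have "\<dots> \<le> (\<Sum>\<Gamma>\<in>S. (9 * N) ^ s)" using fE by (intro sum_mono) auto
  also have "\<dots> = card S * (9 * N) ^ s" by simp
  also have "\<dots> \<le> N ^ s * (9 * N) ^ s" using cS by (rule mult_right_mono) simp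
  also have "\<dots> = (9 * N\<^sup>2) ^ s" by (simp only: power_mult_distrib[symmetric]) (simp add: power2_eq_square mult_ac)
  finally show "card (sparse_net N s) \<le> (9 * N\<^sup>2) ^ s" .
qed

lemma sparse_net_l1:
  assumes "x \<in> sparse_net N s"
  shows "(\<Sum>a\<in>{1..N}. \<bar>x a\<bar>) \<le> sqrt s"
proof -
  obtain \<Gamma> where \<Gamma>: "\<Gamma> \<subseteq> {1..N}" "card \<Gamma> \<le> s" "supported_on \<Gamma> x" using assms by (auto simp: sparse_net_def)
  have "(\<Sum>a\<in>{1..N}. \<bar>x a\<bar>) = (\<Sum>a\<in>\<Gamma>. \<bar>x a\<bar> * 1)"
    using \<Gamma> by (subst sum.mono_neutral_left[of "{1..N}" \<Gamma>]) (auto simp: supported_on_def)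
  then have "(\<Sum>a\<in>{1..N}. \<bar>x a\<bar>)\<^sup>2 \<le> (\<Sum>a\<in>\<Gamma>. \<bar>x a\<bar>\<^sup>2) * (\<Sum>a\<in>\<Gamma>. 1\<^sup>2)"
    using Cauchy_Schwarz_ineq_sum[of "\<lambda>a. \<bar>x a\<bar>" "\<lambda>_. 1" \<Gamma>] by simp
  also have "\<dots> \<le> 1 * real s"
  proof (intro mult_mono)
    have "(\<Sum>a\<in>\<Gamma>. \<bar>x a\<bar>\<^sup>2) \<le> (\<Sum>a\<in>{1..N}. \<bar>x a\<bar>\<^sup>2)" using \<Gamma> by (intro sum_mono2) auto
    then show "(\<Sum>a\<in>\<Gamma>. \<bar>x a\<bar>\<^sup>2) \<le> 1" using assms by (simp add: sparse_net_def)
  qed (use \<Gamma> in auto)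
  finally show ?thesis by (simp add: real_le_rsqrt)
qed

lemma sparse_net_approx:
  assumes s: "0 < s" and \<Gamma>: "\<Gamma> \<subseteq> {1..N}" "card \<Gamma> \<le> s" "supported_on \<Gamma> x" and x: "(\<Sum>a\<in>{1..N}. (x a)\<^sup>2) \<le> 1"
  shows "\<exists>z\<in>sparse_net N s. supported_on \<Gamma> z \<and> (\<Sum>a\<in>{1..N}. (x a - z a)\<^sup>2) \<le> 1 / 16"
proof -
  \<comment> \<open>Rounding towards zero increases no coordinate in modulus and keeps zeros, so the
    rounded vector remains in the unit ball and on \<open>\<Gamma>\<close>.\<close>
  define k where "k a = (if x a \<ge> 0 then \<lfloor>4 * s * x a\<rfloor> else \<lceil>4 * s * x a\<rceil>)" for a
  define z where "z a = real_of_int (k a) / (4 * s)" for a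
  have z: "\<bar>z a\<bar> \<le> \<bar>x a\<bar> \<and> \<bar>x a - z a\<bar> \<le> 1 / (4 * s)" for a
  proof -
    define t where "t = 4 * real s * x a"
    have t: "x a = t / (4 * s)" using s by (simp add: t_def)
    have "\<bar>real_of_int (k a)\<bar> \<le> \<bar>t\<bar> \<and> \<bar>t - real_of_int (k a)\<bar> \<le> 1"
    proof (cases "x a \<ge> 0")
      case True
      then have "0 \<le> t" "k a = \<lfloor>t\<rfloor>" by (simp_all add: k_def t_def)
      then have "0 \<le> real_of_int (k a)" "real_of_int (k a) \<le> t" "t - 1 \<le> real_of_int (k a)"
        using floor_correct[of t] by auto
      then show ?thesis by auto
    next
      case False
      then have "t \<le> 0" "k a = \<lceil>t\<rceil>" by (simp_all add: k_def t_def mult_nonneg_nonpos)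
      then have "real_of_int (k a) \<le> 0" "t \<le> real_of_int (k a)" "real_of_int (k a) \<le> t + 1"
        using ceiling_correct[of t] by auto
      then show ?thesis using \<open>t \<le> 0\<close> by auto
    qed
    then have "\<bar>real_of_int (k a)\<bar> / (4 * s) \<le> \<bar>t\<bar> / (4 * s)" "\<bar>t - real_of_int (k a)\<bar> / (4 * s) \<le> 1 / (4 * s)"
      by (auto intro!: divide_right_mono)
    then show ?thesis unfolding z_def t by (simp add: abs_divide flip: diff_divide_distrib)
  qed
  have sup: "supported_on \<Gamma> z" using \<Gamma>(3) by (simp add: supported_on_def z_def k_def)
  have "(\<Sum>a\<in>{1..N}. (z a)\<^sup>2) \<le> (\<Sum>a\<in>{1..N}. (x a)\<^sup>2)"
    using z by (intro sum_mono) (simp add: abs_le_square_iff)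
  then have "z \<in> sparse_net N s" using \<Gamma> sup x unfolding sparse_net_def by (auto simp: z_def)
  moreover have "(\<Sum>a\<in>{1..N}. (x a - z a)\<^sup>2) \<le> 1 / 16"
  proof -
    have "(\<Sum>a\<in>{1..N}. (x a - z a)\<^sup>2) = (\<Sum>a\<in>\<Gamma>. (x a - z a)\<^sup>2)"
      using \<Gamma> sup by (intro sum.mono_neutral_right) (auto simp: supported_on_def)
    also have "\<dots> \<le> (\<Sum>a\<in>\<Gamma>. (1 / (4 * s))\<^sup>2)"
      using z by (intro sum_mono iffD1[OF abs_le_square_iff]) (simp add: abs_of_nonneg)
    also have "\<dots> = card \<Gamma> * (1 / (4 * s))\<^sup>2" by simp
    also have "\<dots> \<le> s * (1 / (4 * s))\<^sup>2" using \<Gamma> by (intro mult_right_mono) auto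
    also have "\<dots> = 1 / (16 * s)" using s by (simp add: power2_eq_square)
    also have "\<dots> \<le> 1 / 16" using s by (simp add: field_simps)
    finally show ?thesis .
  qed
  ultimately show ?thesis using sup by blast
qed

text \<open>The approximation error is absorbed into the supremum \<open>M\<close> of the quadratic
  form itself over the unit ball on \<open>\<Gamma>\<close>, which is finite. Symmetry allows
  polarization, so the bilinear form is bounded by the same \<open>M\<close>.\<close>

lemma bilinear_le_net:
  fixes A :: "nat \<Rightarrow> nat \<Rightarrow> real" and x y :: "nat \<Rightarrow> real" and N s :: nat
  defines "B \<equiv> \<lambda>u v. \<Sum>a\<in>{1..N}. \<Sum>b\<in>{1..N}. u a * A a b * v b"
  assumes sym: "\<And>a b. A a b = A b a" and s: "0 < s"
    and net: "\<And>z. z \<in> sparse_net N s \<Longrightarrow> \<bar>B z z\<bar> \<le> \<kappa>"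
    and \<Gamma>: "\<Gamma> \<subseteq> {1..N}" "card \<Gamma> \<le> s" and sup: "supported_on \<Gamma> x" "supported_on \<Gamma> y"
    and x1: "(\<Sum>a\<in>{1..N}. (x a)\<^sup>2) = 1" and y1: "(\<Sum>a\<in>{1..N}. (y a)\<^sup>2) = 1"
  shows "\<bar>B y x\<bar> \<le> 3 * \<kappa>"
proof -
  define nsq where "nsq u = (\<Sum>a\<in>{1..N}. (u a)\<^sup>2)" for u :: "nat \<Rightarrow> real"
  define U where "U = {u. supported_on \<Gamma> u \<and> nsq u \<le> 1}"
  define M where "M = (SUP u\<in>U. \<bar>B u u\<bar>)"
  have Bsym: "B u v = B v u" for u v
  proof -
    have "B u v = (\<Sum>b\<in>{1..N}. \<Sum>a\<in>{1..N}. u a * A a b * v b)" unfolding B_def by (rule sum.swap)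
    also have "\<dots> = B v u" unfolding B_def by (intro sum.cong refl) (simp add: sym mult_ac)
    finally show ?thesis .
  qed
  have Badd: "B (\<lambda>a. u a + v a) w = B u w + B v w" "B (\<lambda>a. u a - v a) w = B u w - B v w"
    "B (\<lambda>a. c * u a) w = c * B u w" for u v w c
    by (simp_all add: B_def algebra_simps sum.distrib sum_subtractf sum_distrib_left)
  have Badd': "B w (\<lambda>a. u a + v a) = B w u + B w v" "B w (\<lambda>a. u a - v a) = B w u - B w v"
    "B w (\<lambda>a. c * u a) = c * B w u" for u v w c
    using Badd[of _ _ w] Bsym[of w] by simp_all
  have "(\<lambda>_. 0) \<in> U" by (simp add: U_def nsq_def supported_on_def)
  then have U0: "U \<noteq> {}" by blast
  have bdd: "bdd_above ((\<lambda>u. \<bar>B u u\<bar>) ` U)"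
  proof (rule bdd_aboveI2)
    fix u assume u: "u \<in> U"
    have ua: "\<bar>u a\<bar> \<le> 1" if "a \<in> {1..N}" for a
    proof -
      have "(u a)\<^sup>2 \<le> nsq u" unfolding nsq_def using that by (intro member_le_sum) auto
      then have "(u a)\<^sup>2 \<le> 1" using u by (simp add: U_def)
      then show ?thesis by (simp add: abs_square_le_1)
    qed
    have "\<bar>B u u\<bar> \<le> (\<Sum>a\<in>{1..N}. \<Sum>b\<in>{1..N}. \<bar>u a * A a b * u b\<bar>)"
      unfolding B_def by (rule order_trans[OF sum_abs sum_mono[OF sum_abs]])
    also have "\<dots> \<le> (\<Sum>a\<in>{1..N}. \<Sum>b\<in>{1..N}. \<bar>A a b\<bar>)"
    proof (intro sum_mono)
      fix a b assume "a \<in> {1..N}" "b \<in> {1..N}"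
      then have "\<bar>u a\<bar> * \<bar>A a b\<bar> * \<bar>u b\<bar> \<le> 1 * \<bar>A a b\<bar> * 1"
        using ua by (intro mult_mono) auto
      then show "\<bar>u a * A a b * u b\<bar> \<le> \<bar>A a b\<bar>" by (simp add: abs_mult)
    qed
    finally show "\<bar>B u u\<bar> \<le> (\<Sum>a\<in>{1..N}. \<Sum>b\<in>{1..N}. \<bar>A a b\<bar>)" .
  qed
  have leM: "\<bar>B u u\<bar> \<le> M" if "u \<in> U" for u unfolding M_def using bdd that by (rule cSUP_upper2) simp
  have M0: "0 \<le> M" using leM[OF \<open>(\<lambda>_. 0) \<in> U\<close>] by linarith
  have homog: "\<bar>B u u\<bar> \<le> M * nsq u" if u: "supported_on \<Gamma> u" for u
  proof (cases "nsq u = 0")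
    case True
    then have "\<forall>a\<in>{1..N}. u a = 0" unfolding nsq_def by (simp add: sum_nonneg_eq_0_iff)
    then have "B u u = 0" unfolding B_def by simp
    then show ?thesis using True by simp
  next
    case False
    then have pos: "0 < nsq u" unfolding nsq_def by (simp add: less_le sum_nonneg)
    define c where "c = 1 / sqrt (nsq u)"
    have c2: "c * c * nsq u = 1" using pos by (simp add: c_def)
    have "nsq (\<lambda>a. c * u a) = c * c * nsq u"
      by (simp add: nsq_def power2_eq_square sum_distrib_left mult_ac)
    then have "(\<lambda>a. c * u a) \<in> U" using u c2 by (simp add: U_def supported_on_def)
    from leM[OF this] have "\<bar>c * c * B u u\<bar> \<le> M" by (simp add: Badd Badd' mult_ac)
    then have "c * c * \<bar>B u u\<bar> \<le> M * (c * c * nsq u)" using c2 by (simp add: abs_mult)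
    then have "c * c * \<bar>B u u\<bar> \<le> c * c * (M * nsq u)" by (simp add: mult_ac)
    moreover have "c * c > 0" using pos by (simp add: c_def)
    ultimately show ?thesis by (simp add: mult_le_cancel_left)
  qed
  have polar: "\<bar>B u v\<bar> \<le> M * (nsq u + nsq v) / 2" if u: "supported_on \<Gamma> u" and v: "supported_on \<Gamma> v" for u v
  proof -
    have "4 * B u v = B (\<lambda>a. u a + v a) (\<lambda>a. u a + v a) - B (\<lambda>a. u a - v a) (\<lambda>a. u a - v a)"
      using Bsym[of u v] by (simp add: Badd Badd')
    moreover have "\<bar>B (\<lambda>a. u a + v a) (\<lambda>a. u a + v a)\<bar> \<le> M * nsq (\<lambda>a. u a + v a)"
      "\<bar>B (\<lambda>a. u a - v a) (\<lambda>a. u a - v a)\<bar> \<le> M * nsq (\<lambda>a. u a - v a)"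
      using u v by (intro homog; simp add: supported_on_def)+
    moreover have "nsq (\<lambda>a. u a + v a) + nsq (\<lambda>a. u a - v a) = 2 * (nsq u + nsq v)"
      by (simp add: nsq_def power2_sum power2_diff sum_distrib_left flip: sum.distrib)
    then have "M * nsq (\<lambda>a. u a + v a) + M * nsq (\<lambda>a. u a - v a) = 2 * (M * (nsq u + nsq v))"
      by (simp only: distrib_left[symmetric])
    ultimately show ?thesis by linarith
  qed
  have "\<bar>B u u\<bar> \<le> \<kappa> + 5 / 8 * M" if u: "u \<in> U" for u
  proof -
    obtain z where z: "z \<in> sparse_net N s" "supported_on \<Gamma> z" "nsq (\<lambda>a. u a - z a) \<le> 1 / 16"
      using sparse_net_approx[OF s \<Gamma>, of u] u by (auto simp: U_def nsq_def)
    \<comment> \<open>The factors 2 and \<open>1 / 2\<close> balance the error term against the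
      bound \<open>M * (nsq u + nsq v) / 2\<close>: a squared error of \<open>1 / 16\<close> gives
      \<open>M * (1 / 4 + 1) / 2 = 5 / 8 * M\<close>, and then
      \<open>M \<le> 8 / 3 * \<kappa>\<close>.\<close>
    have eq: "B u u = B z z + B (\<lambda>a. 2 * (u a - z a)) (\<lambda>a. 1 / 2 * (u a + z a))"
      using Bsym[of u z] by (simp only: Badd Badd') (simp add: algebra_simps)
    have "nsq (\<lambda>a. 2 * (u a - z a)) = 4 * nsq (\<lambda>a. u a - z a)"
      unfolding nsq_def power_mult_distrib sum_distrib_left by simp
    then have n1: "nsq (\<lambda>a. 2 * (u a - z a)) \<le> 1 / 4" using z by simp
    have n2: "nsq (\<lambda>a. 1 / 2 * (u a + z a)) \<le> 1"
    proof -
      have "(1 / 2 * (u a + z a))\<^sup>2 \<le> 1 / 2 * (u a)\<^sup>2 + 1 / 2 * (z a)\<^sup>2" for a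
        using sum_squares_bound[of "u a" "z a"] by (simp add: power2_eq_square field_simps)
      then have "nsq (\<lambda>a. 1 / 2 * (u a + z a)) \<le> (\<Sum>a\<in>{1..N}. 1 / 2 * (u a)\<^sup>2 + 1 / 2 * (z a)\<^sup>2)"
        unfolding nsq_def by (rule sum_mono)
      also have "\<dots> = 1 / 2 * nsq u + 1 / 2 * nsq z" by (simp add: nsq_def sum.distrib sum_distrib_left)
      also have "\<dots> \<le> 1" using u z by (simp add: U_def sparse_net_def nsq_def)
      finally show ?thesis .
    qed
    have "\<bar>B (\<lambda>a. 2 * (u a - z a)) (\<lambda>a. 1 / 2 * (u a + z a))\<bar>
      \<le> M * (nsq (\<lambda>a. 2 * (u a - z a)) + nsq (\<lambda>a. 1 / 2 * (u a + z a))) / 2"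
      using u z by (intro polar) (auto simp: supported_on_def U_def)
    also have "\<dots> \<le> M * (1 / 4 + 1) / 2" using n1 n2 M0 by (intro divide_right_mono mult_left_mono) auto
    finally have "\<bar>B (\<lambda>a. 2 * (u a - z a)) (\<lambda>a. 1 / 2 * (u a + z a))\<bar> \<le> 5 / 8 * M" by simp
    moreover have "\<bar>B u u\<bar> \<le> \<bar>B z z\<bar> + \<bar>B (\<lambda>a. 2 * (u a - z a)) (\<lambda>a. 1 / 2 * (u a + z a))\<bar>"
      by (subst eq) (rule abs_triangle_ineq)
    ultimately show ?thesis using net[OF z(1)] by (rule_tac order_trans[OF _ add_mono])
  qed
  then have "M \<le> \<kappa> + 5 / 8 * M" unfolding M_def by (intro cSUP_least[OF U0]) auto
  then have "M \<le> 8 / 3 * \<kappa>" by simp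
  moreover have "\<bar>B y x\<bar> \<le> M" using polar[OF sup(2,1)] x1 y1 by (simp add: nsq_def)
  ultimately show ?thesis using M0 by simp
qed

section \<open>Approximating chains for the spectral distance\<close>

context probe_channel
begin

abbreviation "grid k \<equiv> 2 * pi * real k / real (8 * n\<^sup>2)"

lemma fhat_diff: "fhat (\<lambda>c. x c - y c) \<theta> i = fhat x \<theta> i - fhat y \<theta> i"
  by (simp add: fhat_def left_diff_distrib sum_subtractf)

lemma spec_diff_le: "spec (\<lambda>c. x c - y c) \<theta> \<le> 2 * spec x \<theta> + 2 * spec y \<theta>"
proof -
  have "(cmod (a - b))\<^sup>2 \<le> 2 * (cmod a)\<^sup>2 + 2 * (cmod b)\<^sup>2" for a b
  proof -
    have "(cmod (a - b))\<^sup>2 \<le> (cmod a + cmod b)\<^sup>2" by (intro power_mono norm_triangle_ineq4) auto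
    then show ?thesis using sum_squares_bound[of "cmod a" "cmod b"] by (simp add: power2_sum)
  qed
  then show ?thesis unfolding spec_def fhat_diff sum_distrib_left sum.distrib[symmetric] by (rule sum_mono)
qed

text \<open>Serves the coarsest link of the chain, which starts at zero, and later the variance of
  \<open>Z x\<close> at a single vector.\<close>

lemma spec_le_l1: "spec x \<theta> \<le> (\<Sum>a\<in>cols. \<bar>x a\<bar>)\<^sup>2"
proof -
  define l where "l i = (\<Sum>c\<in>{c\<in>cols. blk c = i}. \<bar>x c\<bar>)" for i
  have l0: "0 \<le> l i" for i unfolding l_def by (intro sum_nonneg) auto
  have "cmod (fhat x \<theta> i) \<le> l i" for i
    unfolding fhat_def l_def by (rule order_trans[OF norm_sum]) (simp add: norm_mult)
  then have "spec x \<theta> \<le> (\<Sum>i\<in>{1..p}. (l i)\<^sup>2)"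
    unfolding spec_def by (intro sum_mono power_mono) auto
  also have "\<dots> \<le> (\<Sum>i\<in>{1..p}. l i * (\<Sum>j\<in>{1..p}. l j))"
    unfolding power2_eq_square using l0 by (intro sum_mono mult_left_mono member_le_sum) auto
  also have "\<dots> = (\<Sum>i\<in>{1..p}. l i)\<^sup>2" by (simp add: power2_eq_square flip: sum_distrib_right)
  also have "(\<Sum>i\<in>{1..p}. l i) = (\<Sum>a\<in>cols. \<bar>x a\<bar>)"
    unfolding l_def by (rule sum.group) (use blk_range in auto)
  finally show ?thesis .
qed

text \<open>The atoms are \<open>\<plusminus>\<surd>s e\<^sub>a\<close>; the mass left over by \<open>x\<close> is spread evenly, where it cancels. Net points with
  the same sample list share a representative inside \<open>T\<close>, since the empirical means are not sparse.\<close>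

lemma chain_level:
  fixes T :: "(nat \<Rightarrow> real) set" and s q L :: nat
  assumes T: "finite T" and l1: "\<And>x. x \<in> T \<Longrightarrow> (\<Sum>a\<in>cols. \<bar>x a\<bar>) \<le> sqrt s"
    and s: "0 < s" and q: "1 \<le> q" "8 * n\<^sup>2 \<le> 2 ^ q" and L: "0 < L"
  shows "\<exists>\<pi>. \<pi> ` T \<subseteq> T \<and> card (\<pi> ` T) \<le> (2 * (n * p)) ^ L \<and>
    (\<forall>x\<in>T. \<forall>k<8 * n\<^sup>2. spec (\<lambda>c. x c - \<pi> x c) (grid k) \<le> 160 * q * s / L)"
proof -
  define A where "A = cols \<times> (UNIV :: bool set)"
  define sg where "sg b = (if b then 1 else - 1 :: real)" for b
  \<comment> \<open>The block transform of the atom: at every frequency a single block is nonzero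
    and has modulus \<open>sqrt s\<close>, hence the bound \<open>B = s\<close> in Maurey's
    method.\<close>
  define v where "v t k i = (if blk (fst t) = i then complex_of_real (sg (snd t) * sqrt s) * cis (grid k * pos (fst t)) else 0)"
    for t :: "nat \<times> bool" and k i :: nat
  have A: "finite A" "card A = 2 * (n * p)" by (simp_all add: A_def card_cartesian_product)
  have N0: "0 < real (n * p)" using n0 p0 by simp
  have sumA: "(\<Sum>t\<in>A. f t) = (\<Sum>a\<in>cols. f (a, True) + f (a, False))" for f :: "_ \<Rightarrow> 'z::comm_monoid_add"
    unfolding A_def sum.cartesian_product' by (simp add: UNIV_bool add.commute)
  have "\<exists>g. (\<forall>l. g l \<in> A) \<and> (\<forall>k\<in>{..<8 * n\<^sup>2}.
    (\<Sum>i\<in>{1..p}. (cmod (fhat x (grid k) i - (1 / L) *\<^sub>R (\<Sum>l<L. v (g l) k i)))\<^sup>2) \<le> 40 * q * s / L)"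
    if x: "x \<in> T" for x
  proof -
    define l where "l = (\<Sum>a\<in>cols. \<bar>x a\<bar>)"
    define c where "c t = (\<bar>x (fst t)\<bar> + sg (snd t) * x (fst t)) / (2 * sqrt s) + (1 - l / sqrt s) / (2 * (n * p))"
      for t :: "nat \<times> bool"
    have c0: "0 \<le> c t" for t
    proof -
      have "0 \<le> (1 - l / sqrt s) / (2 * (n * p))"
        using l1[OF x] s by (simp add: l_def)
      moreover have "0 \<le> (\<bar>x (fst t)\<bar> + sg (snd t) * x (fst t)) / (2 * sqrt s)"
        by (simp add: sg_def)
      ultimately show ?thesis unfolding c_def by simp
    qed
    have c1: "(\<Sum>t\<in>A. c t) = 1"
    proof -
      have "c (a, True) + c (a, False) = \<bar>x a\<bar> / sqrt s + (1 - l / sqrt s) / (n * p)" for a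
        using s N0 by (simp add: c_def sg_def add_divide_distrib diff_divide_distrib)
      then have "(\<Sum>t\<in>A. c t) = l / sqrt s + (n * p) * ((1 - l / sqrt s) / (n * p))"
        unfolding sumA by (simp add: sum.distrib l_def sum_divide_distrib)
      then show ?thesis using n0 p0 s by simp
    qed
    have mean: "(\<Sum>t\<in>A. c t *\<^sub>R v t k i) = fhat x (grid k) i" for k i
    proof -
      have "c (a, True) *\<^sub>R v (a, True) k i + c (a, False) *\<^sub>R v (a, False) k i
        = (if blk a = i then of_real (x a) * cis (grid k * pos a) else 0)" for a
      proof -
        have "(c (a, True) - c (a, False)) * sqrt s = x a"
          using s by (simp add: c_def sg_def add_divide_distrib diff_divide_distrib)
        then have e: "complex_of_real (c (a, True)) * of_real (sqrt s) - complex_of_real (c (a, False)) * of_real (sqrt s) = of_real (x a)"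
          by (metis left_diff_distrib of_real_diff of_real_mult)
        show ?thesis
          unfolding e[symmetric] by (simp add: v_def sg_def scaleR_conv_of_real algebra_simps)
      qed
      then have "(\<Sum>t\<in>A. c t *\<^sub>R v t k i) = (\<Sum>a\<in>cols. if blk a = i then of_real (x a) * cis (grid k * pos a) else 0)"
        unfolding sumA by simp
      also have "\<dots> = fhat x (grid k) i" unfolding fhat_def by (rule sum.inter_filter[symmetric]) simp
      finally show ?thesis .
    qed
    have bd: "(\<Sum>i\<in>{1..p}. (norm (v t k i))\<^sup>2) \<le> real s" if t: "t \<in> A" for t k
    proof -
      have "(norm (v t k i))\<^sup>2 = (if blk (fst t) = i then real s else 0)" for i
        by (simp add: v_def norm_mult sg_def)
      then have "(\<Sum>i\<in>{1..p}. (norm (v t k i))\<^sup>2) = (\<Sum>i\<in>{1..p}. if blk (fst t) = i then real s else 0)"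
        by simp
      also have "\<dots> \<le> real s" by (subst sum.delta') auto
      finally show ?thesis .
    qed
    show ?thesis
      using maurey_empirical[where v=v and c=c and K="{..<8 * n\<^sup>2}" and D="{1..p}" and B="real s", OF A(1) _ _ c0 c1 bd _ q(1) _ L] s q(2)
      unfolding mean by simp
  qed
  then have "\<forall>x\<in>T. \<exists>g. (\<forall>l. g l \<in> A) \<and> (\<forall>k\<in>{..<8 * n\<^sup>2}.
    (\<Sum>i\<in>{1..p}. (cmod (fhat x (grid k) i - (1 / L) *\<^sub>R (\<Sum>l<L. v (g l) k i)))\<^sup>2) \<le> 40 * q * s / L)"
    by blast
  from bchoice[OF this] obtain g where gA: "\<And>x l. x \<in> T \<Longrightarrow> g x l \<in> A"
    and g: "\<And>x k. x \<in> T \<Longrightarrow> k < 8 * n\<^sup>2 \<Longrightarrow>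
      (\<Sum>i\<in>{1..p}. (cmod (fhat x (grid k) i - (1 / L) *\<^sub>R (\<Sum>l<L. v (g x l) k i)))\<^sup>2) \<le> 40 * q * s / L"
    by (auto simp del: of_nat_mult)
  define code where "code x = restrict (g x) {..<L}" for x
  define \<rho> where "\<rho> u = (SOME y. y \<in> T \<and> code y = u)" for u
  define \<pi> where "\<pi> x = \<rho> (code x)" for x
  have \<pi>: "\<pi> x \<in> T \<and> code (\<pi> x) = code x" if "x \<in> T" for x
    unfolding \<pi>_def \<rho>_def using someI[of "\<lambda>y. y \<in> T \<and> code y = code x" x] that by blast
  have "card (\<pi> ` T) \<le> (2 * (n * p)) ^ L"
  proof -
    have "\<pi> ` T = \<rho> ` (code ` T)" by (auto simp: \<pi>_def)
    then have "card (\<pi> ` T) \<le> card (code ` T)" using T by (simp add: card_image_le)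
    also have "\<dots> \<le> card ({..<L} \<rightarrow>\<^sub>E A)"
      using gA A by (intro card_mono finite_PiE image_subsetI) (simp_all add: code_def restrict_PiE_iff)
    also have "\<dots> = (2 * (n * p)) ^ L" using A by (simp add: card_PiE)
    finally show ?thesis .
  qed
  moreover have "spec (\<lambda>c. x c - \<pi> x c) (grid k) \<le> 160 * q * s / L" if x: "x \<in> T" and k: "k < 8 * n\<^sup>2" for x k
  proof -
    define \<mu> where "\<mu> i = (1 / L) *\<^sub>R (\<Sum>l<L. v (g x l) k i)" for i
    have "g x l = g (\<pi> x) l" if "l < L" for l
      using \<pi>[OF x] that unfolding code_def by (metis lessThan_iff restrict_apply')
    then have \<mu>: "\<mu> i = (1 / L) *\<^sub>R (\<Sum>l<L. v (g (\<pi> x) l) k i)" for i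
      unfolding \<mu>_def by (intro arg_cong[where f="\<lambda>z. (1 / L) *\<^sub>R z"] sum.cong) auto
    \<comment> \<open>Both points lie within \<open>40 * q * s / L\<close> of their common empirical
      mean, and the squared triangle inequality doubles each term:
      \<open>160 = 2 * 40 + 2 * 40\<close>.\<close>
    have "(cmod (a - b))\<^sup>2 \<le> 2 * (cmod (a - m))\<^sup>2 + 2 * (cmod (b - m))\<^sup>2" for a b m
    proof -
      have "cmod (a - b) \<le> cmod (a - m) + cmod (b - m)"
        using norm_triangle_ineq4[of "a - m" "b - m"] by simp
      then have "(cmod (a - b))\<^sup>2 \<le> (cmod (a - m) + cmod (b - m))\<^sup>2" by (intro power_mono) auto
      then show ?thesis using sum_squares_bound[of "cmod (a - m)" "cmod (b - m)"] by (simp add: power2_sum)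
    qed
    then have "spec (\<lambda>c. x c - \<pi> x c) (grid k)
      \<le> (\<Sum>i\<in>{1..p}. 2 * (cmod (fhat x (grid k) i - \<mu> i))\<^sup>2 + 2 * (cmod (fhat (\<pi> x) (grid k) i - \<mu> i))\<^sup>2)"
      unfolding spec_def fhat_diff by (intro sum_mono)
    also have "\<dots> = 2 * (\<Sum>i\<in>{1..p}. (cmod (fhat x (grid k) i - \<mu> i))\<^sup>2) + 2 * (\<Sum>i\<in>{1..p}. (cmod (fhat (\<pi> x) (grid k) i - \<mu> i))\<^sup>2)"
      by (simp add: sum.distrib sum_distrib_left)
    also have "\<dots> \<le> 2 * (40 * q * s / L) + 2 * (40 * q * s / L)"
      using g[OF x k] g[OF _ k, of "\<pi> x"] \<pi>[OF x] unfolding \<mu>_def[symmetric] \<mu>[symmetric]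
      by (intro add_mono mult_left_mono) auto
    finally show ?thesis by simp
  qed
  ultimately show ?thesis using \<pi> by (intro exI[of _ \<pi>]) auto
qed

text \<open>Inner levels use \<open>2 ^ j\<close> samples. Level 0 is replaced by the zero vector,
  so that telescoping starts from nothing, and level \<open>J\<close> by the identity; the latter is
  affordable because \<open>s \<le> 2 ^ J\<close> puts the whole net within the cardinality allowed
  there.\<close>

lemma chain_exists:
  fixes s q J :: nat
  defines "T \<equiv> sparse_net (n * p) s"
  assumes s: "0 < s" "s \<le> n * p" "s \<le> 2 ^ J" and J: "0 < J" and q: "1 \<le> q" "8 * n\<^sup>2 \<le> 2 ^ q"
  shows "\<exists>\<pi>. (\<forall>x\<in>T. \<pi> 0 x = (\<lambda>_. 0) \<and> \<pi> J x = x) \<and> (\<forall>j. \<pi> j ` T \<subseteq> T) \<and>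
    (\<forall>j\<le>J. card (\<pi> j ` T) \<le> (9 * (n * p)\<^sup>2) ^ (2 ^ j)) \<and>
    (\<forall>j<J. \<forall>x\<in>T. \<forall>k<8 * n\<^sup>2. spec (\<lambda>c. \<pi> (Suc j) x c - \<pi> j x c) (grid k) \<le> 480 * q * s / 2 ^ j)"
proof -
  have T: "finite T" "card T \<le> (9 * (n * p)\<^sup>2) ^ s" unfolding T_def by (rule sparse_net_card[OF s(1,2)])+
  have l1: "(\<Sum>a\<in>cols. \<bar>x a\<bar>) \<le> sqrt s" if "x \<in> T" for x using that unfolding T_def by (rule sparse_net_l1)
  have "\<forall>j. \<exists>\<pi>. \<pi> ` T \<subseteq> T \<and> card (\<pi> ` T) \<le> (2 * (n * p)) ^ (2 ^ j) \<and>
    (\<forall>x\<in>T. \<forall>k<8 * n\<^sup>2. spec (\<lambda>c. x c - \<pi> x c) (grid k) \<le> 160 * q * s / real (2 ^ j))"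
  proof
    fix j show "\<exists>\<pi>. \<pi> ` T \<subseteq> T \<and> card (\<pi> ` T) \<le> (2 * (n * p)) ^ (2 ^ j) \<and>
      (\<forall>x\<in>T. \<forall>k<8 * n\<^sup>2. spec (\<lambda>c. x c - \<pi> x c) (grid k) \<le> 160 * q * s / real (2 ^ j))"
      by (rule chain_level[OF T(1) l1 s(1) q]) auto
  qed
  from choice[OF this] obtain \<rho> where \<rho>: "\<And>j. \<rho> j ` T \<subseteq> T" "\<And>j. card (\<rho> j ` T) \<le> (2 * (n * p)) ^ (2 ^ j)"
    "\<And>j x k. x \<in> T \<Longrightarrow> k < 8 * n\<^sup>2 \<Longrightarrow> spec (\<lambda>c. x c - \<rho> j x c) (grid k) \<le> 160 * q * s / real (2 ^ j)"
    by blast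
  define \<pi> where "\<pi> j = (if j = 0 then (\<lambda>x _. 0) else if J \<le> j then (\<lambda>x. x) else \<rho> j)" for j
  have np: "1 \<le> n * p" using n0 p0 by (simp add: Suc_le_eq)
  have card: "card (\<pi> j ` T) \<le> (9 * (n * p)\<^sup>2) ^ (2 ^ j)" if j: "j \<le> J" for j
  proof -
    consider "j = 0" | "j = J" "0 < j" | "0 < j" "j < J" using j by linarith
    then show ?thesis
    proof cases
      case 1
      have "card (\<pi> 0 ` T) \<le> card {\<lambda>_::nat. 0::real}" unfolding \<pi>_def by (intro card_mono) auto
      also have "\<dots> \<le> (9 * (n * p)\<^sup>2) ^ (2 ^ j)" using np by (simp add: Suc_le_eq)
      finally show ?thesis using 1 by simp
    next
      case 2
      then have "card (\<pi> j ` T) \<le> (9 * (n * p)\<^sup>2) ^ s" using T by (simp add: \<pi>_def)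
      also have "\<dots> \<le> (9 * (n * p)\<^sup>2) ^ (2 ^ j)" using s 2 np by (intro power_increasing) (auto simp: Suc_le_eq)
      finally show ?thesis .
    next
      case 3
      then have "card (\<pi> j ` T) \<le> (2 * (n * p)) ^ (2 ^ j)" using \<rho>(2)[of j] by (simp add: \<pi>_def)
      also have "2 * (n * p) \<le> 9 * (n * p)\<^sup>2"
        using mult_mono[of 2 9 "n * p" "(n * p)\<^sup>2"] self_le_power[OF np, of 2] by simp
      then have "(2 * (n * p)) ^ (2 ^ j) \<le> (9 * (n * p)\<^sup>2) ^ (2 ^ j)" by (intro power_mono) auto
      finally show ?thesis .
    qed
  qed
  have dev: "spec (\<lambda>c. x c - \<pi> j x c) (grid k) \<le> 160 * q * s / 2 ^ j" if x: "x \<in> T" and k: "k < 8 * n\<^sup>2" for j x k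
  proof -
    consider "j = 0" | "J \<le> j" "0 < j" | "0 < j" "j < J" by linarith
    then show ?thesis
    proof cases
      case 1
      have "spec x (grid k) \<le> (\<Sum>a\<in>cols. \<bar>x a\<bar>)\<^sup>2" by (rule spec_le_l1)
      also have "\<dots> \<le> (sqrt s)\<^sup>2" using l1[OF x] by (intro power_mono) (auto intro: sum_nonneg)
      also have "\<dots> \<le> 160 * q * s" using q mult_right_mono[of 1 "160 * real q" "real s"] by simp
      finally show ?thesis using 1 by (simp add: \<pi>_def)
    next
      case 2
      then show ?thesis by (simp add: \<pi>_def spec_def fhat_def)
    next
      case 3
      then show ?thesis using \<rho>(3)[OF x k, of j] by (simp add: \<pi>_def)
    qed
  qed
  have inc: "spec (\<lambda>c. \<pi> (Suc j) x c - \<pi> j x c) (grid k) \<le> 480 * q * s / 2 ^ j"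
    if x: "x \<in> T" and k: "k < 8 * n\<^sup>2" for j x k
  proof -
    have "spec (\<lambda>c. \<pi> (Suc j) x c - \<pi> j x c) (grid k) = spec (\<lambda>c. (x c - \<pi> j x c) - (x c - \<pi> (Suc j) x c)) (grid k)"
      by (rule arg_cong[of _ _ "\<lambda>z. spec z (grid k)"]) auto
    also have "\<dots> \<le> 2 * spec (\<lambda>c. x c - \<pi> j x c) (grid k) + 2 * spec (\<lambda>c. x c - \<pi> (Suc j) x c) (grid k)"
      by (rule spec_diff_le)
    \<comment> \<open>The finer level has twice as many samples, so the sum is
      \<open>2 * 160 + 2 * 80 = 480\<close>.\<close>
    also have "\<dots> \<le> 2 * (160 * q * s / 2 ^ j) + 2 * (160 * q * s / 2 ^ Suc j)"
      by (intro add_mono mult_left_mono dev[OF x k]) auto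
    also have "\<dots> = 480 * q * s / 2 ^ j" by (simp add: field_simps)
    finally show ?thesis .
  qed
  have "\<pi> j ` T \<subseteq> T" for j
    using \<rho>(1)[of j] zero_in_sparse_net[of "n * p" s] by (auto simp: \<pi>_def T_def)
  then show ?thesis using card inc J by (intro exI[of _ \<pi>]) (auto simp: \<pi>_def)
qed

end

section \<open>The decoupled chaos\<close>

context probe_channel
begin

declare One_nat_def [simp del] \<comment> \<open>keeps the intervals \<open>{1..k}\<close> in the form used by the abbreviations\<close>

sublocale G: gauss_product taps "1 / sqrt (real m)"
  by standard (use m0 in auto)

lemma probe_space_eq: "probe_space p m = G.P"
  by (simp add: probe_space_def)

abbreviation "PP \<equiv> G.P \<Otimes>\<^sub>M G.P"

definition "Z x \<phi> = (\<Sum>r\<in>outs. (Y x \<phi> r)\<^sup>2)" for x :: "nat \<Rightarrow> real" and \<phi> :: "nat \<times> nat \<Rightarrow> real"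
definition "ip x y \<phi> \<psi> = (\<Sum>r\<in>outs. Y x \<phi> r * Y y \<psi> r)" for x y :: "nat \<Rightarrow> real" and \<phi> \<psi> :: "nat \<times> nat \<Rightarrow> real"

lemma Z_nonneg: "0 \<le> Z x \<phi>"
  by (simp add: Z_def sum_nonneg)

lemma Y_measurable [measurable]: "(\<lambda>\<phi>. Y x \<phi> r) \<in> borel_measurable G.P"
  unfolding Y_def by (intro borel_measurable_sum borel_measurable_times G.component_measurable slot_range) auto

lemma Z_measurable [measurable]: "Z x \<in> borel_measurable G.P"
  unfolding Z_def[abs_def] by measurable

lemma ip_measurable [measurable]: "(\<lambda>u. ip x y (fst u) (snd u)) \<in> borel_measurable PP"
  unfolding ip_def by measurable

lemma lin_coef: "G.lin (coef z w) \<phi> = (\<Sum>r\<in>outs. Y z \<phi> r * w r)"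
  by (simp only: G.lin_def sum_Y_mult)

text \<open>For a fixed second copy \<open>\<psi>\<close> the form is linear in the first one, with
  variance at most \<open>4 * g / m * Z x \<psi>\<close>. The threshold depends only on
  \<open>\<psi>\<close>, so the Gaussian tail holds on every slice and Fubini integrates it.\<close>

lemma ip_tail_right:
  assumes G: "\<And>k. k < 8 * n\<^sup>2 \<Longrightarrow> spec z (grid k) \<le> g" "0 \<le> g" and \<tau>: "0 \<le> \<tau>"
  shows "emeasure PP {u\<in>space PP. \<bar>ip z x (fst u) (snd u)\<bar> > \<tau> * (sqrt (4 * g / m) * sqrt (Z x (snd u)))}
    \<le> ennreal (2 * exp (- \<tau>\<^sup>2 / 2))" (is "emeasure PP ?A \<le> ?e")
proof -
  have A: "?A \<in> sets PP" by measurable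
  have "emeasure PP ?A = (\<integral>\<^sup>+\<psi>. emeasure G.P ((\<lambda>\<phi>. (\<phi>, \<psi>)) -` ?A) \<partial>G.P)"
    by (rule G.PP.emeasure_pair_measure_alt2[OF A])
  also have "\<dots> \<le> (\<integral>\<^sup>+\<psi>. ?e \<partial>G.P)"
  proof (rule nn_integral_mono)
    fix \<psi> assume \<psi>: "\<psi> \<in> space G.P"
    let ?c = "sqrt (4 * g / m) * sqrt (Z x \<psi>)"
    have "(1 / sqrt (real m))\<^sup>2 * (\<Sum>t\<in>taps. (coef z (Y x \<psi>) t)\<^sup>2) \<le> (1 / sqrt (real m))\<^sup>2 * (4 * g * Z x \<psi>)"
      unfolding Z_def by (intro mult_left_mono coef_energy_grid G(1)) auto
    also have "\<dots> = ?c\<^sup>2" using G(2) Z_nonneg by (simp add: power_mult_distrib power_divide)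
    finally have "emeasure G.P {\<phi>\<in>space G.P. \<bar>G.lin (coef z (Y x \<psi>)) \<phi>\<bar> > \<tau> * ?c} \<le> ?e"
      by (rule G.lin_tail) (use G(2) Z_nonneg \<tau> in auto)
    also have "{\<phi>\<in>space G.P. \<bar>G.lin (coef z (Y x \<psi>)) \<phi>\<bar> > \<tau> * ?c} = (\<lambda>\<phi>. (\<phi>, \<psi>)) -` ?A"
      using \<psi> by (auto simp: lin_coef ip_def space_pair_measure)
    finally show "emeasure G.P ((\<lambda>\<phi>. (\<phi>, \<psi>)) -` ?A) \<le> ?e" .
  qed
  also have "\<dots> = ?e" by (simp add: G.PS.P.emeasure_space_1)
  finally show ?thesis .
qed

lemma ip_commute: "ip x y \<phi> \<psi> = ip y x \<psi> \<phi>"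
  by (simp add: ip_def mult.commute)

lemma ip_tail_left:
  assumes G: "\<And>k. k < 8 * n\<^sup>2 \<Longrightarrow> spec z (grid k) \<le> g" "0 \<le> g" and \<tau>: "0 \<le> \<tau>"
  shows "emeasure PP {u\<in>space PP. \<bar>ip x z (fst u) (snd u)\<bar> > \<tau> * (sqrt (4 * g / m) * sqrt (Z x (fst u)))}
    \<le> ennreal (2 * exp (- \<tau>\<^sup>2 / 2))" (is "emeasure PP ?A \<le> ?e")
proof -
  let ?A' = "{u\<in>space PP. \<bar>ip z x (fst u) (snd u)\<bar> > \<tau> * (sqrt (4 * g / m) * sqrt (Z x (snd u)))}"
  have A: "?A \<in> sets PP" by measurable
  have A': "?A' \<in> sets PP" by measurable
  have "emeasure PP ?A = (\<integral>\<^sup>+\<phi>. emeasure G.P (Pair \<phi> -` ?A) \<partial>G.P)"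
    by (rule G.PS.P.emeasure_pair_measure_alt[OF A])
  also have "\<dots> = (\<integral>\<^sup>+\<phi>. emeasure G.P ((\<lambda>\<psi>. (\<psi>, \<phi>)) -` ?A') \<partial>G.P)"
    by (intro nn_integral_cong arg_cong[where f="emeasure G.P"]) (auto simp: space_pair_measure ip_commute)
  also have "\<dots> = emeasure PP ?A'"
    by (rule G.PP.emeasure_pair_measure_alt2[OF A', symmetric])
  also have "\<dots> \<le> ?e" by (rule ip_tail_right[OF G \<tau>])
  finally show ?thesis .
qed

text \<open>As \<open>n \<le> m\<close>, no row meets the same probe entry twice. Each output of
  \<open>x\<close> is thus a combination of independent variables, which gives \<open>Z x\<close>
  the squared norm of \<open>x\<close> as its mean.\<close>

lemma slot_inj: "inj_on (slot r) cols" if "r \<in> outs" for r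
proof (rule inj_onI)
  fix c d assume cd: "c \<in> cols" "d \<in> cols" and eq: "slot r c = slot r d"
  have pc: "1 \<le> pos c" "pos c \<le> n" "1 \<le> pos d" "pos d \<le> n" using pos_range[of c] pos_range[of d] by auto
  have "(n + r - pos c - 1) mod m = (n + r - pos d - 1) mod m" using eq by (simp add: slot_def)
  then have "int (n + r - pos c - 1) mod int m = int (n + r - pos d - 1) mod int m" by (metis of_nat_mod)
  then have "int m dvd int (n + r - pos c - 1) - int (n + r - pos d - 1)" by (simp add: mod_eq_dvd_iff)
  then have "int m dvd int (pos d) - int (pos c)" using pc that by (simp add: of_nat_diff)
  moreover have "\<bar>int (pos d) - int (pos c)\<bar> < int m" using pc nm by auto
  ultimately have "pos c = pos d" by (metis dvd_imp_le_int abs_of_nat eq_iff_diff_eq_0 not_le of_nat_eq_iff)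
  then show "c = d" using eq cd inj_on_pos[of "blk c"] by (auto simp: slot_def inj_on_def)
qed

lemma Z_expectation: "(\<integral>\<^sup>+\<phi>. ennreal (Z x \<phi>) \<partial>G.P) = ennreal (\<Sum>a\<in>cols. (x a)\<^sup>2)"
proof -
  let ?b = "\<lambda>r t. \<Sum>c\<in>cols. if slot r c = t then x c else 0"
  have Yb: "Y x \<phi> r = G.lin (?b r) \<phi>" for \<phi> r
  proof -
    have "G.lin (?b r) \<phi> = (\<Sum>t\<in>taps. \<Sum>c\<in>cols. if slot r c = t then x c * \<phi> t else 0)"
      unfolding G.lin_def sum_distrib_right by (intro sum.cong refl) auto
    also have "\<dots> = (\<Sum>c\<in>cols. \<Sum>t\<in>taps. if slot r c = t then x c * \<phi> t else 0)" by (rule sum.swap)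
    also have "\<dots> = (\<Sum>c\<in>cols. x c * \<phi> (slot r c))"
      by (intro sum.cong refl, subst sum.delta') (use slot_range in auto)
    finally show ?thesis by (simp add: Y_def mult.commute)
  qed
  have b2: "(\<Sum>t\<in>taps. (?b r t)\<^sup>2) = (\<Sum>a\<in>cols. (x a)\<^sup>2)" if r: "r \<in> outs" for r
  proof -
    have b0: "?b r t = 0" if "t \<notin> slot r ` cols" for t using that by (intro sum.neutral) auto
    have bs: "?b r (slot r c) = x c" if c: "c \<in> cols" for c
    proof -
      have "?b r (slot r c) = (\<Sum>d\<in>cols. if d = c then x d else 0)"
        using c by (intro sum.cong refl) (simp only: inj_on_eq_iff[OF slot_inj[OF r]])
      then show ?thesis using c by simp
    qed
    have "(\<Sum>t\<in>taps. (?b r t)\<^sup>2) = (\<Sum>t\<in>slot r ` cols. (?b r t)\<^sup>2)"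
      by (rule sum.mono_neutral_right[OF _ image_subsetI[OF slot_range]]) (simp, assumption, intro ballI, subst b0, auto)
    also have "\<dots> = (\<Sum>c\<in>cols. (?b r (slot r c))\<^sup>2)"
      using slot_inj[OF r] by (simp add: sum.reindex)
    also have "\<dots> = (\<Sum>a\<in>cols. (x a)\<^sup>2)" by (intro sum.cong refl) (simp only: bs)
    finally show ?thesis .
  qed
  have "(\<integral>\<^sup>+\<phi>. ennreal (Z x \<phi>) \<partial>G.P) = (\<integral>\<^sup>+\<phi>. (\<Sum>r\<in>outs. ennreal ((Y x \<phi> r)\<^sup>2)) \<partial>G.P)"
    by (simp add: Z_def)
  also have "\<dots> = (\<Sum>r\<in>outs. \<integral>\<^sup>+\<phi>. ennreal ((Y x \<phi> r)\<^sup>2) \<partial>G.P)"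
    by (rule nn_integral_sum) measurable
  also have "\<dots> = (\<Sum>r\<in>outs. ennreal ((1 / sqrt (real m))\<^sup>2 * (\<Sum>a\<in>cols. (x a)\<^sup>2)))"
    by (intro sum.cong refl) (simp only: Yb G.lin_second_moment b2)
  also have "\<dots> = ennreal (\<Sum>a\<in>cols. (x a)\<^sup>2)"
    using m0 by (simp add: power_divide ennreal_of_nat_eq_real_of_nat sum_nonneg flip: ennreal_mult)
  finally show ?thesis .
qed

lemma ip_second_moment:
  assumes G: "\<And>k. k < 8 * n\<^sup>2 \<Longrightarrow> spec x (grid k) \<le> g" "0 \<le> g"
  shows "(\<integral>\<^sup>+u. ennreal ((ip x x (fst u) (snd u))\<^sup>2) \<partial>PP) \<le> ennreal (4 * g / m * (\<Sum>a\<in>cols. (x a)\<^sup>2))"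
proof -
  have "(\<integral>\<^sup>+u. ennreal ((ip x x (fst u) (snd u))\<^sup>2) \<partial>PP) = (\<integral>\<^sup>+\<psi>. \<integral>\<^sup>+\<phi>. ennreal ((ip x x \<phi> \<psi>)\<^sup>2) \<partial>G.P \<partial>G.P)"
    by (subst G.PP.nn_integral_snd[symmetric]) auto
  also have "\<dots> \<le> (\<integral>\<^sup>+\<psi>. ennreal (4 * g / m) * ennreal (Z x \<psi>) \<partial>G.P)"
  proof (rule nn_integral_mono)
    fix \<psi>
    have "(\<integral>\<^sup>+\<phi>. ennreal ((ip x x \<phi> \<psi>)\<^sup>2) \<partial>G.P) = ennreal ((1 / sqrt (real m))\<^sup>2 * (\<Sum>t\<in>taps. (coef x (Y x \<psi>) t)\<^sup>2))"
      unfolding ip_def lin_coef[symmetric] by (rule G.lin_second_moment)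
    also have "\<dots> \<le> ennreal ((1 / sqrt (real m))\<^sup>2 * (4 * g * Z x \<psi>))"
      unfolding Z_def by (intro ennreal_leI mult_left_mono coef_energy_grid G(1)) auto
    also have "(1 / sqrt (real m))\<^sup>2 * (4 * g * Z x \<psi>) = 4 * g / m * Z x \<psi>" by (simp add: power_divide)
    finally show "(\<integral>\<^sup>+\<phi>. ennreal ((ip x x \<phi> \<psi>)\<^sup>2) \<partial>G.P) \<le> ennreal (4 * g / m) * ennreal (Z x \<psi>)"
      by (simp only: ennreal_mult''[OF Z_nonneg])
  qed
  also have "\<dots> = ennreal (4 * g / m) * ennreal (\<Sum>a\<in>cols. (x a)\<^sup>2)"
    by (simp add: nn_integral_cmult Z_expectation)
  also have "\<dots> = ennreal (4 * g / m * (\<Sum>a\<in>cols. (x a)\<^sup>2))"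
    by (rule ennreal_mult''[symmetric]) (simp add: sum_nonneg)
  finally show ?thesis .
qed

lemma Y_plus: "Y x (G.plus h h') r = (Y x h r + Y x h' r) / sqrt 2"
proof -
  have "Y x (G.plus h h') r = (\<Sum>c\<in>cols. (h (slot r c) + h' (slot r c)) / sqrt 2 * x c)"
    unfolding Y_def using slot_range by (intro sum.cong refl) (simp add: G.plus_def)
  then show ?thesis by (simp add: Y_def distrib_right sum.distrib flip: sum_divide_distrib)
qed

lemma Y_minus: "Y x (G.minus h h') r = (Y x h r - Y x h' r) / sqrt 2"
proof -
  have "Y x (G.minus h h') r = (\<Sum>c\<in>cols. (h (slot r c) - h' (slot r c)) / sqrt 2 * x c)"
    unfolding Y_def using slot_range by (intro sum.cong refl) (simp add: G.minus_def)
  then show ?thesis by (simp add: Y_def left_diff_distrib sum_subtractf flip: sum_divide_distrib)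
qed

text \<open>The factorization of a difference of squares in every output: this is where the
  comparison of two copies becomes a decoupled form, as an exact identity.\<close>

lemma ip_rotated: "2 * ip x x (G.plus h h') (G.minus h h') = Z x h - Z x h'"
proof -
  have e: "2 * ((a + b) / sqrt 2 * ((a - b) / sqrt 2)) = a\<^sup>2 - b\<^sup>2" for a b :: real
    by (simp add: power2_eq_square field_simps)
  show ?thesis
    unfolding ip_def Z_def Y_plus Y_minus sum_distrib_left sum_subtractf[symmetric] e ..
qed

lemma norm_Y_rotated:
  "sqrt (Z x (G.plus h h')) \<le> (sqrt (Z x h) + sqrt (Z x h')) / sqrt 2"
  "sqrt (Z x (G.minus h h')) \<le> (sqrt (Z x h) + sqrt (Z x h')) / sqrt 2"
proof -
  have L: "sqrt (Z x h) = L2_set (Y x h) outs" for h by (simp add: Z_def L2_set_def)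
  have S: "sqrt (\<Sum>r\<in>outs. (u r / sqrt 2)\<^sup>2) = L2_set u outs / sqrt 2" for u :: "nat \<Rightarrow> real"
    by (simp add: power_divide L2_set_def real_sqrt_divide flip: sum_divide_distrib)
  have "sqrt (Z x (G.plus h h')) = L2_set (\<lambda>r. Y x h r + Y x h' r) outs / sqrt 2"
    unfolding Z_def Y_plus by (rule S)
  also have "\<dots> \<le> (L2_set (Y x h) outs + L2_set (Y x h') outs) / sqrt 2"
    by (intro divide_right_mono L2_set_triangle_ineq) auto
  finally show "sqrt (Z x (G.plus h h')) \<le> (sqrt (Z x h) + sqrt (Z x h')) / sqrt 2" by (simp add: L)
  have "sqrt (Z x (G.minus h h')) = L2_set (\<lambda>r. Y x h r + - Y x h' r) outs / sqrt 2"
    using S[of "\<lambda>r. Y x h r - Y x h' r"] unfolding Z_def Y_minus by simp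
  also have "\<dots> \<le> (L2_set (Y x h) outs + L2_set (\<lambda>r. - Y x h' r) outs) / sqrt 2"
    by (intro divide_right_mono L2_set_triangle_ineq) auto
  finally show "sqrt (Z x (G.minus h h')) \<le> (sqrt (Z x h) + sqrt (Z x h')) / sqrt 2" by (simp add: L L2_set_def)
qed

text \<open>The variance of \<open>Z x\<close> comes from the rotation as well: it avoids fourth moments of Gaussians.\<close>

lemma Z_concentration:
  fixes s :: nat
  assumes x: "(\<Sum>a\<in>cols. (x a)\<^sup>2) \<le> 1" "(\<Sum>a\<in>cols. \<bar>x a\<bar>) \<le> sqrt s" and s: "0 < s"
    and t: "0 < t" "128 * s / m \<le> t\<^sup>2"
  shows "emeasure G.P {\<phi>\<in>space G.P. \<bar>Z x \<phi> - (\<Sum>a\<in>cols. (x a)\<^sup>2)\<bar> > 2 * t} \<le> ennreal (1 / 4)"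
proof -
  define \<mu> where "\<mu> = (\<Sum>a\<in>cols. (x a)\<^sup>2)"
  \<comment> \<open>The mean squared difference of two copies is at most \<open>V\<close>: a factor
    4 comes from squaring \<open>2 * ip\<close>, and \<open>4 * s / m\<close> from
    \<open>ip_second_moment\<close> with \<open>spec x \<le> s\<close>.\<close>
  define V where "V = 16 * s / real m"
  have \<mu>0: "0 \<le> \<mu>" by (simp add: \<mu>_def sum_nonneg)
  have V0: "0 < V" using s m0 by (simp add: V_def)
  have spec: "spec x \<theta> \<le> s" for \<theta>
  proof -
    have "(\<Sum>a\<in>cols. \<bar>x a\<bar>)\<^sup>2 \<le> (sqrt s)\<^sup>2" using x(2) by (intro power_mono) (auto intro: sum_nonneg)
    then show ?thesis using spec_le_l1[of x \<theta>] by simp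
  qed
  have "(\<integral>\<^sup>+u. ennreal ((Z x (fst u) - Z x (snd u))\<^sup>2) \<partial>PP)
    = (\<integral>\<^sup>+u. ennreal ((2 * ip x x (G.plus (fst u) (snd u)) (G.minus (fst u) (snd u)))\<^sup>2) \<partial>PP)"
    by (simp only: ip_rotated)
  also have "\<dots> = (\<integral>\<^sup>+u. ennreal ((2 * ip x x (fst u) (snd u))\<^sup>2) \<partial>PP)"
    using G.nn_integral_rotation[of "\<lambda>u. ennreal ((2 * ip x x (fst u) (snd u))\<^sup>2)"] by simp
  also have "\<dots> = 4 * (\<integral>\<^sup>+u. ennreal ((ip x x (fst u) (snd u))\<^sup>2) \<partial>PP)"
    by (simp add: power_mult_distrib ennreal_mult' nn_integral_cmult)
  also have "\<dots> \<le> 4 * ennreal (4 * real s / m * \<mu>)"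
    unfolding \<mu>_def using ip_second_moment[of x "real s", OF spec] by (intro mult_left_mono) auto
  also have "\<dots> \<le> 4 * ennreal (4 * real s / m * 1)"
    using x(1) by (intro mult_left_mono ennreal_leI) (auto simp: \<mu>_def)
  also have "\<dots> = ennreal V"
    by (subst ennreal_numeral[symmetric], subst ennreal_mult'[symmetric]) (simp_all add: V_def)
  finally have "(\<integral>\<^sup>+h'. \<integral>\<^sup>+h. ennreal ((Z x h - Z x h')\<^sup>2) \<partial>G.P \<partial>G.P) \<le> ennreal V"
    using G.PP.nn_integral_snd[of "\<lambda>u. ennreal ((Z x (fst u) - Z x (snd u))\<^sup>2)"] by simp
  \<comment> \<open>Freezing the second copy at a value not much worse than average gives a constant
    \<open>c = Z x h'\<close> about which \<open>Z x\<close> has second moment at most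
    \<open>2 * V\<close>. Nonnegativity of the variance then places the mean within \<open>t\<close>
    of \<open>c\<close>.\<close>
  then have "\<exists>h'\<in>space G.P. (\<integral>\<^sup>+h. ennreal ((Z x h - Z x h')\<^sup>2) \<partial>G.P) \<le> ennreal (2 * V)"
  proof (rule contrapos_pp)
    assume "\<not> (\<exists>h'\<in>space G.P. (\<integral>\<^sup>+h. ennreal ((Z x h - Z x h')\<^sup>2) \<partial>G.P) \<le> ennreal (2 * V))"
    then have "(\<integral>\<^sup>+h'. ennreal (2 * V) \<partial>G.P) \<le> (\<integral>\<^sup>+h'. \<integral>\<^sup>+h. ennreal ((Z x h - Z x h')\<^sup>2) \<partial>G.P \<partial>G.P)"
      by (intro nn_integral_mono) (auto simp: not_le less_imp_le)
    moreover have "ennreal V < ennreal (2 * V)" using V0 by (simp add: ennreal_less_iff)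
    ultimately show "\<not> (\<integral>\<^sup>+h'. \<integral>\<^sup>+h. ennreal ((Z x h - Z x h')\<^sup>2) \<partial>G.P \<partial>G.P) \<le> ennreal V"
      by (simp add: G.PS.P.emeasure_space_1)
  qed
  then obtain c where c: "(\<integral>\<^sup>+h. ennreal ((Z x h - c)\<^sup>2) \<partial>G.P) \<le> ennreal (2 * V)" by blast
  have intZ: "integrable G.P (Z x)"
    using Z_expectation[of x] Z_nonneg by (intro integrableI_nonneg) auto
  have int2: "integrable G.P (\<lambda>h. (Z x h - c)\<^sup>2)"
    using c by (intro integrableI_nonneg) (auto intro: le_less_trans)
  have EZ: "G.PS.P.expectation (Z x) = \<mu>"
    using Z_expectation[of x] Z_nonneg \<mu>0 by (subst integral_eq_nn_integral) (auto simp: \<mu>_def)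
  have E2: "G.PS.P.expectation (\<lambda>h. (Z x h - c)\<^sup>2) \<le> 2 * V"
    using c V0 by (subst integral_eq_nn_integral) (auto intro: enn2real_leI)
  have "0 \<le> G.PS.P.variance (\<lambda>h. Z x h - c)" by (rule G.PS.P.variance_positive)
  also have "\<dots> = G.PS.P.expectation (\<lambda>h. (Z x h - c)\<^sup>2) - (G.PS.P.expectation (\<lambda>h. Z x h - c))\<^sup>2"
    using intZ int2 by (intro G.PS.P.variance_eq) auto
  also have "G.PS.P.expectation (\<lambda>h. Z x h - c) = \<mu> - c" using intZ EZ by (simp add: G.PS.P.prob_space)
  finally have "(\<mu> - c)\<^sup>2 \<le> 2 * V" using E2 by linarith
  also have "\<dots> \<le> t\<^sup>2" using t(2) V0 by (simp add: V_def)
  finally have \<mu>c: "\<bar>\<mu> - c\<bar> \<le> t" using t(1) by (simp add: abs_le_square_iff[symmetric] power2_le_iff_abs_le)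
  have "emeasure G.P {\<phi>\<in>space G.P. \<bar>Z x \<phi> - \<mu>\<bar> > 2 * t}
    \<le> emeasure G.P {\<phi>\<in>space G.P. 1 \<le> ennreal (1 / t\<^sup>2) * ennreal ((Z x \<phi> - c)\<^sup>2)}"
  proof (rule emeasure_mono)
    show "{\<phi>\<in>space G.P. \<bar>Z x \<phi> - \<mu>\<bar> > 2 * t} \<subseteq> {\<phi>\<in>space G.P. 1 \<le> ennreal (1 / t\<^sup>2) * ennreal ((Z x \<phi> - c)\<^sup>2)}"
    proof safe
      fix \<phi> assume "\<bar>Z x \<phi> - \<mu>\<bar> > 2 * t"
      then have "t \<le> \<bar>Z x \<phi> - c\<bar>" using \<mu>c by linarith
      then have "t\<^sup>2 \<le> (Z x \<phi> - c)\<^sup>2" using t(1) by (metis abs_le_square_iff abs_of_pos)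
      then have "1 \<le> 1 / t\<^sup>2 * (Z x \<phi> - c)\<^sup>2" using t(1) by (simp add: field_simps)
      then show "1 \<le> ennreal (1 / t\<^sup>2) * ennreal ((Z x \<phi> - c)\<^sup>2)"
        by (simp flip: ennreal_mult' ennreal_1)
    qed
  qed measurable
  also have "\<dots> \<le> ennreal (1 / t\<^sup>2) * (\<integral>\<^sup>+\<phi>. ennreal ((Z x \<phi> - c)\<^sup>2) * indicator (space G.P) \<phi> \<partial>G.P)"
    by (rule nn_integral_Markov_inequality) auto
  also have "(\<integral>\<^sup>+\<phi>. ennreal ((Z x \<phi> - c)\<^sup>2) * indicator (space G.P) \<phi> \<partial>G.P) = (\<integral>\<^sup>+\<phi>. ennreal ((Z x \<phi> - c)\<^sup>2) \<partial>G.P)"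
    by (intro nn_integral_cong) simp
  also have "ennreal (1 / t\<^sup>2) * \<dots> \<le> ennreal (1 / t\<^sup>2) * ennreal (2 * V)"
    by (rule mult_left_mono[OF c]) simp
  also have "\<dots> = ennreal (1 / t\<^sup>2 * (2 * V))"
    by (rule ennreal_mult''[symmetric]) (use V0 in simp)
  \<comment> \<open>Markov needs \<open>2 * V / t\<^sup>2 \<le> 1 / 4\<close>, that is
    \<open>8 * V \<le> t\<^sup>2\<close>; this is the origin of \<open>128 = 8 * 16\<close>.\<close>
  also have "\<dots> \<le> ennreal (1 / 4)"
  proof (rule ennreal_leI)
    have "8 * V \<le> t\<^sup>2" using t(2) by (simp add: V_def)
    then show "1 / t\<^sup>2 * (2 * V) \<le> 1 / 4" using t(1) by (simp add: field_simps)
  qed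
  finally show ?thesis unfolding \<mu>_def .
qed

end

text \<open>A deterministic statement about one pair of copies. \<open>Z'\<close> is controlled at
  \<open>y\<close> alone; elsewhere it is reached through the chaos inequality, which yields
  \<open>W' \<le> W + a\<close>, while the choice of \<open>y\<close> yields
  \<open>W\<^sup>2 \<le> 1 + \<kappa>\<close>. Hence
  \<open>\<kappa> \<le> a * (2 + a + \<kappa>) + \<delta> / 5\<close>, and \<open>a\<close> is small
  enough for \<open>\<kappa>\<close> to be absorbed.\<close>

lemma self_bounding:
  fixes Z Z' \<nu> :: "'a \<Rightarrow> real" and a \<delta> :: real
  assumes T: "finite T" "T \<noteq> {}"
    and Z: "\<And>x. 0 \<le> Z x" "\<And>x. 0 \<le> Z' x" and \<nu>: "\<And>x. x \<in> T \<Longrightarrow> \<nu> x \<le> 1"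
    and a: "0 \<le> a" "a \<le> \<delta> / 30" and \<delta>: "\<delta> \<le> 1"
    and chaos: "\<And>x. x \<in> T \<Longrightarrow> \<bar>Z x - Z' x\<bar> \<le> a * (Max ((\<lambda>x. sqrt (Z x)) ` T) + Max ((\<lambda>x. sqrt (Z' x)) ` T))"
    and y: "y \<in> T" "\<And>x. x \<in> T \<Longrightarrow> \<bar>Z x - \<nu> x\<bar> \<le> \<bar>Z y - \<nu> y\<bar>" "\<bar>Z' y - \<nu> y\<bar> \<le> \<delta> / 5"
  shows "\<bar>Z y - \<nu> y\<bar> \<le> \<delta> / 3"
proof -
  define W where "W = Max ((\<lambda>x. sqrt (Z x)) ` T)"
  define W' where "W' = Max ((\<lambda>x. sqrt (Z' x)) ` T)"
  define \<kappa> where "\<kappa> = \<bar>Z y - \<nu> y\<bar>"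
  have W'x: "sqrt (Z' x) \<le> W'" if "x \<in> T" for x unfolding W'_def using T that by (intro Max_ge) auto
  have Wx: "sqrt (Z x) \<le> W" if "x \<in> T" for x unfolding W_def using T that by (intro Max_ge) auto
  have "W \<in> (\<lambda>x. sqrt (Z x)) ` T" unfolding W_def using T by (intro Max_in) auto
  then obtain x1 where x1: "x1 \<in> T" "W = sqrt (Z x1)" by blast
  have "W' \<in> (\<lambda>x. sqrt (Z' x)) ` T" unfolding W'_def using T by (intro Max_in) auto
  then obtain x2 where x2: "x2 \<in> T" "W' = sqrt (Z' x2)" by blast
  have W0: "0 \<le> W" "0 \<le> W'" using x1 x2 Z by auto
  \<comment> \<open>At the maximizer of \<open>Z'\<close> the chaos inequality bounds
    \<open>W'\<^sup>2 - W\<^sup>2\<close> by \<open>a * (W + W')\<close>, and the factor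
    \<open>W + W'\<close> cancels.\<close>
  have W'W: "W' \<le> W + a"
  proof (rule ccontr)
    assume "\<not> W' \<le> W + a"
    then have gt: "a < W' - W" and pos: "0 < W + W'" using W0 a by linarith+
    have "W'\<^sup>2 = Z' x2" using x2 Z by simp
    also have "\<dots> \<le> Z x2 + a * (W + W')" using chaos[OF x2(1)] unfolding W_def W'_def by linarith
    also have "Z x2 = (sqrt (Z x2))\<^sup>2" using Z by simp
    also have "\<dots> \<le> W\<^sup>2" using Wx[OF x2(1)] Z by (intro power_mono) auto
    finally have "(W' - W) * (W + W') \<le> a * (W + W')" by (simp add: power2_eq_square algebra_simps)
    then show False using gt pos by (simp add: mult_le_cancel_right)
  qed
  have "W\<^sup>2 \<le> 1 + \<kappa>"
  proof -
    have "W\<^sup>2 = Z x1" using x1 Z by simp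
    also have "\<dots> \<le> \<nu> x1 + \<kappa>" using y(2)[OF x1(1)] unfolding \<kappa>_def by linarith
    finally show ?thesis using \<nu>[OF x1(1)] by linarith
  qed
  moreover have "2 * W \<le> 1 + W\<^sup>2" using sum_squares_bound[of W 1] by simp
  ultimately have W: "2 * W \<le> 2 + \<kappa>" by linarith
  have "\<kappa> \<le> a * (W + W') + \<delta> / 5"
    using chaos[OF y(1)] y(3) unfolding \<kappa>_def W_def W'_def by linarith
  moreover have "a * (W + W') \<le> a * (2 + a + \<kappa>)" using W W'W a by (intro mult_left_mono) auto
  moreover have "a * (2 + a + \<kappa>) = a * (2 + a) + a * \<kappa>" by (rule distrib_left)
  \<comment> \<open>Here \<open>61 / 900 = 1 / 30 * (61 / 30)\<close>. Together with
    \<open>\<kappa> / 30\<close> and \<open>\<delta> / 5\<close> this leaves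
    \<open>\<kappa> \<le> 241 / 870 * \<delta>\<close>, which is at most
    \<open>\<delta> / 3\<close>.\<close>
  moreover have "a * (2 + a) \<le> \<delta> * (61 / 900)"
    using a \<delta> mult_mono[of a "\<delta> / 30" "2 + a" "61 / 30"] by simp
  moreover have "a * \<kappa> \<le> 1 / 30 * \<kappa>" using a \<delta> by (intro mult_right_mono) (auto simp: \<kappa>_def)
  ultimately show ?thesis unfolding \<kappa>_def[symmetric] using a by linarith
qed

section \<open>Union bound over the chain and comparison of two copies\<close>

context probe_channel
begin

definition "W s \<phi> = Max ((\<lambda>x. sqrt (Z x \<phi>)) ` sparse_net (n * p) s)"

lemma Y_diff: "Y (\<lambda>c. x c - y c) \<phi> r = Y x \<phi> r - Y y \<phi> r"
  by (simp add: Y_def right_diff_distrib sum_subtractf)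

text \<open>Each error term pairs the increment in one copy with a single chain point in the other,
  as the two tail bounds require.\<close>

lemma ip_telescope: "ip x x \<phi> \<psi> = ip y y \<phi> \<psi> + ip (\<lambda>c. x c - y c) x \<phi> \<psi> + ip y (\<lambda>c. x c - y c) \<phi> \<psi>"
  by (simp add: ip_def Y_diff algebra_simps sum.distrib sum_subtractf)

lemma sqrt_Z_le_W: "0 < s \<Longrightarrow> s \<le> n * p \<Longrightarrow> x \<in> sparse_net (n * p) s \<Longrightarrow> sqrt (Z x \<phi>) \<le> W s \<phi>"
  unfolding W_def using sparse_net_card(1) by (intro Max_ge) auto

text \<open>The exceptional set is fixed before anything is known about the size of
  \<open>W\<close>: its thresholds contain the random norms of chain points, which are dominated by
  \<open>W\<close> only afterwards. Off this set every link adds at most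
  \<open>\<rho> * (W s (fst u) + W s (snd u))\<close>.\<close>

lemma chaos_event:
  fixes s q J :: nat and N9 \<rho> :: real
  defines "N9 \<equiv> real (9 * (n * p)\<^sup>2)"
  defines "\<rho> \<equiv> 124 * sqrt (q * s * ln N9 / m)"
  assumes s: "0 < s" "s \<le> n * p" "s \<le> 2 ^ J" and J: "0 < J" and q: "1 \<le> q" "8 * n\<^sup>2 \<le> 2 ^ q"
  shows "\<exists>B\<in>sets PP. emeasure PP B \<le> ennreal (J * (4 / N9)) \<and>
    (\<forall>u\<in>space PP - B. \<forall>x\<in>sparse_net (n * p) s. \<bar>ip x x (fst u) (snd u)\<bar> \<le> J * \<rho> * (W s (fst u) + W s (snd u)))"
proof -
  let ?T = "sparse_net (n * p) s"
  have finT: "finite ?T" by (rule sparse_net_card(1)[OF s(1,2)])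
  obtain \<pi> where \<pi>: "\<forall>x\<in>?T. \<pi> 0 x = (\<lambda>_. 0) \<and> \<pi> J x = x" "\<forall>j. \<pi> j ` ?T \<subseteq> ?T"
    "\<forall>j\<le>J. card (\<pi> j ` ?T) \<le> (9 * (n * p)\<^sup>2) ^ (2 ^ j)"
    "\<forall>j<J. \<forall>x\<in>?T. \<forall>k<8 * n\<^sup>2. spec (\<lambda>c. \<pi> (Suc j) x c - \<pi> j x c) (grid k) \<le> 480 * q * s / 2 ^ j"
    using chain_exists[OF s J q] by (elim exE conjE)
  have \<pi>0: "\<pi> 0 x = (\<lambda>_. 0)" and \<pi>J: "\<pi> J x = x" and \<pi>T: "\<pi> j x \<in> ?T" if "x \<in> ?T" for x j
    using \<pi>(1,2) that by blast+
  have \<pi>card: "card (\<pi> j ` ?T) \<le> (9 * (n * p)\<^sup>2) ^ (2 ^ j)" if "j \<le> J" for j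
    using \<pi>(3) that by blast
  have \<pi>spec: "spec (\<lambda>c. \<pi> (Suc j) x c - \<pi> j x c) (grid k) \<le> 480 * q * s / 2 ^ j"
    if "j < J" "x \<in> ?T" "k < 8 * n\<^sup>2" for j x k
    using \<pi>(4) that by blast
  \<comment> \<open>\<open>exp (- \<tau>\<^sup>2 / 2) = N9 ^ (- 4 * 2 ^ j)\<close> beats the at most \<open>N9 ^ (3 * 2 ^ j)\<close> pairs of level \<open>j\<close>,
    while \<open>\<tau> j\<close> times the deviation of an increment does not depend on \<open>j\<close>\<close>
  define \<tau> where "\<tau> j = sqrt (8 * 2 ^ j * ln N9)" for j :: nat
  define g where "g j = 480 * q * s / 2 ^ j" for j :: nat
  define pairs where "pairs j = (\<lambda>x. (\<pi> (Suc j) x, \<pi> j x)) ` ?T" for j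
  define E1 where "E1 j pr = {w\<in>space PP. \<bar>ip (\<lambda>c. fst pr c - snd pr c) (fst pr) (fst w) (snd w)\<bar>
      > \<tau> j * (sqrt (4 * g j / m) * sqrt (Z (fst pr) (snd w)))}" for j :: nat and pr
  define E2 where "E2 j pr = {w\<in>space PP. \<bar>ip (snd pr) (\<lambda>c. fst pr c - snd pr c) (fst w) (snd w)\<bar>
      > \<tau> j * (sqrt (4 * g j / m) * sqrt (Z (snd pr) (fst w)))}" for j :: nat and pr
  define B where "B = (\<Union>j<J. \<Union>pr\<in>pairs j. E1 j pr \<union> E2 j pr)"
  have np: "1 \<le> n * p" using n0 p0 by (simp add: One_nat_def Suc_le_eq)
  then have "1 \<le> (n * p)\<^sup>2" by simp
  then have "real 9 \<le> N9" unfolding N9_def of_nat_le_iff by simp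
  then have N9: "9 \<le> N9" by simp
  have lnN9: "0 \<le> ln N9" using N9 by simp
  have finp: "finite (pairs j)" for j unfolding pairs_def using finT by simp
  have [measurable]: "E1 j pr \<in> sets PP" "E2 j pr \<in> sets PP" for j pr
    unfolding E1_def E2_def by measurable
  have g0: "0 \<le> g j" and \<tau>0: "0 \<le> \<tau> j" for j using lnN9 by (simp_all add: g_def \<tau>_def)
  have \<tau>e: "exp (- (\<tau> j)\<^sup>2 / 2) = 1 / N9 ^ (4 * 2 ^ j)" for j
  proof -
    have "(\<tau> j)\<^sup>2 / 2 = real (4 * 2 ^ j) * ln N9" using lnN9 by (simp add: \<tau>_def)
    then have "exp (- (\<tau> j)\<^sup>2 / 2) = inverse (exp (ln N9) ^ (4 * 2 ^ j))"
      by (simp only: exp_minus minus_divide_left[symmetric] exp_of_nat_mult)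
    then show ?thesis using N9 by (simp add: field_simps)
  qed
  \<comment> \<open>Two events per link, each with a two-sided tail, give the factor 4.\<close>
  have Ebd: "emeasure PP (E1 j pr \<union> E2 j pr) \<le> ennreal (4 / N9 ^ (4 * 2 ^ j))"
    if j: "j < J" and pr: "pr \<in> pairs j" for j pr
  proof -
    obtain x where x: "x \<in> ?T" "pr = (\<pi> (Suc j) x, \<pi> j x)" using pr by (auto simp: pairs_def)
    have sp: "spec (\<lambda>c. fst pr c - snd pr c) (grid k) \<le> g j" if "k < 8 * n\<^sup>2" for k
      using \<pi>spec[OF j x(1) that] by (simp add: x(2) g_def)
    have "emeasure PP (E1 j pr \<union> E2 j pr) \<le> emeasure PP (E1 j pr) + emeasure PP (E2 j pr)"
      by (rule emeasure_subadditive) measurable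
    also have "\<dots> \<le> ennreal (2 * exp (- (\<tau> j)\<^sup>2 / 2)) + ennreal (2 * exp (- (\<tau> j)\<^sup>2 / 2))"
      unfolding E1_def E2_def
      by (intro add_mono ip_tail_right[OF sp g0 \<tau>0] ip_tail_left[OF sp g0 \<tau>0])
    also have "\<dots> = ennreal (4 / N9 ^ (4 * 2 ^ j))"
      unfolding \<tau>e using N9 by (subst ennreal_plus[symmetric]) auto
    finally show ?thesis .
  qed
  have cardp: "card (pairs j) * (4 / N9 ^ (4 * 2 ^ j)) \<le> 4 / N9" if j: "j < J" for j
  proof -
    have "card (pairs j) \<le> card (\<pi> (Suc j) ` ?T \<times> \<pi> j ` ?T)"
      unfolding pairs_def using finT by (intro card_mono) auto
    also have "\<dots> \<le> (9 * (n * p)\<^sup>2) ^ (2 ^ Suc j) * (9 * (n * p)\<^sup>2) ^ (2 ^ j)"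
      unfolding card_cartesian_product using j by (intro mult_mono \<pi>card) auto
    also have "\<dots> = (9 * (n * p)\<^sup>2) ^ (2 ^ Suc j + 2 ^ j)" by (rule power_add[symmetric])
    also have "2 ^ Suc j + 2 ^ j = (3 * 2 ^ j :: nat)" by simp
    finally have "real (card (pairs j)) \<le> N9 ^ (3 * 2 ^ j)"
      unfolding N9_def by (metis of_nat_le_iff of_nat_power)
    then have "card (pairs j) * (4 / N9 ^ (4 * 2 ^ j)) \<le> N9 ^ (3 * 2 ^ j) * (4 / N9 ^ (4 * 2 ^ j))"
      using N9 by (intro mult_right_mono) auto
    also have "\<dots> = 4 / N9 ^ (2 ^ j)"
    proof -
      have "N9 ^ (4 * 2 ^ j) = N9 ^ (3 * 2 ^ j) * N9 ^ (2 ^ j)" by (simp flip: power_add)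
      then show ?thesis using N9 by simp
    qed
    also have "\<dots> \<le> 4 / N9 ^ 1"
      using N9 by (intro divide_left_mono power_increasing) auto
    finally show ?thesis by simp
  qed
  have "B \<in> sets PP" unfolding B_def using finp by (intro sets.finite_UN) auto
  moreover have "emeasure PP B \<le> ennreal (J * (4 / N9))"
  proof -
    have "emeasure PP B \<le> (\<Sum>j<J. emeasure PP (\<Union>pr\<in>pairs j. E1 j pr \<union> E2 j pr))"
      unfolding B_def using finp by (intro emeasure_subadditive_finite) auto
    also have "\<dots> \<le> (\<Sum>j<J. \<Sum>pr\<in>pairs j. emeasure PP (E1 j pr \<union> E2 j pr))"
      using finp by (intro sum_mono emeasure_subadditive_finite) auto
    also have "\<dots> \<le> (\<Sum>j<J. \<Sum>pr\<in>pairs j. ennreal (4 / N9 ^ (4 * 2 ^ j)))"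
      by (intro sum_mono Ebd) auto
    also have "\<dots> = (\<Sum>j<J. ennreal (card (pairs j) * (4 / N9 ^ (4 * 2 ^ j))))"
      using N9 by (intro sum.cong refl) (simp only: sum_constant ennreal_of_nat_eq_real_of_nat ennreal_mult' of_nat_0_le_iff)
    also have "\<dots> \<le> (\<Sum>j<J. ennreal (4 / N9))" by (intro sum_mono ennreal_leI cardp) auto
    also have "\<dots> = ennreal (J * (4 / N9))"
      using N9 by (simp only: sum_constant ennreal_of_nat_eq_real_of_nat ennreal_mult' of_nat_0_le_iff card_lessThan)
    finally show ?thesis .
  qed
  moreover have "\<bar>ip x x (fst u) (snd u)\<bar> \<le> J * \<rho> * (W s (fst u) + W s (snd u))"
    if u: "u \<in> space PP - B" and x: "x \<in> ?T" for u x
  proof -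
    let ?f = "fst u" and ?h = "snd u"
    have \<tau>c: "\<tau> j * sqrt (4 * g j / m) \<le> \<rho>" for j
    proof -
      have "\<tau> j * sqrt (4 * g j / m) = sqrt (8 * 2 ^ j * ln N9 * (4 * g j / m))"
        unfolding \<tau>_def by (rule real_sqrt_mult[symmetric])
      also have "8 * 2 ^ j * ln N9 * (4 * g j / m) = 15360 * (q * s * ln N9 / m)" by (simp add: g_def)
      \<comment> \<open>\<open>15360 = 8 * 4 * 480\<close> collects the constants of
        \<open>\<tau>\<close>, of the grid bound and of the chain; 124 is the least integer whose
        square, 15376, exceeds it.\<close>
      also have "sqrt \<dots> \<le> sqrt (124\<^sup>2 * (q * s * ln N9 / m))"
        using lnN9 by (intro real_sqrt_le_mono mult_right_mono) auto
      also have "\<dots> = \<rho>" by (simp only: real_sqrt_mult[of "124\<^sup>2"] real_sqrt_abs \<rho>_def)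
      finally show ?thesis .
    qed
    have W0: "0 \<le> W s \<phi>" for \<phi> using order_trans[OF _ sqrt_Z_le_W[OF s(1,2) x]] Z_nonneg by simp
    have "\<bar>ip (\<pi> j x) (\<pi> j x) ?f ?h\<bar> \<le> j * \<rho> * (W s ?f + W s ?h)" if "j \<le> J" for j
      using that
    proof (induction j)
      case 0
      show ?case by (simp add: \<pi>0[OF x] ip_def Y_def)
    next
      case (Suc j)
      let ?pr = "(\<pi> (Suc j) x, \<pi> j x)"
      have j: "j < J" and pr: "?pr \<in> pairs j" using Suc.prems x by (auto simp: pairs_def)
      then have nE: "u \<notin> E1 j ?pr" "u \<notin> E2 j ?pr" using u by (auto simp: B_def)
      have "\<bar>ip (\<lambda>c. \<pi> (Suc j) x c - \<pi> j x c) (\<pi> (Suc j) x) ?f ?h\<bar> \<le> \<tau> j * (sqrt (4 * g j / m) * sqrt (Z (\<pi> (Suc j) x) ?h))"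
        using nE(1) u by (simp add: E1_def not_less)
      also have "\<dots> = (\<tau> j * sqrt (4 * g j / m)) * sqrt (Z (\<pi> (Suc j) x) ?h)" by simp
      also have "\<dots> \<le> \<rho> * W s ?h"
        using \<tau>c[of j] g0[of j] \<tau>0[of j] lnN9 sqrt_Z_le_W[OF s(1,2) \<pi>T[OF x]] Z_nonneg
        by (intro mult_mono) (auto simp: \<rho>_def)
      finally have b1: "\<bar>ip (\<lambda>c. \<pi> (Suc j) x c - \<pi> j x c) (\<pi> (Suc j) x) ?f ?h\<bar> \<le> \<rho> * W s ?h" .
      have "\<bar>ip (\<pi> j x) (\<lambda>c. \<pi> (Suc j) x c - \<pi> j x c) ?f ?h\<bar> \<le> \<tau> j * (sqrt (4 * g j / m) * sqrt (Z (\<pi> j x) ?f))"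
        using nE(2) u by (simp add: E2_def not_less)
      also have "\<dots> = (\<tau> j * sqrt (4 * g j / m)) * sqrt (Z (\<pi> j x) ?f)" by simp
      also have "\<dots> \<le> \<rho> * W s ?f"
        using \<tau>c[of j] g0[of j] \<tau>0[of j] lnN9 sqrt_Z_le_W[OF s(1,2) \<pi>T[OF x]] Z_nonneg
        by (intro mult_mono) (auto simp: \<rho>_def)
      finally have b2: "\<bar>ip (\<pi> j x) (\<lambda>c. \<pi> (Suc j) x c - \<pi> j x c) ?f ?h\<bar> \<le> \<rho> * W s ?f" .
      have "\<bar>ip (\<pi> (Suc j) x) (\<pi> (Suc j) x) ?f ?h\<bar> \<le> j * \<rho> * (W s ?f + W s ?h) + \<rho> * W s ?h + \<rho> * W s ?f"
        using b1 b2 Suc.IH j unfolding ip_telescope[of "\<pi> (Suc j) x" ?f ?h "\<pi> j x"] by linarith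
      then show ?case by (simp add: algebra_simps)
    qed
    from this[of J] show ?thesis by (simp add: \<pi>J[OF x])
  qed
  ultimately show ?thesis by blast
qed

text \<open>The exceptional set is pulled back by the measure-preserving rotation, so that it speaks
  about \<open>Z x h - Z x h'\<close>. Every bad \<open>h\<close> has a section of measure at least
  \<open>1 / 2\<close> in it, whence the factor 2. The level \<open>\<delta> / 3\<close> anticipates
  the loss in \<open>bilinear_le_net\<close>, and \<open>12800 = 128 * 100\<close> comes from
  \<open>Z_concentration\<close> at \<open>t = \<delta> / 10\<close>.\<close>

lemma net_deviation_tail:
  fixes s q J :: nat and N9 \<delta> :: real
  defines "N9 \<equiv> real (9 * (n * p)\<^sup>2)"
  assumes s: "0 < s" "s \<le> n * p" "s \<le> 2 ^ J" and J: "0 < J" and q: "1 \<le> q" "8 * n\<^sup>2 \<le> 2 ^ q"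
    and \<delta>: "0 < \<delta>" "\<delta> \<le> 1"
    and small: "3 * (J * (124 * sqrt (q * s * ln N9 / m))) \<le> \<delta> / 30" "12800 * s / m \<le> \<delta>\<^sup>2"
  shows "emeasure G.P {\<phi>\<in>space G.P. \<exists>x\<in>sparse_net (n * p) s. \<bar>Z x \<phi> - (\<Sum>a\<in>cols. (x a)\<^sup>2)\<bar> > \<delta> / 3}
    \<le> ennreal (2 * (J * (4 / N9)))"
proof -
  let ?T = "sparse_net (n * p) s"
  let ?\<nu> = "\<lambda>x. \<Sum>a\<in>cols. (x a)\<^sup>2"
  define R where "R = J * (124 * sqrt (q * s * ln N9 / m))"
  have T: "finite ?T" "?T \<noteq> {}" using sparse_net_card(1)[OF s(1,2)] zero_in_sparse_net by auto
  obtain B where B[measurable]: "B \<in> sets PP" and PB: "emeasure PP B \<le> ennreal (J * (4 / N9))"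
    and nB: "\<And>u x. u \<in> space PP - B \<Longrightarrow> x \<in> ?T \<Longrightarrow> \<bar>ip x x (fst u) (snd u)\<bar> \<le> R * (W s (fst u) + W s (snd u))"
    using chaos_event[OF s J q] unfolding N9_def R_def by (auto simp only: mult.assoc)
  have "1 \<le> (n * p)\<^sup>2" using n0 p0 by (simp add: One_nat_def Suc_le_eq)
  then have "real 9 \<le> N9" unfolding N9_def of_nat_le_iff by simp
  then have N9: "9 \<le> N9" by simp
  have R0: "0 \<le> R" unfolding R_def using N9 by simp
  define rot where "rot w = (G.plus (fst w) (snd w), G.minus (fst w) (snd w))" for w
  have rot[measurable]: "rot \<in> PP \<rightarrow>\<^sub>M PP" unfolding rot_def[abs_def] by measurable
  define B' where "B' = rot -` B \<inter> space PP"
  have B'[measurable]: "B' \<in> sets PP" unfolding B'_def by measurable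
  have "emeasure PP B' = (\<integral>\<^sup>+w. indicator B' w \<partial>PP)" by simp
  also have "\<dots> = (\<integral>\<^sup>+w. indicator B (rot w) \<partial>PP)"
    by (intro nn_integral_cong) (simp add: B'_def indicator_def)
  also have "\<dots> = (\<integral>\<^sup>+w. indicator B w \<partial>PP)"
    unfolding rot_def by (rule G.nn_integral_rotation) measurable
  finally have PB': "emeasure PP B' = emeasure PP B" by simp
  have chaos: "\<bar>Z x h - Z x h'\<bar> \<le> 3 * R * (W s h + W s h')"
    if h: "(h, h') \<in> space PP - B'" and x: "x \<in> ?T" for h h' x
  proof -
    have rs: "rot (h, h') \<in> space PP - B"
      using h measurable_space[OF rot, of "(h, h')"] by (auto simp: B'_def)
    have Wr: "W s (fst (rot (h, h'))) \<le> (W s h + W s h') / sqrt 2" "W s (snd (rot (h, h'))) \<le> (W s h + W s h') / sqrt 2"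
    proof -
      have le: "(sqrt (Z z h) + sqrt (Z z h')) / sqrt 2 \<le> (W s h + W s h') / sqrt 2" if "z \<in> ?T" for z
        using sqrt_Z_le_W[OF s(1,2) that] by (intro divide_right_mono add_mono) auto
      show "W s (fst (rot (h, h'))) \<le> (W s h + W s h') / sqrt 2"
        unfolding W_def[of s "fst (rot (h, h'))"] unfolding rot_def
        using T by (intro Max.boundedI) (auto intro: order_trans[OF norm_Y_rotated(1) le])
      show "W s (snd (rot (h, h'))) \<le> (W s h + W s h') / sqrt 2"
        unfolding W_def[of s "snd (rot (h, h'))"] unfolding rot_def
        using T by (intro Max.boundedI) (auto intro: order_trans[OF norm_Y_rotated(2) le])
    qed
    have W0: "0 \<le> W s \<phi>" for \<phi> using order_trans[OF _ sqrt_Z_le_W[OF s(1,2) x]] Z_nonneg by simp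
    have "\<bar>Z x h - Z x h'\<bar> = 2 * \<bar>ip x x (fst (rot (h, h'))) (snd (rot (h, h')))\<bar>"
      unfolding ip_rotated[symmetric] rot_def by (simp add: abs_mult)
    also have "\<dots> \<le> 2 * (R * (W s (fst (rot (h, h'))) + W s (snd (rot (h, h')))))"
      using nB[OF rs x] by simp
    also have "\<dots> \<le> 2 * (R * ((W s h + W s h') / sqrt 2 + (W s h + W s h') / sqrt 2))"
      using Wr R0 by (intro mult_left_mono add_mono) auto
    \<comment> \<open>A factor 2 comes from \<open>ip_rotated\<close>, and each of the two rotated
      copies contributes \<open>1 / sqrt 2\<close>.\<close>
    also have "\<dots> = (4 / sqrt 2) * (R * (W s h + W s h'))" by simp
    also have "\<dots> \<le> 3 * (R * (W s h + W s h'))"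
    proof (intro mult_right_mono)
      have "4 / 3 \<le> sqrt 2" by (rule real_le_rsqrt) (simp add: power2_eq_square)
      then show "4 / sqrt 2 \<le> 3" by (simp add: divide_le_eq)
    qed (use R0 W0 in auto)
    finally show ?thesis by simp
  qed
  define S where "S = {\<phi>\<in>space G.P. \<exists>x\<in>?T. \<bar>Z x \<phi> - ?\<nu> x\<bar> > \<delta> / 3}"
  have S[measurable]: "S \<in> sets G.P"
  proof -
    have "S = (\<Union>x\<in>?T. {\<phi>\<in>space G.P. \<bar>Z x \<phi> - ?\<nu> x\<bar> > \<delta> / 3})" by (auto simp: S_def)
    also have "\<dots> \<in> sets G.P" by (rule sets.finite_UN[OF T(1)]) measurable
    finally show ?thesis .
  qed
  \<comment> \<open>symmetrization: for a bad \<open>h\<close>, the maximizer \<open>y\<close> depends on \<open>h\<close> only, so most \<open>h'\<close> are good for it\<close>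
  have half: "ennreal (1 / 2) \<le> emeasure G.P (Pair h -` B')" if h: "h \<in> S" for h
  proof -
    have hs: "h \<in> space G.P" using h by (simp add: S_def)
    obtain y where y: "y \<in> ?T" "\<And>x. x \<in> ?T \<Longrightarrow> \<bar>Z x h - ?\<nu> x\<bar> \<le> \<bar>Z y h - ?\<nu> y\<bar>"
    proof -
      have "Max ((\<lambda>x. \<bar>Z x h - ?\<nu> x\<bar>) ` ?T) \<in> (\<lambda>x. \<bar>Z x h - ?\<nu> x\<bar>) ` ?T" using T by (intro Max_in) auto
      then obtain y where "y \<in> ?T" "\<bar>Z y h - ?\<nu> y\<bar> = Max ((\<lambda>x. \<bar>Z x h - ?\<nu> x\<bar>) ` ?T)" by auto
      then show ?thesis using T by (intro that[of y]) auto
    qed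
    have big: "\<bar>Z y h - ?\<nu> y\<bar> > \<delta> / 3" using h y(2) unfolding S_def by force
    let ?D = "{\<phi>\<in>space G.P. \<bar>Z y \<phi> - ?\<nu> y\<bar> > 2 * (\<delta> / 10)}"
    have D: "emeasure G.P ?D \<le> ennreal (1 / 4)"
    proof (rule Z_concentration[OF _ sparse_net_l1[OF y(1)] s(1)])
      show "?\<nu> y \<le> 1" using y(1) by (simp add: sparse_net_def)
      show "128 * s / m \<le> (\<delta> / 10)\<^sup>2" using small(2) by (simp add: power_divide)
    qed (use \<delta> in simp)
    have [measurable]: "Pair h -` B' \<in> sets G.P" by (rule sets_Pair1[OF B'])
    have "space G.P \<subseteq> Pair h -` B' \<union> ?D"
    proof
      fix h' assume h': "h' \<in> space G.P"
      show "h' \<in> Pair h -` B' \<union> ?D"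
      proof (rule ccontr)
        assume "h' \<notin> Pair h -` B' \<union> ?D"
        then have nb: "(h, h') \<in> space PP - B'" and nd: "\<bar>Z y h' - ?\<nu> y\<bar> \<le> \<delta> / 5"
          using hs h' by (auto simp: space_pair_measure)
        have "\<bar>Z y h - ?\<nu> y\<bar> \<le> \<delta> / 3"
        proof (rule self_bounding[OF T, where a="3 * R" and Z="\<lambda>x. Z x h" and Z'="\<lambda>x. Z x h'" and \<nu>="?\<nu>"])
          show "\<bar>Z x h - Z x h'\<bar> \<le> 3 * R * (Max ((\<lambda>x. sqrt (Z x h)) ` ?T) + Max ((\<lambda>x. sqrt (Z x h')) ` ?T))"
            if "x \<in> ?T" for x using chaos[OF nb that] by (simp add: W_def)
          show "?\<nu> x \<le> 1" if "x \<in> ?T" for x using that by (simp add: sparse_net_def)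
          show "3 * R \<le> \<delta> / 30" using small(1) by (simp add: R_def)
        qed (use y nd \<delta> R0 Z_nonneg in auto)
        then show False using big by linarith
      qed
    qed
    then have "emeasure G.P (space G.P) \<le> emeasure G.P (Pair h -` B' \<union> ?D)" by (intro emeasure_mono) measurable
    also have "\<dots> \<le> emeasure G.P (Pair h -` B') + emeasure G.P ?D" by (rule emeasure_subadditive) measurable
    also have "\<dots> \<le> emeasure G.P (Pair h -` B') + ennreal (1 / 4)" by (rule add_left_mono[OF D])
    finally have le: "1 \<le> emeasure G.P (Pair h -` B') + ennreal (1 / 4)"
      unfolding G.PS.P.emeasure_space_1 .
    show ?thesis
    proof (rule ccontr)
      assume "\<not> ?thesis"
      then have "emeasure G.P (Pair h -` B') \<le> ennreal (1 / 2)" by (simp only: not_le less_imp_le)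
      then have "emeasure G.P (Pair h -` B') + ennreal (1 / 4) \<le> ennreal (1 / 2) + ennreal (1 / 4)"
        by (rule add_right_mono)
      also have "\<dots> = ennreal (3 / 4)" by (subst ennreal_plus[symmetric]) auto
      finally have "1 \<le> ennreal (3 / 4)" using le by (rule order_trans[rotated])
      then show False by simp
    qed
  qed
  have "ennreal (1 / 2) * emeasure G.P S = (\<integral>\<^sup>+h. ennreal (1 / 2) * indicator S h \<partial>G.P)"
    by (simp add: nn_integral_cmult_indicator)
  also have "\<dots> \<le> (\<integral>\<^sup>+h. emeasure G.P (Pair h -` B') \<partial>G.P)"
    using half by (intro nn_integral_mono) (auto simp: indicator_def)
  also have "\<dots> = emeasure PP B'" by (rule G.PS.P.emeasure_pair_measure_alt[OF B', symmetric])
  finally have "ennreal (1 / 2) * emeasure G.P S \<le> ennreal (J * (4 / N9))" using PB PB' by simp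
  then have "ennreal 2 * (ennreal (1 / 2) * emeasure G.P S) \<le> ennreal 2 * ennreal (J * (4 / N9))"
    by (rule mult_left_mono) simp
  also have "ennreal 2 * (ennreal (1 / 2) * emeasure G.P S) = emeasure G.P S"
    by (subst mult.assoc[symmetric], subst ennreal_mult'[symmetric]) auto
  also have "ennreal 2 * ennreal (J * (4 / N9)) = ennreal (2 * (J * (4 / N9)))"
    by (rule ennreal_mult'[symmetric]) simp
  finally show ?thesis unfolding S_def .
qed

end

section \<open>The sparse norm of the Gram defect\<close>

text \<open>The integer functions will range over a countable \<open>PiE\<close>, whose members are
  \<open>undefined\<close> outside \<open>{1..N}\<close>; the value zero is put there so that
  supports make sense.\<close>

definition int_vec :: "nat \<Rightarrow> (nat \<Rightarrow> int) \<Rightarrow> nat \<Rightarrow> real" where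
  "int_vec N f a = (if a \<in> {1..N} then of_int (f a) else 0)"

definition bilin :: "nat \<Rightarrow> (nat \<Rightarrow> nat \<Rightarrow> real) \<Rightarrow> (nat \<Rightarrow> real) \<Rightarrow> (nat \<Rightarrow> real) \<Rightarrow> real" where
  "bilin N A y x = (\<Sum>a\<in>{1..N}. \<Sum>b\<in>{1..N}. y a * A a b * x b)"

definition nsq :: "nat \<Rightarrow> (nat \<Rightarrow> real) \<Rightarrow> real" where
  "nsq N x = (\<Sum>a\<in>{1..N}. (x a)\<^sup>2)"

lemma bilin_scale: "bilin N A (\<lambda>a. c * y a) (\<lambda>a. d * x a) = c * d * bilin N A y x"
  by (simp add: bilin_def sum_distrib_left mult_ac)

lemma nsq_scale: "nsq N (\<lambda>a. c * x a) = c\<^sup>2 * nsq N x"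
  unfolding nsq_def power_mult_distrib sum_distrib_left ..

lemma nsq_nonneg: "0 \<le> nsq N x"
  by (simp add: nsq_def sum_nonneg)

definition sparse_forms :: "nat \<Rightarrow> nat \<Rightarrow> (nat \<Rightarrow> nat \<Rightarrow> real) \<Rightarrow> real set" where
  "sparse_forms N s A = {\<bar>bilin N A y x\<bar> | x y \<Gamma>. \<Gamma> \<subseteq> {1..N} \<and> card \<Gamma> \<le> s \<and>
    supported_on \<Gamma> x \<and> supported_on \<Gamma> y \<and> nsq N x = 1 \<and> nsq N y = 1}"

lemma s_norm_eq: "s_norm N s A = Sup (sparse_forms N s A)"
  unfolding s_norm_def sparse_forms_def supported_on_def bilin_def nsq_def ..

lemma sparse_forms_nonempty:
  assumes "0 < s" "0 < N"
  shows "sparse_forms N s A \<noteq> {}"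
proof -
  let ?e = "\<lambda>a::nat. if a = 1 then 1 else 0 :: real"
  have "nsq N ?e = 1"
  proof -
    have "nsq N ?e = (\<Sum>a\<in>{1..N}. if a = 1 then 1 else 0)" unfolding nsq_def by (intro sum.cong) auto
    also have "\<dots> = 1" using assms by (subst sum.delta) auto
    finally show ?thesis .
  qed
  moreover have "supported_on {1} ?e" by (simp add: supported_on_def)
  moreover have "{1} \<subseteq> {1..N}" "card {1::nat} \<le> s" using assms by auto
  ultimately have "\<bar>bilin N A ?e ?e\<bar> \<in> sparse_forms N s A" unfolding sparse_forms_def by blast
  then show ?thesis by blast
qed

lemma sparse_forms_bdd: "bdd_above (sparse_forms N s A)"
proof (rule bdd_aboveI)
  fix t assume "t \<in> sparse_forms N s A"
  then obtain x y where t: "t = \<bar>bilin N A y x\<bar>" and n1: "nsq N x = 1" "nsq N y = 1" by (auto simp: sparse_forms_def)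
  have le1: "\<bar>u a\<bar> \<le> 1" if "nsq N u = 1" "a \<in> {1..N}" for u a
  proof -
    have "(u a)\<^sup>2 \<le> nsq N u" unfolding nsq_def using that(2) by (intro member_le_sum) auto
    then show ?thesis using that(1) by (simp add: abs_square_le_1)
  qed
  have "t \<le> (\<Sum>a\<in>{1..N}. \<Sum>b\<in>{1..N}. \<bar>y a * A a b * x b\<bar>)"
    unfolding t bilin_def by (rule order_trans[OF sum_abs sum_mono[OF sum_abs]])
  also have "\<dots> \<le> (\<Sum>a\<in>{1..N}. \<Sum>b\<in>{1..N}. \<bar>A a b\<bar>)"
  proof (intro sum_mono)
    fix a b assume "a \<in> {1..N}" "b \<in> {1..N}"
    then have "\<bar>y a\<bar> * \<bar>A a b\<bar> * \<bar>x b\<bar> \<le> 1 * \<bar>A a b\<bar> * 1"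
      using le1 n1 by (intro mult_mono) auto
    then show "\<bar>y a * A a b * x b\<bar> \<le> \<bar>A a b\<bar>" by (simp add: abs_mult)
  qed
  finally show "t \<le> (\<Sum>a\<in>{1..N}. \<Sum>b\<in>{1..N}. \<bar>A a b\<bar>)" .
qed

text \<open>By homogeneity the supremum may be tested on integer vectors; this makes the event
  \<open>s_norm > \<delta>\<close> a countable union of measurable events.\<close>

lemma s_norm_greater_iff:
  assumes s: "0 < s" and N: "0 < N" and \<delta>: "0 \<le> \<delta>"
  shows "\<delta> < s_norm N s A \<longleftrightarrow> (\<exists>f\<in>PiE {1..N} (\<lambda>_. UNIV). \<exists>g\<in>PiE {1..N} (\<lambda>_. UNIV).
    (\<exists>\<Gamma>\<subseteq>{1..N}. card \<Gamma> \<le> s \<and> supported_on \<Gamma> (int_vec N f) \<and> supported_on \<Gamma> (int_vec N g)) \<and>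
    \<delta> * (sqrt (nsq N (int_vec N f)) * sqrt (nsq N (int_vec N g))) < \<bar>bilin N A (int_vec N g) (int_vec N f)\<bar>)"
    (is "?L \<longleftrightarrow> ?R")
proof
  assume ?R
  then obtain f g \<Gamma> where \<Gamma>: "\<Gamma> \<subseteq> {1..N}" "card \<Gamma> \<le> s" "supported_on \<Gamma> (int_vec N f)" "supported_on \<Gamma> (int_vec N g)"
    and gt: "\<delta> * (sqrt (nsq N (int_vec N f)) * sqrt (nsq N (int_vec N g))) < \<bar>bilin N A (int_vec N g) (int_vec N f)\<bar>" by blast
  let ?x = "int_vec N f" and ?y = "int_vec N g"
  have zero: "\<bar>bilin N A v u\<bar> = 0" if "nsq N u = 0 \<or> nsq N v = 0" for u v
  proof -
    have "(\<forall>a\<in>{1..N}. u a = 0) \<or> (\<forall>a\<in>{1..N}. v a = 0)"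
      using that unfolding nsq_def by (simp add: sum_nonneg_eq_0_iff)
    then show ?thesis unfolding bilin_def by auto
  qed
  \<comment> \<open>The strict inequality fails for a zero vector, so both vectors can be
    normalized.\<close>
  have pos: "0 < nsq N ?x" "0 < nsq N ?y"
    using zero[of ?x ?y] gt nsq_nonneg[of N ?x] nsq_nonneg[of N ?y] by (auto simp: less_le)
  define c where "c = 1 / sqrt (nsq N ?x)"
  define d where "d = 1 / sqrt (nsq N ?y)"
  have "nsq N (\<lambda>a. c * ?x a) = 1" "nsq N (\<lambda>a. d * ?y a) = 1"
    unfolding nsq_scale c_def d_def using pos by (simp_all add: power_divide)
  moreover have "supported_on \<Gamma> (\<lambda>a. c * ?x a)" "supported_on \<Gamma> (\<lambda>a. d * ?y a)"
    using \<Gamma> by (simp_all add: supported_on_def)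
  ultimately have "\<bar>bilin N A (\<lambda>a. d * ?y a) (\<lambda>a. c * ?x a)\<bar> \<in> sparse_forms N s A"
    unfolding sparse_forms_def using \<Gamma>(1,2) by blast
  then have "\<bar>bilin N A (\<lambda>a. d * ?y a) (\<lambda>a. c * ?x a)\<bar> \<le> s_norm N s A"
    unfolding s_norm_eq by (rule cSup_upper[OF _ sparse_forms_bdd])
  moreover have "\<delta> < \<bar>bilin N A (\<lambda>a. d * ?y a) (\<lambda>a. c * ?x a)\<bar>"
  proof -
    have "\<delta> < \<bar>bilin N A ?y ?x\<bar> / (sqrt (nsq N ?x) * sqrt (nsq N ?y))"
      using gt pos by (subst pos_less_divide_eq) auto
    also have "\<dots> = \<bar>bilin N A (\<lambda>a. d * ?y a) (\<lambda>a. c * ?x a)\<bar>"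
      unfolding bilin_scale c_def d_def using pos by (simp add: abs_mult)
    finally show ?thesis .
  qed
  ultimately show ?L by linarith
next
  assume ?L
  then obtain t where "t \<in> sparse_forms N s A" "\<delta> < t"
    unfolding s_norm_eq less_cSup_iff[OF sparse_forms_nonempty[OF s N] sparse_forms_bdd] by blast
  then obtain x y \<Gamma> where \<Gamma>: "\<Gamma> \<subseteq> {1..N}" "card \<Gamma> \<le> s" "supported_on \<Gamma> x" "supported_on \<Gamma> y"
    and n1: "nsq N x = 1" "nsq N y = 1" and gt: "\<delta> < \<bar>bilin N A y x\<bar>"
    unfolding sparse_forms_def by blast
  \<comment> \<open>Taking the floor of \<open>k * u\<close> keeps zeros, hence the support, and
    after division by \<open>k\<close> it converges to \<open>u\<close> in every coordinate. The
    strict inequality therefore survives for some finite \<open>k\<close>.\<close>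
  define F where "F u k = (\<lambda>a\<in>{1..N}. \<lfloor>real k * u a\<rfloor>)" for u :: "nat \<Rightarrow> real" and k :: nat
  define V where "V u k a = 1 / real k * int_vec N (F u k) a" for u :: "nat \<Rightarrow> real" and k :: nat and a
  have V: "V u k a = real_of_int \<lfloor>real k * u a\<rfloor> / real k" if "a \<in> {1..N}" for u k a
    using that by (simp add: V_def F_def int_vec_def)
  have lim: "(\<lambda>k. V u k a) \<longlonglongrightarrow> u a" if "a \<in> {1..N}" for u a
    unfolding V[OF that]
  proof (rule tendsto_sandwich)
    show "\<forall>\<^sub>F k in sequentially. u a - 1 / real k \<le> real_of_int \<lfloor>real k * u a\<rfloor> / real k"
      using eventually_gt_at_top[of 0]
    proof eventually_elim
      case (elim k)
      have "real k * u a - 1 \<le> real_of_int \<lfloor>real k * u a\<rfloor>" by linarith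
      then have "(real k * u a - 1) / real k \<le> real_of_int \<lfloor>real k * u a\<rfloor> / real k" by (rule divide_right_mono) simp
      then show ?case using elim by (simp add: diff_divide_distrib)
    qed
    show "\<forall>\<^sub>F k in sequentially. real_of_int \<lfloor>real k * u a\<rfloor> / real k \<le> u a"
      using eventually_gt_at_top[of 0]
    proof eventually_elim
      case (elim k)
      have "real_of_int \<lfloor>real k * u a\<rfloor> / real k \<le> (real k * u a) / real k" by (rule divide_right_mono) auto
      then show ?case using elim by simp
    qed
    have "(\<lambda>k. u a - 1 / real k) \<longlonglongrightarrow> u a - 0" by (intro tendsto_intros lim_1_over_n)
    then show "(\<lambda>k. u a - 1 / real k) \<longlonglongrightarrow> u a" by simp
  qed simp
  define H where "H k = \<bar>bilin N A (V y k) (V x k)\<bar> - \<delta> * (sqrt (nsq N (V x k)) * sqrt (nsq N (V y k)))" for k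
  have "H \<longlonglongrightarrow> \<bar>bilin N A y x\<bar> - \<delta> * (sqrt (nsq N x) * sqrt (nsq N y))"
    unfolding H_def bilin_def nsq_def by (intro tendsto_intros lim)
  then have "\<forall>\<^sub>F k in sequentially. 0 < H k"
    using gt n1 by (intro order_tendstoD(1)) auto
  then have "\<forall>\<^sub>F k in sequentially. 0 < H k \<and> 0 < k" using eventually_gt_at_top[of 0] by (rule eventually_conj)
  then obtain k where k: "0 < H k" "0 < k" using eventually_happens sequentially_bot by blast
  let ?f = "F x k" and ?g = "F y k"
  have VV: "V u k = (\<lambda>a. 1 / real k * int_vec N (F u k) a)" for u by (simp add: V_def fun_eq_iff)
  have sqk: "sqrt ((1 / real k)\<^sup>2 * t) = 1 / real k * sqrt t" for t by (simp add: real_sqrt_mult)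
  have "H k = (1 / real k)\<^sup>2 * (\<bar>bilin N A (int_vec N ?g) (int_vec N ?f)\<bar> - \<delta> * (sqrt (nsq N (int_vec N ?f)) * sqrt (nsq N (int_vec N ?g))))"
    unfolding H_def VV bilin_scale nsq_scale sqk abs_mult by (simp add: power2_eq_square right_diff_distrib)
  then have gtk: "\<delta> * (sqrt (nsq N (int_vec N ?f)) * sqrt (nsq N (int_vec N ?g))) < \<bar>bilin N A (int_vec N ?g) (int_vec N ?f)\<bar>"
    using k by (simp add: zero_less_mult_iff)
  have sup: "supported_on \<Gamma> (int_vec N (F u k))" if "supported_on \<Gamma> u" for u
    using that by (simp add: supported_on_def int_vec_def F_def)
  have F: "F u k \<in> PiE {1..N} (\<lambda>_. UNIV)" for u by (simp add: F_def)
  show ?R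
    by (rule bexI[OF _ F[of x]], rule bexI[OF _ F[of y]], rule conjI, rule exI[of _ \<Gamma>])
      (intro conjI \<Gamma>(1,2) sup \<Gamma>(3,4), rule gtk)
qed

section \<open>Measurability of the event and reduction to the net\<close>

context probe_channel
begin

lemma gram_defect_sym: "gram_defect n m \<phi> a b = gram_defect n m \<phi> b a"
  by (simp add: gram_defect_def mult.commute)

lemma gram_defect_measurable:
  assumes "a \<in> cols" "b \<in> cols"
  shows "(\<lambda>\<phi>. gram_defect n m \<phi> a b) \<in> borel_measurable G.P"
  unfolding gram_defect_def Phi_mat_slot
  by (intro borel_measurable_diff borel_measurable_const borel_measurable_sum borel_measurable_times
      G.component_measurable slot_range assms)

lemma gram_defect_form: "bilin (n * p) (gram_defect n m \<phi>) z z = (\<Sum>a\<in>cols. (z a)\<^sup>2) - Z z \<phi>"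
proof -
  have "bilin (n * p) (gram_defect n m \<phi>) z z
    = (\<Sum>a\<in>cols. \<Sum>b\<in>cols. if a = b then z a * z b else 0)
      - (\<Sum>a\<in>cols. \<Sum>b\<in>cols. \<Sum>r\<in>outs. (\<phi> (slot r a) * z a) * (\<phi> (slot r b) * z b))"
    unfolding bilin_def sum_subtractf[symmetric]
    by (intro sum.cong refl)
      (auto simp: gram_defect_def Phi_mat_slot sum_distrib_left sum_distrib_right algebra_simps)
  also have "(\<Sum>a\<in>cols. \<Sum>b\<in>cols. if a = b then z a * z b else 0) = (\<Sum>a\<in>cols. (z a)\<^sup>2)"
    by (intro sum.cong refl) (simp add: power2_eq_square)
  also have "(\<Sum>a\<in>cols. \<Sum>b\<in>cols. \<Sum>r\<in>outs. (\<phi> (slot r a) * z a) * (\<phi> (slot r b) * z b))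
    = (\<Sum>a\<in>cols. \<Sum>r\<in>outs. \<Sum>b\<in>cols. (\<phi> (slot r a) * z a) * (\<phi> (slot r b) * z b))"
    by (intro sum.cong refl sum.swap)
  also have "\<dots> = (\<Sum>r\<in>outs. \<Sum>a\<in>cols. \<Sum>b\<in>cols. (\<phi> (slot r a) * z a) * (\<phi> (slot r b) * z b))"
    by (rule sum.swap)
  also have "\<dots> = Z z \<phi>"
    unfolding Z_def Y_def power2_eq_square sum_product ..
  finally show ?thesis .
qed

lemma s_norm_event_sets:
  assumes "0 < s" "0 \<le> \<delta>"
  shows "{\<phi>\<in>space G.P. s_norm (n * p) s (gram_defect n m \<phi>) > \<delta>} \<in> sets G.P"
proof -
  let ?N = "n * p"
  define D where "D = PiE {1..?N} (\<lambda>_. UNIV :: int set)"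
  define joint where "joint f g \<longleftrightarrow> (\<exists>\<Gamma>\<subseteq>{1..?N}. card \<Gamma> \<le> s \<and> supported_on \<Gamma> (int_vec ?N f) \<and> supported_on \<Gamma> (int_vec ?N g))" for f g
  define large where "large f g A \<longleftrightarrow> \<delta> * (sqrt (nsq ?N (int_vec ?N f)) * sqrt (nsq ?N (int_vec ?N g)))
      < \<bar>bilin ?N A (int_vec ?N g) (int_vec ?N f)\<bar>" for f g A
  have "0 < ?N" using n0 p0 by simp
  then have iff: "\<delta> < s_norm ?N s A \<longleftrightarrow> (\<exists>f\<in>D. \<exists>g\<in>D. joint f g \<and> large f g A)" for A
    unfolding D_def joint_def large_def by (rule s_norm_greater_iff[OF assms(1) _ assms(2)])
  have "countable D" unfolding D_def by (rule countable_PiE) auto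
  then have countable: "countable {g\<in>D. joint f g}" "countable D" for f by auto
  have "(\<lambda>\<phi>. bilin ?N (gram_defect n m \<phi>) y x) \<in> borel_measurable G.P" for x y
    unfolding bilin_def
    by (intro borel_measurable_sum borel_measurable_times borel_measurable_const gram_defect_measurable)
  then have "{\<phi>\<in>space G.P. large f g (gram_defect n m \<phi>)} \<in> sets G.P" for f g
    unfolding large_def by measurable
  then have "(\<Union>f\<in>D. \<Union>g\<in>{g\<in>D. joint f g}. {\<phi>\<in>space G.P. large f g (gram_defect n m \<phi>)}) \<in> sets G.P"
    by (intro sets.countable_UN'' countable) auto
  also have "(\<Union>f\<in>D. \<Union>g\<in>{g\<in>D. joint f g}. {\<phi>\<in>space G.P. large f g (gram_defect n m \<phi>)})
    = {\<phi>\<in>space G.P. s_norm ?N s (gram_defect n m \<phi>) > \<delta>}"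
    unfolding iff by auto
  finally show ?thesis .
qed

lemma s_norm_le_net:
  assumes s: "0 < s" and net: "\<And>x. x \<in> sparse_net (n * p) s \<Longrightarrow> \<bar>Z x \<phi> - (\<Sum>a\<in>cols. (x a)\<^sup>2)\<bar> \<le> \<kappa>"
  shows "s_norm (n * p) s (gram_defect n m \<phi>) \<le> 3 * \<kappa>"
proof -
  have "0 < n * p" using n0 p0 by simp
  then show ?thesis unfolding s_norm_eq
  proof (intro cSup_least sparse_forms_nonempty s)
    fix t assume "t \<in> sparse_forms (n * p) s (gram_defect n m \<phi>)"
    then obtain x y \<Gamma> where t: "t = \<bar>bilin (n * p) (gram_defect n m \<phi>) y x\<bar>"
      and \<Gamma>: "\<Gamma> \<subseteq> cols" "card \<Gamma> \<le> s" "supported_on \<Gamma> x" "supported_on \<Gamma> y"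
      and n1: "nsq (n * p) x = 1" "nsq (n * p) y = 1" unfolding sparse_forms_def by blast
    show "t \<le> 3 * \<kappa>"
      unfolding t bilin_def
    proof (rule bilinear_le_net[OF gram_defect_sym s _ \<Gamma>])
      fix z assume z: "z \<in> sparse_net (n * p) s"
      show "\<bar>\<Sum>a\<in>cols. \<Sum>b\<in>cols. z a * gram_defect n m \<phi> a b * z b\<bar> \<le> \<kappa>"
        using net[OF z] gram_defect_form[of \<phi> z] unfolding bilin_def by (simp add: abs_minus_commute)
    qed (use n1 in \<open>simp_all add: nsq_def\<close>)
  qed
qed

lemma s_norm_tail:
  fixes s q J :: nat and N9 \<delta> :: real
  defines "N9 \<equiv> real (9 * (n * p)\<^sup>2)"
  assumes s: "0 < s" "s \<le> n * p" "s \<le> 2 ^ J" and J: "0 < J" and q: "1 \<le> q" "8 * n\<^sup>2 \<le> 2 ^ q"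
    and \<delta>: "0 < \<delta>" "\<delta> \<le> 1"
    and small: "3 * (J * (124 * sqrt (q * s * ln N9 / m))) \<le> \<delta> / 30" "12800 * s / m \<le> \<delta>\<^sup>2"
  shows "emeasure G.P {\<phi>\<in>space G.P. s_norm (n * p) s (gram_defect n m \<phi>) > \<delta>} \<le> ennreal (2 * (J * (4 / N9)))"
proof -
  let ?S = "{\<phi>\<in>space G.P. \<exists>x\<in>sparse_net (n * p) s. \<bar>Z x \<phi> - (\<Sum>a\<in>cols. (x a)\<^sup>2)\<bar> > \<delta> / 3}"
  have S: "?S \<in> sets G.P"
  proof -
    have "?S = (\<Union>x\<in>sparse_net (n * p) s. {\<phi>\<in>space G.P. \<bar>Z x \<phi> - (\<Sum>a\<in>cols. (x a)\<^sup>2)\<bar> > \<delta> / 3})" by auto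
    also have "\<dots> \<in> sets G.P" by (rule sets.finite_UN[OF sparse_net_card(1)[OF s(1,2)]]) measurable
    finally show ?thesis .
  qed
  have "emeasure G.P {\<phi>\<in>space G.P. s_norm (n * p) s (gram_defect n m \<phi>) > \<delta>} \<le> emeasure G.P ?S"
  proof (rule emeasure_mono[OF _ S])
    show "{\<phi>\<in>space G.P. s_norm (n * p) s (gram_defect n m \<phi>) > \<delta>} \<subseteq> ?S"
    proof safe
      fix \<phi> assume "\<delta> < s_norm (n * p) s (gram_defect n m \<phi>)"
      then show "\<exists>x\<in>sparse_net (n * p) s. \<delta> / 3 < \<bar>Z x \<phi> - (\<Sum>a\<in>cols. (x a)\<^sup>2)\<bar>"
        using s_norm_le_net[OF s(1), of \<phi> "\<delta> / 3"] by (force simp: not_less)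
    qed
  qed
  also have "\<dots> \<le> ennreal (2 * (J * (4 / N9)))"
    unfolding N9_def by (rule net_deviation_tail[OF s J q \<delta> small[unfolded N9_def]])
  finally show ?thesis .
qed

end

section \<open>Choice of the parameters and constants\<close>

lemma ex_power2_ge:
  fixes k :: nat
  assumes "1 < k"
  shows "\<exists>q\<ge>1. k \<le> 2 ^ q \<and> real q \<le> log 2 k + 1"
proof -
  define q where "q = nat \<lceil>log 2 k\<rceil>"
  have l0: "0 < log 2 k" using assms by simp
  have q: "log 2 k \<le> q" "real q \<le> log 2 k + 1" using l0 unfolding q_def by linarith+
  have "real k = 2 powr log 2 k" using assms by simp
  also have "\<dots> \<le> 2 powr real q" using q by simp
  also have "\<dots> = 2 ^ q" by (simp add: powr_realpow)
  finally have "k \<le> 2 ^ q" by (metis of_nat_le_iff of_nat_numeral of_nat_power)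
  moreover have "1 \<le> q" using l0 q(1) by (cases q) auto
  ultimately show ?thesis using q by blast
qed

theorem theorem2:
  shows "\<exists>C8 C9 :: real. C8 > 0 \<and> C9 > 0 \<and>
    (\<forall>(n::nat) (p::nat) (m::nat) (s::nat) (\<delta>::real).
       0 < n \<longrightarrow> 0 < p \<longrightarrow> n \<le> m \<longrightarrow> 2 \<le> s \<longrightarrow> s \<le> n * p \<longrightarrow>
       0 < \<delta> \<longrightarrow> \<delta> \<le> 1 \<longrightarrow>
       real m \<ge> C9 * \<delta> powi (-2) * real s * (ln (real (n * p))) ^ 6 \<longrightarrow>
       ({\<omega> \<in> space (probe_space p m). s_norm (n * p) s (gram_defect n m \<omega>) > \<delta>}
           \<in> sets (probe_space p m) \<and>
        measure (probe_space p m)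
          {\<omega> \<in> space (probe_space p m). s_norm (n * p) s (gram_defect n m \<omega>) > \<delta>}
        \<le> C8 / real (n * p)))"
proof -
  \<comment> \<open>A round value with room to spare: the chaos bound asks for
    \<open>648 * 11160\<^sup>2 * (3 / 2)\<^sup>2\<close>, below \<open>2 * 10 ^ 11\<close>, and the
    concentration bound for \<open>12800 * (3 / 2) ^ 6\<close>.\<close>
  define C9 :: real where "C9 = 10 ^ 15"
  have "{\<omega> \<in> space (probe_space p m). s_norm (n * p) s (gram_defect n m \<omega>) > \<delta>} \<in> sets (probe_space p m) \<and>
        measure (probe_space p m) {\<omega> \<in> space (probe_space p m). s_norm (n * p) s (gram_defect n m \<omega>) > \<delta>}
        \<le> 8 / real (n * p)"
    if n: "0 < n" and p: "0 < p" and nm: "n \<le> m" and s: "2 \<le> s" "s \<le> n * p" and \<delta>: "0 < \<delta>" "\<delta> \<le> 1"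
      and m: "C9 * \<delta> powi (-2) * real s * (ln (real (n * p))) ^ 6 \<le> real m"
    for n p m s :: nat and \<delta> :: real
  proof -
    interpret probe_channel n p m using n p nm by unfold_locales
    define N where "N = real (n * p)"
    define l where "l = ln N"
    define N9 where "N9 = real (9 * (n * p)\<^sup>2)"
    have N2: "2 \<le> N" using s unfolding N_def by linarith
    have ln2: "2 / 3 \<le> ln (2::real)" using ln2_ge_two_thirds .
    have "ln 2 \<le> l" unfolding l_def using N2 by simp
    \<comment> \<open>Additive constants are absorbed into multiples of \<open>l\<close> by this
      bound; for example \<open>log 2 s + 1 \<le> 3 / 2 * l + 3 / 2 * l\<close>.\<close>
    then have l: "2 / 3 \<le> l" using ln2 by linarith
    have log2: "log 2 x \<le> 3 / 2 * ln x" if "1 \<le> x" for x :: real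
    proof -
      have "log 2 x = ln x / ln 2" by (simp add: log_def)
      also have "\<dots> \<le> ln x / (2 / 3)" using that ln2 by (intro divide_left_mono) auto
      finally show ?thesis by simp
    qed
    obtain J where J: "1 \<le> J" "s \<le> 2 ^ J" "real J \<le> log 2 s + 1" using ex_power2_ge[of s] s by auto
    have "0 < n\<^sup>2" using n by simp
    then have "1 < 8 * n\<^sup>2" by linarith
    then obtain q where q: "1 \<le> q" "8 * n\<^sup>2 \<le> 2 ^ q" "real q \<le> log 2 (real (8 * n\<^sup>2)) + 1"
      using ex_power2_ge by blast
    have sN: "real s \<le> N" using s unfolding N_def of_nat_le_iff by simp
    have nN: "real n \<le> N" using p unfolding N_def of_nat_le_iff by simp
    have Jl: "real J \<le> 3 * l"
    proof -
      have "log 2 s \<le> 3 / 2 * ln (real s)" using s by (intro log2) auto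
      also have "\<dots> \<le> 3 / 2 * l" unfolding l_def using s sN by (intro mult_left_mono) auto
      finally show ?thesis using J(3) l by linarith
    qed
    have ql: "real q \<le> 9 * l"
    proof -
      have "real (8 * n\<^sup>2) \<le> 2 ^ 3 * N\<^sup>2" using nN by (simp add: power_mono)
      then have "log 2 (real (8 * n\<^sup>2)) \<le> log 2 (2 ^ 3 * N\<^sup>2)" using n N2 by (subst log_le_cancel_iff) auto
      also have "\<dots> = log 2 (2 ^ 3) + log 2 (N\<^sup>2)" using N2 by (subst log_mult) auto
      also have "log 2 (2 ^ 3 :: real) = 3" by (subst log_nat_power) auto
      also have "log 2 (N\<^sup>2) = 2 * log 2 N" using N2 by (subst log_nat_power) auto
      also have "2 * log 2 N \<le> 3 * l" using log2[of N] N2 unfolding l_def by simp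
      finally show ?thesis using q(3) l by linarith
    qed
    have N9l: "ln N9 \<le> 8 * l"
    proof -
      have "N9 \<le> N ^ 4 * N\<^sup>2"
      proof -
        have "(2::real) ^ 4 \<le> N ^ 4" using N2 by (intro power_mono) auto
        then have "9 * N\<^sup>2 \<le> N ^ 4 * N\<^sup>2" by (intro mult_right_mono) auto
        then show ?thesis by (simp add: N9_def N_def)
      qed
      also have "\<dots> = N ^ 6" by (simp flip: power_add)
      finally have "ln N9 \<le> ln (N ^ 6)" using n p unfolding N9_def by (intro ln_mono) auto
      then show ?thesis using l N2 by (simp add: ln_realpow l_def)
    qed
    have N9: "9 \<le> N9"
    proof -
      have "(2::real)\<^sup>2 \<le> N\<^sup>2" using N2 by (intro power_mono) auto
      then show ?thesis by (simp add: N9_def N_def)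
    qed
    have mpos: "0 < real m" using n nm by simp
    have \<delta>2: "\<delta> powi (-2) = 1 / \<delta>\<^sup>2" by (simp add: power_int_minus divide_inverse)
    have m': "C9 * s * l ^ 6 \<le> \<delta>\<^sup>2 * m"
    proof -
      have "\<delta>\<^sup>2 * (C9 * \<delta> powi (-2) * real s * (ln (real (n * p))) ^ 6) \<le> \<delta>\<^sup>2 * m" using m by (intro mult_left_mono) auto
      moreover have "\<delta>\<^sup>2 * (C9 * \<delta> powi (-2) * real s * (ln (real (n * p))) ^ 6) = C9 * s * l ^ 6"
        unfolding \<delta>2 l_def N_def using \<delta> by simp
      ultimately show ?thesis by (simp only:)
    qed
    have l2: "(2 / 3)\<^sup>2 \<le> l\<^sup>2" and l6: "(2 / 3) ^ 6 \<le> l ^ 6" using l by (auto intro!: power_mono)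
    have small2: "12800 * s / m \<le> \<delta>\<^sup>2"
    proof -
      have "12800 * real s \<le> C9 * (2 / 3) ^ 6 * real s"
        unfolding C9_def by (intro mult_right_mono) (auto simp: power_divide)
      also have "\<dots> \<le> C9 * l ^ 6 * s" using l6 by (intro mult_right_mono mult_left_mono) (auto simp: C9_def)
      also have "\<dots> \<le> \<delta>\<^sup>2 * m" using m' by (simp add: mult_ac)
      finally show ?thesis using mpos by (simp add: divide_le_eq)
    qed
    have small1: "3 * (J * (124 * sqrt (q * s * ln N9 / m))) \<le> \<delta> / 30"
    proof -
      have ln0: "0 \<le> ln N9" using N9 by simp
      have "(J * sqrt (q * s * ln N9 / m))\<^sup>2 = (real J)\<^sup>2 * (q * s * ln N9 / m)"
        using ln0 by (simp add: power_mult_distrib)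
      also have "\<dots> \<le> (3 * l)\<^sup>2 * ((9 * l) * s * (8 * l) / m)"
        using Jl ql N9l ln0 l by (intro mult_mono power_mono divide_right_mono) (auto intro: mult_right_mono)
      \<comment> \<open>\<open>648 = 3\<^sup>2 * 9 * 8\<close> collects the bounds on
        \<open>J\<close>, \<open>q\<close> and \<open>ln N9\<close>, and
        \<open>11160 = 3 * 124 * 30\<close> the constants of the required inequality.\<close>
      also have "\<dots> = 648 * (s * l ^ 4) / m" by (simp add: power_numeral_reduce)
      also have "\<dots> \<le> (\<delta> / 11160)\<^sup>2"
      proof -
        have "648 * 11160\<^sup>2 * (s * l ^ 4) \<le> C9 * (2 / 3)\<^sup>2 * (s * l ^ 4)"
          unfolding C9_def using l by (intro mult_right_mono) (auto simp: field_simps)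
        also have "\<dots> \<le> C9 * l\<^sup>2 * (s * l ^ 4)"
          using l2 l by (intro mult_right_mono mult_left_mono) (auto simp: C9_def)
        also have "\<dots> = C9 * s * l ^ 6" by (simp add: power_numeral_reduce)
        also have "\<dots> \<le> \<delta>\<^sup>2 * m" by (rule m')
        finally show ?thesis using mpos by (simp add: power_divide field_simps)
      qed
      finally have "J * sqrt (q * s * ln N9 / m) \<le> \<delta> / 11160"
        by (rule power2_le_imp_le) (use \<delta> in simp)
      then show ?thesis by simp
    qed
    have "emeasure G.P {\<phi>\<in>space G.P. s_norm (n * p) s (gram_defect n m \<phi>) > \<delta>} \<le> ennreal (2 * (J * (4 / N9)))"
      unfolding N9_def
      by (rule s_norm_tail) (use s J q \<delta> small1 small2 in \<open>auto simp: N9_def\<close>)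
    also have "\<dots> \<le> ennreal (8 / N)"
    proof (rule ennreal_leI)
      \<comment> \<open>\<open>N9\<close> is of order \<open>N\<^sup>2\<close>, so one power of
        \<open>N\<close> is available to pay for the number of levels,
        \<open>J \<le> 3 * N\<close>.\<close>
      have "l \<le> N" unfolding l_def using N2 ln_le_minus_one[of N] by linarith
      then have "real J \<le> 3 * N" using Jl by linarith
      then have "2 * (J * (4 / N9)) \<le> 2 * (3 * N * (4 / N9))" using N9 by (intro mult_left_mono mult_right_mono) auto
      also have "\<dots> = 24 / 9 / N" using N2 by (simp add: N9_def N_def power2_eq_square field_simps)
      also have "\<dots> \<le> 8 / N" using N2 by (intro divide_right_mono) auto
      finally show "2 * (J * (4 / N9)) \<le> 8 / N" .
    qed
    finally have "measure G.P {\<phi>\<in>space G.P. s_norm (n * p) s (gram_defect n m \<phi>) > \<delta>} \<le> 8 / N"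
      using N2 by (simp add: measure_def enn2real_leI)
    moreover have "{\<phi>\<in>space G.P. s_norm (n * p) s (gram_defect n m \<phi>) > \<delta>} \<in> sets G.P"
      by (rule s_norm_event_sets) (use s \<delta> in auto)
    ultimately show ?thesis unfolding probe_space_eq N_def by blast
  qed
  moreover have "0 < C9" by (simp add: C9_def)
  ultimately show ?thesis by (intro exI[of _ 8] exI[of _ C9]) auto
qed

end
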